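(* In the affine coordinates $w=(w_1,\dots,w_{k+1})\in\mathcal{O}_m$, the Laplace--Beltrami operator on $F_{m,2m,\dots,km}(\mathbb{C}^n)$ is given by $$\begin{aligned}\Delta_{F_{m,2m,\dots,km}(\mathbb{C}^n)}=&\,4\sum_{j=1}^{k+1}\sum_{p,r=1}^{n-m}\sum_{s,q=1}^m (I_{n-m}+w_jw_j^* )_{pr}(I_m+w_j^*w_j)_{sq}\frac{\partial^2}{\partial w_{j,pq}\,\partial\overline{w}_{j,rs}}\\&-2\sum_{1\le j\ne\ell\le k+1}\sum_{p,r=1}^{n-m}\sum_{s,q=1}^m (w_\ell-w_j)_{ps}(w_j-w_\ell)_{rq}\frac{\partial^2}{\partial w_{j,pq}\,\partial w_{\ell,rs}}\\&-2\sum_{1\le j\ne\ell\le k+1}\sum_{p,r=1}^{n-m}\sum_{s,q=1}^m (\overline{w}_\ell-\overline{w}_j)_{ps}(\overline{w}_j-\overline{w}_\ell)_{rq}\frac{\partial^2}{\partial\overline{w}_{j,pq}\,\partial\overline{w}_{\ell,rs}}.\end{aligned}$$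
   Context: Fix integers $k,m\ge 1$ and put $n=(k+1)m$. Matrices in the unitary group $\mathbf{U}(n)$ are written in $(k+1)\times(k+1)$ blocks of size $m\times m$. The Lie algebra $\mathfrak{u}(n)$ of skew-Hermitian matrices carries the inner product $\langle A,B\rangle=\frac12\mathrm{Tr}(AB^* )$, and $\mathbf{U}(n)$ carries the induced bi-invariant metric. $\mathbf{U}(m)^{k+1}\subset\mathbf{U}(n)$ is the subgroup of block-diagonal unitary matrices. The partial flag manifold is $F_{m,2m,\dots,km}(\mathbb{C}^n)=\mathbf{U}(n)/\mathbf{U}(m)^{k+1}$ with the metric making $\mathbf{U}(n)\to\mathbf{U}(n)/\mathbf{U}(m)^{k+1}$ a Riemannian submersion. Affine coordinates: let $\mathcal{D}_m$ be the set of $A=(A_{\ell j})\in\mathbf{U}(n)$ with $\det A_{(k+1)j}\ne 0$ for all $1\le j\le k+1$, and let $p:\mathcal{D}_m\to(\mathbb{C}^{(n-m)\times m})^{k+1}$ have $j$-th component $w_j$ equal to the $(n-m)\times m$ matrix with stacked blocks $A_{1j}A_{(k+1)j}^{-1},\dots,A_{kj}A_{(k+1)j}^{-1}$. Its image is $\mathcal{O}_m=\{(w_1,\dots,w_{k+1})\in(\mathbb{C}^{(n-m)\times m})^{k+1}: w_j^*w_\ell=-I_m \text{ for } 1\le j<\ell\le k+1\}$. The map $p$ induces a diffeomorphism from a dense open subset of $F_{m,2m,\dots,km}(\mathbb{C}^n)$ onto $\mathcal{O}_m$, through which the two are identified. $w_{j,pq}$ is the $(p,q)$ entry of $w_j$,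 and $\partial/\partial w_{j,pq}$, $\partial/\partial\overline{w}_{j,pq}$ are the Wirtinger derivatives in the ambient space $(\mathbb{C}^{(n-m)\times m})^{k+1}$. The formula means: for $f$ smooth on a neighbourhood of $\mathcal{O}_m$ in the ambient space, the Laplace--Beltrami operator applied to $f|_{\mathcal{O}_m}$ equals the restriction to $\mathcal{O}_m$ of the right-hand side applied to $f$. *)

theory Defs
  imports "HOL-Analysis.Analysis"
begin

section \<open>Smooth maps between Euclidean spaces\<close>

primrec Ck_on :: "nat \<Rightarrow> 'a::real_normed_vector set \<Rightarrow> ('a \<Rightarrow> 'b::real_normed_vector) \<Rightarrow> bool" where
  "Ck_on 0 S f \<longleftrightarrow> continuous_on S f"
| "Ck_on (Suc r) S f \<longleftrightarrow>
     (\<forall>x\<in>S. f differentiable (at x)) \<and> (\<forall>v. Ck_on r S (\<lambda>x. frechet_derivative f (at x) v))"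

text \<open>Only meant for open sets.\<close>

definition smooth_on :: "'a::real_normed_vector set \<Rightarrow> ('a \<Rightarrow> 'b::real_normed_vector) \<Rightarrow> bool" where
  "smooth_on S f \<longleftrightarrow> (\<forall>r. Ck_on r S f)"


section \<open>The Laplace--Beltrami operator of an embedded Riemannian manifold\<close>

text \<open>
  A manifold is a subset \<open>M\<close> of a Euclidean space; a Riemannian metric on it is a function
  \<open>G\<close> such that \<open>G x u v\<close> is the scalar product of the vectors \<open>u, v\<close> tangent to \<open>M\<close> at \<open>x\<close>
  (the value on other vectors is irrelevant). Charts are given by their inverses, the local
  parametrizations; the type \<open>'d\<close> is an index type whose cardinality is the dimension of \<open>M\<close>.
\<close>

definition partial_deriv :: "'d::finite \<Rightarrow> (real^'d \<Rightarrow> 'b::real_normed_vector) \<Rightarrow> real^'d \<Rightarrow> 'b" where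
  "partial_deriv a h x = frechet_derivative h (at x) (axis a 1)"

definition local_parametrization ::
    "'e::euclidean_space set \<Rightarrow> (real^'d::finite) set \<Rightarrow> (real^'d \<Rightarrow> 'e) \<Rightarrow> bool" where
  "local_parametrization M V \<phi> \<longleftrightarrow>
     open V \<and> smooth_on V \<phi> \<and>
     (\<forall>x\<in>V. inj (frechet_derivative \<phi> (at x))) \<and>
     openin (top_of_set M) (\<phi> ` V) \<and> (\<exists>\<psi>. homeomorphism V (\<phi> ` V) \<phi> \<psi>)"

definition gram :: "('e \<Rightarrow> 'e \<Rightarrow> 'e \<Rightarrow> real) \<Rightarrow> (real^'d::finite \<Rightarrow> 'e::euclidean_space) \<Rightarrow> real^'d \<Rightarrow> real^'d^'d" where
  "gram G \<phi> x = (\<chi> a b. G (\<phi> x) (partial_deriv a \<phi> x) (partial_deriv b \<phi> x))"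

definition laplace_beltrami_in_chart ::
    "('e \<Rightarrow> 'e \<Rightarrow> 'e \<Rightarrow> real) \<Rightarrow> (real^'d::finite \<Rightarrow> 'e::euclidean_space) \<Rightarrow>
     ('e \<Rightarrow> 'b::real_normed_vector) \<Rightarrow> real^'d \<Rightarrow> 'b" where
  "laplace_beltrami_in_chart G \<phi> f x =
     (1 / sqrt (det (gram G \<phi> x))) *\<^sub>R
       (\<Sum>a\<in>UNIV. partial_deriv a
          (\<lambda>y. sqrt (det (gram G \<phi> y)) *\<^sub>R
             (\<Sum>b\<in>UNIV. matrix_inv (gram G \<phi> y) $ a $ b *\<^sub>R partial_deriv b (f \<circ> \<phi>) y)) x)"

text \<open>
  The value at \<open>x\<close> is the one computed in any local parametrization around \<open>x\<close>. The first argument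
  only serves to name the index type \<open>'d\<close>.
\<close>

definition laplace_beltrami ::
    "'d::finite itself \<Rightarrow> 'e::euclidean_space set \<Rightarrow> ('e \<Rightarrow> 'e \<Rightarrow> 'e \<Rightarrow> real) \<Rightarrow>
     ('e \<Rightarrow> 'b::real_normed_vector) \<Rightarrow> 'e \<Rightarrow> 'b" where
  "laplace_beltrami d M G f x =
     (THE L. \<exists>V (\<phi> :: real^'d \<Rightarrow> 'e). \<exists>y\<in>V. local_parametrization M V \<phi> \<and> \<phi> y = x \<and>
        L = laplace_beltrami_in_chart G \<phi> f y)"


section \<open>The unitary group and affine coordinates on the flag manifold\<close>

text \<open>
  The integers \<open>k, m \<ge> 1\<close> are the cardinalities of \<open>'k\<close> and \<open>'m\<close>. Block indices
  \<open>1, \<dots>, k+1\<close> are elements of \<open>'k option\<close>, with \<open>None\<close> in the role of \<open>k+1\<close>. Rows and columns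
  of an \<open>n \<times> n\<close> matrix are indexed by pairs of a block index and a position within the block, and
  the \<open>n-m\<close> rows of a coordinate \<open>w\<^sub>j\<close> by \<open>'k \<times> 'm\<close>.
\<close>

type_synonym ('k, 'm) block_matrix = "complex^('k option \<times> 'm)^('k option \<times> 'm)"
type_synonym ('k, 'm) affine_space = "((complex^'m)^('k \<times> 'm))^('k option)"

definition ctranspose :: "complex^'n^'m \<Rightarrow> complex^'m^'n" where
  "ctranspose A = (\<chi> i j. cnj (A $ j $ i))"

definition unitary_group :: "(complex^'n^'n) set" where
  "unitary_group = {A. A ** ctranspose A = mat 1 \<and> ctranspose A ** A = mat 1}"

definition skew_hermitian :: "(complex^'n^'n) set" where
  "skew_hermitian = {X. ctranspose X = - X}"

text \<open>The trace below is real for skew-Hermitian arguments.\<close>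

definition u_inner :: "complex^'n^'n \<Rightarrow> complex^'n^'n \<Rightarrow> real" where
  "u_inner A B = Re (trace (A ** ctranspose B)) / 2"

definition block :: "('k::finite, 'm::finite) block_matrix \<Rightarrow> 'k option \<Rightarrow> 'k option \<Rightarrow> complex^'m^'m" where
  "block A l j = (\<chi> a b. A $ (l, a) $ (j, b))"

text \<open>The Lie algebra of the block-diagonal subgroup, and its orthogonal complement.\<close>

definition vertical :: "('k::finite, 'm::finite) block_matrix set" where
  "vertical = {Y \<in> skew_hermitian. \<forall>l j. l \<noteq> j \<longrightarrow> block Y l j = 0}"

definition horizontal :: "('k::finite, 'm::finite) block_matrix set" where
  "horizontal = {X \<in> skew_hermitian. \<forall>Y\<in>vertical. u_inner X Y = 0}"

definition affine_domain :: "('k::finite, 'm::finite) block_matrix set" where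
  "affine_domain = {A \<in> unitary_group. \<forall>j. det (block A None j) \<noteq> 0}"

definition affine_coords :: "('k::finite, 'm::finite) block_matrix \<Rightarrow> ('k, 'm) affine_space" where
  "affine_coords A = (\<chi> j la b. (block A (Some (fst la)) j ** matrix_inv (block A None j)) $ snd la $ b)"

text \<open>
  The condition for \<open>j < l\<close> is the conjugate transpose of the one for \<open>l < j\<close>, so no order on the
  block indices is needed.
\<close>

definition affine_image :: "('k::finite, 'm::finite) affine_space set" where
  "affine_image = {w. \<forall>j l. j \<noteq> l \<longrightarrow> ctranspose (w $ j) ** (w $ l) = - mat 1}"

text \<open>
  The metric that makes \<open>affine_coords\<close>, hence the quotient map it represents, a Riemannian
  submersion from \<open>affine_domain\<close> with the bi-invariant metric. The vectors tangent to the unitary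
  group at \<open>A\<close> are \<open>A ** X\<close> with \<open>X\<close> skew-Hermitian, and those orthogonal to the coset of \<open>A\<close> are
  the ones with \<open>X\<close> horizontal. The scalar product of \<open>u\<close> and \<open>v\<close> is that of their horizontal
  lifts to any point \<open>A\<close> over \<open>w\<close>.
\<close>

definition flag_metric ::
    "('k::finite, 'm::finite) affine_space \<Rightarrow> ('k, 'm) affine_space \<Rightarrow> ('k, 'm) affine_space \<Rightarrow> real" where
  "flag_metric w u v =
     (THE c. \<exists>A\<in>affine_domain. \<exists>X\<in>horizontal. \<exists>Y\<in>horizontal.
        affine_coords A = w \<and>
        frechet_derivative affine_coords (at A) (A ** X) = u \<and>
        frechet_derivative affine_coords (at A) (A ** Y) = v \<and>
        c = u_inner X Y)"

text \<open>The index type has \<open>(k+1) k m\<^sup>2 = n\<^sup>2 - (k+1) m\<^sup>2\<close> elements, the real dimension of the flag manifold.\<close>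

definition flag_laplacian ::
    "(('k::finite, 'm::finite) affine_space \<Rightarrow> complex) \<Rightarrow> ('k, 'm) affine_space \<Rightarrow> complex" where
  "flag_laplacian f w =
     laplace_beltrami TYPE('k option \<times> 'k \<times> 'm \<times> 'm) affine_image flag_metric f w"


section \<open>Wirtinger derivatives\<close>

definition coord_vec :: "'k option \<Rightarrow> 'k \<times> 'm \<Rightarrow> 'm \<Rightarrow> complex \<Rightarrow> ('k::finite, 'm::finite) affine_space" where
  "coord_vec j p q c = axis j (axis p (axis q c))"

definition wirtinger ::
    "'k option \<Rightarrow> 'k \<times> 'm \<Rightarrow> 'm \<Rightarrow> (('k::finite, 'm::finite) affine_space \<Rightarrow> complex) \<Rightarrow>
     ('k, 'm) affine_space \<Rightarrow> complex" where
  "wirtinger j p q f w =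
     (frechet_derivative f (at w) (coord_vec j p q 1) -
      \<i> * frechet_derivative f (at w) (coord_vec j p q \<i>)) / 2"

definition wirtinger_bar ::
    "'k option \<Rightarrow> 'k \<times> 'm \<Rightarrow> 'm \<Rightarrow> (('k::finite, 'm::finite) affine_space \<Rightarrow> complex) \<Rightarrow>
     ('k, 'm) affine_space \<Rightarrow> complex" where
  "wirtinger_bar j p q f w =
     (frechet_derivative f (at w) (coord_vec j p q 1) +
      \<i> * frechet_derivative f (at w) (coord_vec j p q \<i>)) / 2"

end

theory Submission
  imports Defs
begin

text \<open>
  The unitary group acts on the affine coordinates by matrix fractional linear transformations, and
  the flag metric is invariant. With the homogeneous coordinates \<open>W\<^sub>j = (w\<^sub>j; I)\<close> and their annihilators
  \<open>P\<^sub>j = (I, -w\<^sub>j)\<close>, the velocity field of \<open>\<xi> \<in> u(n)\<close> is \<open>K\<^sub>\<xi>(w)\<^sub>j = P\<^sub>j \<xi> W\<^sub>j\<close> (\<open>action_field\<close>), a quadratic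
  holomorphic field on the ambient space. Let \<open>\<xi>\<close> run through a Parseval frame of \<open>u(n)\<close> (\<open>u_frame\<close>).
  Then the Laplace--Beltrami operator is \<open>\<Sum>\<^sub>\<xi> K\<^sub>\<xi> K\<^sub>\<xi>\<close>, for two reasons.

  First, the metric at \<open>w\<close> is that of horizontal lifts, and the horizontal lift of \<open>K\<^sub>\<xi>(w)\<close> is the
  orthogonal projection of \<open>\<xi>\<close>. So Parseval's identity in \<open>u(n)\<close> descends to
  \<open>u = \<Sum>\<^sub>\<xi> \<langle>K\<^sub>\<xi>, u\<rangle> K\<^sub>\<xi>\<close> for tangent vectors \<open>u\<close> (\<open>flag_metric_eq\<close>, \<open>action_field_frame\<close>): the inverse
  metric is \<open>\<Sum>\<^sub>\<xi> K\<^sub>\<xi> \<otimes> K\<^sub>\<xi>\<close>, and the gradient of \<open>f\<close> is \<open>\<Sum>\<^sub>\<xi> (K\<^sub>\<xi> f) K\<^sub>\<xi>\<close>. Second, the brackets are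
  \<open>[K\<^sub>\<xi>, K\<^sub>\<eta>] = \<plusminus> K\<^bsub>[\<xi>,\<eta>]\<^esub>\<close>, and the inner product of \<open>u(n)\<close> is invariant under the adjoint action. Hence
  the Lie derivative of the inverse metric along \<open>K\<^sub>\<xi>\<close> vanishes, the fields are divergence free, and the
  divergence of the gradient is \<open>\<Sum>\<^sub>\<xi> K\<^sub>\<xi> (K\<^sub>\<xi> f)\<close>. The lemma
  \<open>laplace_beltrami_in_chart_killing_frame\<close> carries this out in an arbitrary local parametrization.
  Its tools are Jacobi's formula for the derivative of a determinant and the symmetry of second
  derivatives. Since every parametrization gives the same
  sum, the value does not depend on the chart.

  What remains is algebra: \<open>\<Sum>\<^sub>\<xi> \<xi> \<otimes> \<xi>\<close> is \<open>-2\<close> times the tensor that exchanges two factors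
  (\<open>sum_u_frame_mult\<close>). It follows that the first order part \<open>\<Sum>\<^sub>\<xi> DK\<^sub>\<xi>[K\<^sub>\<xi>]\<close> is zero, because \<open>P\<^sub>j W\<^sub>j = 0\<close>
  (\<open>sum_action_field_deriv_self\<close>). The pure second order coefficients are
  \<open>-2 (P\<^sub>j W\<^sub>l)\<^bsub>ps\<^esub> (P\<^sub>l W\<^sub>j)\<^bsub>rq\<^esub>\<close> with \<open>P\<^sub>j W\<^sub>l = w\<^sub>l - w\<^sub>j\<close>, and the mixed ones are twice
  \<open>2 (P\<^sub>j P\<^sub>l\<^sup>*)\<^bsub>pr\<^esub> (W\<^sub>l\<^sup>* W\<^sub>j)\<^bsub>sq\<^esub>\<close>, which vanish for \<open>j \<noteq> l\<close> because \<open>W\<^sub>l\<^sup>* W\<^sub>j = 0\<close> on the affine image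
  (\<open>sum_u_frame_bilinear\<close>).

  Finally, local parametrizations exist. The affine image is the zero set of a quadratic map whose
  derivative is onto at each of its zeros (\<open>surj_affine_constraint_deriv\<close>), so the implicit function theorem
  applies (\<open>regular_level_set_parametrization\<close>), and its tangent spaces are the kernels of these
  derivatives (\<open>range_derivative_local_parametrization\<close>).
\<close>

section \<open>Maps of class \<open>C\<^sup>k\<close>\<close>

lemma Ck_on_subset: "Ck_on r S f \<Longrightarrow> T \<subseteq> S \<Longrightarrow> Ck_on r T f"
  by (induction r arbitrary: f) (auto intro: continuous_on_subset)

lemma Ck_on_Suc_imp: "Ck_on (Suc r) S f \<Longrightarrow> Ck_on r S f"
proof (induction r arbitrary: f)
  case 0
  then show ?case
    by (auto intro!: differentiable_imp_continuous_on differentiable_at_imp_differentiable_on)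
qed simp

lemma Ck_on_cong:
  assumes "open S" "\<And>x. x \<in> S \<Longrightarrow> f x = g x" "Ck_on r S f"
  shows "Ck_on r S g"
  using assms(2,3)
proof (induction r arbitrary: f g)
  case 0
  then show ?case by (metis Ck_on.simps(1) continuous_on_cong)
next
  case (Suc r)
  have d: "(g has_derivative frechet_derivative f (at x)) (at x)" if "x \<in> S" for x
    using Suc.prems that
    by (auto simp: frechet_derivative_works intro: has_derivative_transform_within_open[OF _ \<open>open S\<close>])
  have "Ck_on r S (\<lambda>x. frechet_derivative g (at x) v)" for v
  proof (rule Suc.IH)
    show "frechet_derivative f (at x) v = frechet_derivative g (at x) v" if "x \<in> S" for x
      using frechet_derivative_at[OF d[OF that]] by simp
    show "Ck_on r S (\<lambda>x. frechet_derivative f (at x) v)"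
      using Suc.prems(2) by simp
  qed
  with d show ?case by (auto intro: differentiableI)
qed

lemma Ck_on_SucI:
  assumes "open S" "\<And>x. x \<in> S \<Longrightarrow> (f has_derivative f' x) (at x)"
    "\<And>v. Ck_on r S (\<lambda>x. f' x v)"
  shows "Ck_on (Suc r) S f"
proof -
  have "Ck_on r S (\<lambda>x. frechet_derivative f (at x) v)" for v
  proof (rule Ck_on_cong[OF \<open>open S\<close> _ assms(3)])
    show "f' x v = frechet_derivative f (at x) v" if "x \<in> S" for x
      using frechet_derivative_at[OF assms(2)[OF that]] by simp
  qed
  with assms(2) show ?thesis by (auto intro: differentiableI)
qed

lemma Ck_on_SucD:
  assumes "Ck_on (Suc r) S f"
  shows "\<And>x. x \<in> S \<Longrightarrow> (f has_derivative frechet_derivative f (at x)) (at x)"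
    and "Ck_on r S (\<lambda>x. frechet_derivative f (at x) v)"
  using assms by (auto simp: frechet_derivative_works)

lemma Ck_on_const: "open S \<Longrightarrow> Ck_on r S (\<lambda>x. c)"
  by (induction r arbitrary: c) auto

lemma Ck_on_linear_compose:
  assumes "open S" "bounded_linear L" "Ck_on r S f"
  shows "Ck_on r S (\<lambda>x. L (f x))"
  using assms(3)
proof (induction r arbitrary: f)
  case 0
  then show ?case by (auto intro: bounded_linear.continuous_on assms)
next
  case (Suc r)
  show ?case
    by (rule Ck_on_SucI[OF \<open>open S\<close> bounded_linear.has_derivative[OF assms(2) Ck_on_SucD(1)[OF Suc.prems]]])
      (auto intro: Suc.IH Ck_on_SucD[OF Suc.prems])
qed

lemma Ck_on_linear: "open S \<Longrightarrow> bounded_linear L \<Longrightarrow> Ck_on r S L"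
proof (cases r)
  case (Suc n)
  assume *: "open S" "bounded_linear L"
  show ?thesis unfolding Suc
    by (rule Ck_on_SucI[OF *(1)]) (auto intro: bounded_linear_imp_has_derivative Ck_on_const *)
qed (simp add: linear_continuous_on)

lemma Ck_on_add:
  assumes "open S" "Ck_on r S f" "Ck_on r S g"
  shows "Ck_on r S (\<lambda>x. f x + g x)"
  using assms(2,3)
proof (induction r arbitrary: f g)
  case (Suc r)
  show ?case
    by (rule Ck_on_SucI[OF \<open>open S\<close> has_derivative_add[OF Ck_on_SucD(1)[OF Suc.prems(1)] Ck_on_SucD(1)[OF Suc.prems(2)]]])
      (auto intro: Suc.IH Ck_on_SucD[OF Suc.prems(1)] Ck_on_SucD[OF Suc.prems(2)])
qed (simp add: continuous_on_add)

lemma Ck_on_sum: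
  assumes "open S" "finite I" "\<And>i. i \<in> I \<Longrightarrow> Ck_on r S (f i)"
  shows "Ck_on r S (\<lambda>x. \<Sum>i\<in>I. f i x)"
  using assms(2,3) by (induction I rule: finite_induct) (auto intro!: Ck_on_const Ck_on_add \<open>open S\<close>)

lemma Ck_on_bilinear:
  assumes "bounded_bilinear B" "open S" "Ck_on r S f" "Ck_on r S g"
  shows "Ck_on r S (\<lambda>x. B (f x) (g x))"
  using assms(3,4)
proof (induction r arbitrary: f g)
  case 0
  then show ?case by (auto intro: bounded_bilinear.continuous_on assms)
next
  case (Suc r)
  show ?case
    by (rule Ck_on_SucI[OF \<open>open S\<close> bounded_bilinear.FDERIV[OF assms(1)
            Ck_on_SucD(1)[OF Suc.prems(1)] Ck_on_SucD(1)[OF Suc.prems(2)]]])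
      (auto intro!: Suc.IH Ck_on_add \<open>open S\<close>
        intro: Ck_on_SucD[OF Suc.prems(1)] Ck_on_SucD[OF Suc.prems(2)] Ck_on_Suc_imp Suc.prems)
qed

lemmas Ck_on_mult = Ck_on_bilinear[OF bounded_bilinear_mult]
lemmas Ck_on_scaleR = Ck_on_bilinear[OF bounded_bilinear_scaleR]

lemma Ck_on_prod:
  fixes f :: "'i \<Rightarrow> 'a::real_normed_vector \<Rightarrow> 'b::real_normed_field"
  assumes "open S" "finite I" "\<And>i. i \<in> I \<Longrightarrow> Ck_on r S (f i)"
  shows "Ck_on r S (\<lambda>x. \<Prod>i\<in>I. f i x)"
  using assms(2,3) by (induction I rule: finite_induct) (auto intro!: Ck_on_const Ck_on_mult \<open>open S\<close>)

lemma Ck_on_inverse: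
  fixes g :: "'a::real_normed_vector \<Rightarrow> 'b::real_normed_field"
  assumes "open S" "Ck_on r S g" "\<And>x. x \<in> S \<Longrightarrow> g x \<noteq> 0"
  shows "Ck_on r S (\<lambda>x. inverse (g x))"
  using assms(2)
proof (induction r)
  case 0
  then show ?case using assms(3) by (auto intro: continuous_on_inverse)
next
  case (Suc r)
  show ?case
  proof (rule Ck_on_SucI[OF \<open>open S\<close>])
    show "((\<lambda>x. inverse (g x)) has_derivative
        (\<lambda>v. - (inverse (g x) * frechet_derivative g (at x) v * inverse (g x)))) (at x)" if "x \<in> S" for x
      using Deriv.has_derivative_inverse[OF assms(3)[OF that] Ck_on_SucD(1)[OF Suc.prems that]] .
    fix v
    have "Ck_on r S (\<lambda>x. inverse (g x))" "Ck_on r S (\<lambda>x. frechet_derivative g (at x) v)"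
      using Suc Ck_on_Suc_imp Ck_on_SucD(2) by blast+
    then have "Ck_on r S (\<lambda>x. -1 * (inverse (g x) * frechet_derivative g (at x) v * inverse (g x)))"
      by (intro Ck_on_mult Ck_on_const \<open>open S\<close>)
    then show "Ck_on r S (\<lambda>x. - (inverse (g x) * frechet_derivative g (at x) v * inverse (g x)))"
      by simp
  qed
qed

text \<open>
  The chain rule differentiates \<open>g\<close> in a direction that moves with the point. In a fixed basis this
  is a combination of derivatives in fixed directions, which are the ones that the definition of
  \<^const>\<open>Ck_on\<close> speaks of. The codomain of \<open>f\<close> is finite-dimensional for this reason.
\<close>

lemma Ck_on_compose:
  fixes f :: "'a::real_normed_vector \<Rightarrow> 'b::euclidean_space"
  assumes "open S" "f ` S \<subseteq> T" "Ck_on r T g" "Ck_on r S f"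
  shows "Ck_on r S (\<lambda>x. g (f x))"
  using assms(3,4)
proof (induction r arbitrary: g)
  case 0
  then show ?case using assms(2) by (auto intro: continuous_on_compose2)
next
  case (Suc r)
  let ?g = "\<lambda>x. frechet_derivative g (at x)" and ?f = "\<lambda>x. frechet_derivative f (at x)"
  have d: "((\<lambda>x. g (f x)) has_derivative (\<lambda>v. ?g (f x) (?f x v))) (at x)" if "x \<in> S" for x
    using that assms(2)
    by (intro has_derivative_compose[of f "?f x" x UNIV g] Ck_on_SucD(1)[OF Suc.prems(2)]
        Ck_on_SucD(1)[OF Suc.prems(1)]) auto
  have eq: "(\<Sum>b\<in>Basis. (?f x v \<bullet> b) *\<^sub>R ?g (f x) b) = ?g (f x) (?f x v)" if "x \<in> S" for x v
  proof -
    have "linear (?g (f x))"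
      using that assms(2) Ck_on_SucD(1)[OF Suc.prems(1)] by (auto intro: has_derivative_linear)
    then have "?g (f x) (\<Sum>b\<in>Basis. (?f x v \<bullet> b) *\<^sub>R b) = (\<Sum>b\<in>Basis. (?f x v \<bullet> b) *\<^sub>R ?g (f x) b)"
      by (simp add: linear_sum linear_cmul)
    then show ?thesis by (simp add: euclidean_representation)
  qed
  have "Ck_on r S (\<lambda>x. ?g (f x) (?f x v))" for v
  proof (rule Ck_on_cong[OF \<open>open S\<close> eq])
    show "Ck_on r S (\<lambda>x. \<Sum>b\<in>Basis. (?f x v \<bullet> b) *\<^sub>R ?g (f x) b)"
      by (intro Ck_on_sum Ck_on_scaleR \<open>open S\<close> finite_Basis Suc.IH
          Ck_on_linear_compose[OF _ bounded_linear_inner_left] Ck_on_SucD(2)[OF Suc.prems(1)]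
          Ck_on_SucD(2)[OF Suc.prems(2)] Ck_on_Suc_imp[OF Suc.prems(2)])
  qed
  then show ?case by (intro Ck_on_SucI[OF \<open>open S\<close> d])
qed

text \<open>
  The second difference is symmetric in \<open>u\<close> and \<open>v\<close>, and its quotient by \<open>s\<^sup>2\<close> converges to the
  derivative along \<open>v\<close> of the derivative along \<open>u\<close>. Hence the two mixed derivatives agree. The mean
  value theorem along \<open>u\<close> reduces the second difference to first derivatives.
\<close>

lemma second_difference_quotient:
  fixes f :: "'a::real_normed_vector \<Rightarrow> real"
  assumes "open S" "x \<in> S" and d: "\<And>y. y \<in> S \<Longrightarrow> (f has_derivative f' y) (at y)"
    and d2: "((\<lambda>y. f' y u) has_derivative D) (at x)"
  shows "((\<lambda>s. (f (x + s *\<^sub>R u + s *\<^sub>R v) - f (x + s *\<^sub>R u) - f (x + s *\<^sub>R v) + f x) / s\<^sup>2) \<longlongrightarrow> D v) (at_right 0)"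
proof (rule tendstoI)
  fix e :: real assume "e > 0"
  define c where "c = norm u + norm v + 1"
  have c: "c > 0" unfolding c_def by (smt (verit) norm_ge_zero)
  define e' where "e' = e / (4 * c)"
  have "e' > 0" using \<open>e > 0\<close> c by (simp add: e'_def)
  interpret D: bounded_linear D using d2 by (rule has_derivative_bounded_linear)
  obtain \<delta> where \<delta>: "\<delta> > 0" and
    est: "\<And>y. norm (y - x) < \<delta> \<Longrightarrow> \<bar>f' y u - f' x u - D (y - x)\<bar> \<le> e' * norm (y - x)"
    using d2 \<open>e' > 0\<close> unfolding has_derivative_at_alt by (metis real_norm_def)
  obtain \<rho> where \<rho>: "\<rho> > 0" "ball x \<rho> \<subseteq> S"
    using \<open>open S\<close> \<open>x \<in> S\<close> open_contains_ball by blast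
  define m where "m = min \<delta> \<rho> / c"
  have "m > 0" using \<delta> \<rho> c by (simp add: m_def)
  show "\<forall>\<^sub>F s in at_right 0. dist ((f (x + s *\<^sub>R u + s *\<^sub>R v) - f (x + s *\<^sub>R u) - f (x + s *\<^sub>R v) + f x) / s\<^sup>2) (D v) < e"
    unfolding eventually_at_right_field
  proof (intro exI[of _ m] conjI allI impI)
    fix s :: real assume s: "0 < s" "s < m"
    have sc: "s * c < \<delta>" "s * c < \<rho>"
      using s c by (auto simp: m_def field_simps)
    have small: "norm (t *\<^sub>R u + r *\<^sub>R v) \<le> s * (c - 1)" if "0 \<le> t" "t \<le> s" "0 \<le> r" "r \<le> s" for t r
    proof -
      have "norm (t *\<^sub>R u + r *\<^sub>R v) \<le> t * norm u + r * norm v"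
        using that norm_triangle_ineq[of "t *\<^sub>R u" "r *\<^sub>R v"] by simp
      also have "\<dots> \<le> s * norm u + s * norm v"
        using that by (intro add_mono mult_right_mono) auto
      finally show ?thesis by (simp add: c_def algebra_simps)
    qed
    have small': "norm (t *\<^sub>R u + r *\<^sub>R v) < s * c" if "0 \<le> t" "t \<le> s" "0 \<le> r" "r \<le> s" for t r
      using small[OF that] s by (simp add: algebra_simps)
    have inS: "x + t *\<^sub>R u + r *\<^sub>R v \<in> S" if "0 \<le> t" "t \<le> s" "0 \<le> r" "r \<le> s" for t r
    proof -
      have "dist x (x + t *\<^sub>R u + r *\<^sub>R v) = norm (t *\<^sub>R u + r *\<^sub>R v)"
        by (metis add.assoc add_diff_cancel_left' dist_commute dist_norm)
      then show ?thesis using \<rho>(2) small'[OF that] sc by (auto simp: subset_iff)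
    qed
    define h where "h t = f (x + t *\<^sub>R u + s *\<^sub>R v) - f (x + t *\<^sub>R u)" for t
    define h' where "h' t = f' (x + t *\<^sub>R u + s *\<^sub>R v) u - f' (x + t *\<^sub>R u) u" for t
    have dh: "(h has_real_derivative h' t) (at t)" if t: "0 \<le> t" "t \<le> s" for t
    proof -
      have *: "((\<lambda>t. f (x + t *\<^sub>R u + r *\<^sub>R v)) has_real_derivative f' (x + t *\<^sub>R u + r *\<^sub>R v) u) (at t)"
        if r: "0 \<le> r" "r \<le> s" for r
      proof -
        have lin: "linear (f' (x + t *\<^sub>R u + r *\<^sub>R v))"
          by (rule has_derivative_linear[OF d[OF inS[OF t r]]])
        have "((\<lambda>t. x + t *\<^sub>R u + r *\<^sub>R v) has_derivative (\<lambda>a. a *\<^sub>R u)) (at t)"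
          by (auto intro!: derivative_eq_intros)
        from has_derivative_compose[OF this d[OF inS[OF t r]]] show ?thesis
          by (simp add: has_field_derivative_def linear_cmul[OF lin] mult_commute_abs)
      qed
      from *[of s] *[of 0] show ?thesis
        unfolding h_def h'_def using s by (auto intro: DERIV_diff)
    qed
    have "\<exists>\<theta>>0. \<theta> < s \<and> h s - h 0 = (s - 0) * h' \<theta>"
      using dh s by (intro MVT2) auto
    then obtain \<theta> where \<theta>: "0 < \<theta>" "\<theta> < s" "h s - h 0 = s * h' \<theta>" by auto
    let ?p = "\<theta> *\<^sub>R u + s *\<^sub>R v" and ?q = "\<theta> *\<^sub>R u + 0 *\<^sub>R v"
    have p: "norm ?p < s * c" and q: "norm ?q < s * c"
      using \<theta> s by (auto intro!: small' simp del: scaleR_zero_left)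
    have ep: "\<bar>f' (x + ?p) u - f' x u - D ?p\<bar> \<le> e' * norm ?p"
      using est[of "x + ?p"] p sc by simp
    have eq: "\<bar>f' (x + ?q) u - f' x u - D ?q\<bar> \<le> e' * norm ?q"
      using est[of "x + ?q"] q sc by simp
    have Dv: "D ?p - D ?q = s * D v"
      by (simp add: D.add D.scaleR)
    have "\<bar>h' \<theta> - s * D v\<bar> \<le> e' * norm ?p + e' * norm ?q"
      using ep eq Dv unfolding h'_def by (simp add: add.assoc)
    also have "\<dots> \<le> e' * (s * c) + e' * (s * c)"
      using p q \<open>e' > 0\<close> by (intro add_mono mult_left_mono) auto
    also have "\<dots> = s * (e / 2)" using c by (simp add: e'_def field_simps)
    finally have "s * \<bar>h' \<theta> / s - D v\<bar> \<le> s * (e / 2)"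
      using s by (simp add: abs_mult_pos' right_diff_distrib)
    then have le: "\<bar>h' \<theta> / s - D v\<bar> \<le> e / 2" using s by simp
    have "f (x + s *\<^sub>R u + s *\<^sub>R v) - f (x + s *\<^sub>R u) - f (x + s *\<^sub>R v) + f x = s * h' \<theta>"
      using \<theta>(3) by (simp add: h_def)
    then have "(f (x + s *\<^sub>R u + s *\<^sub>R v) - f (x + s *\<^sub>R u) - f (x + s *\<^sub>R v) + f x) / s\<^sup>2 = h' \<theta> / s"
      using s by (simp add: power2_eq_square)
    then show "dist ((f (x + s *\<^sub>R u + s *\<^sub>R v) - f (x + s *\<^sub>R u) - f (x + s *\<^sub>R v) + f x) / s\<^sup>2) (D v) < e"
      using le \<open>e > 0\<close> by (simp add: dist_real_def)
  qed (fact \<open>m > 0\<close>)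
qed

lemma symmetric_second_derivative:
  fixes f :: "'a::real_normed_vector \<Rightarrow> 'b::euclidean_space"
  assumes "open S" "x \<in> S" and C2: "Ck_on 2 S f"
  shows "frechet_derivative (\<lambda>y. frechet_derivative f (at y) u) (at x) v =
         frechet_derivative (\<lambda>y. frechet_derivative f (at y) v) (at x) u"
proof (rule euclidean_eqI)
  fix b :: 'b assume "b \<in> Basis"
  have C2': "Ck_on (Suc (Suc 0)) S f" using C2 by (simp only: numeral_2_eq_2)
  let ?D = "\<lambda>u. frechet_derivative (\<lambda>y. frechet_derivative f (at y) u) (at x)"
  let ?g = "\<lambda>y. f y \<bullet> b"
  have d: "(?g has_derivative (\<lambda>u. frechet_derivative f (at y) u \<bullet> b)) (at y)" if "y \<in> S" for y
    using Ck_on_SucD(1)[OF C2' that] by (rule has_derivative_inner_left)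
  have d2: "((\<lambda>y. frechet_derivative f (at y) u \<bullet> b) has_derivative (\<lambda>v. ?D u v \<bullet> b)) (at x)" for u
    by (rule has_derivative_inner_left[OF Ck_on_SucD(1)[OF Ck_on_SucD(2)[OF C2'] \<open>x \<in> S\<close>]])
  note lim = second_difference_quotient[OF \<open>open S\<close> \<open>x \<in> S\<close> d d2]
  have "((\<lambda>s. (?g (x + s *\<^sub>R u + s *\<^sub>R v) - ?g (x + s *\<^sub>R u) - ?g (x + s *\<^sub>R v) + ?g x) / s\<^sup>2) \<longlongrightarrow> ?D v u \<bullet> b) (at_right 0)"
    using lim[of v u] by (simp add: add.commute add.left_commute algebra_simps)
  from tendsto_unique[OF _ lim[of u v] this] show "?D u v \<bullet> b = ?D v u \<bullet> b"
    by simp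
qed

section \<open>Derivatives of determinants and inverse matrices\<close>

lemma bounded_linear_axis: "bounded_linear (axis i :: 'b::real_normed_vector \<Rightarrow> 'b^'n)"
proof (rule bounded_linear_intro[where K=1])
  fix x :: 'b
  have "norm (axis i x :: 'b^'n) = norm x"
    by (simp add: norm_vec_def L2_set_def axis_def if_distrib[of norm] if_distrib[of "\<lambda>x. x^2"] cong: if_cong)
  then show "norm (axis i x :: 'b^'n) \<le> norm x * 1" by simp
qed (auto simp: axis_def vec_eq_iff)

lemma vec_eq_sum_axis: "x = (\<Sum>i\<in>UNIV. axis i (x $ i))" for x :: "'b::comm_monoid_add^'n"
  by (simp add: vec_eq_iff axis_def)

lemma has_derivative_vecI:
  fixes f :: "'a::real_normed_vector \<Rightarrow> 'b::real_normed_vector^'n"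
  assumes "\<And>i. ((\<lambda>x. f x $ i) has_derivative (\<lambda>v. f' v $ i)) F"
  shows "(f has_derivative f') F"
proof -
  have "((\<lambda>x. \<Sum>i\<in>UNIV. axis i (f x $ i)) has_derivative (\<lambda>v. \<Sum>i\<in>UNIV. axis i (f' v $ i))) F"
    by (intro has_derivative_sum bounded_linear.has_derivative[OF bounded_linear_axis] assms)
  then show ?thesis by (simp flip: vec_eq_sum_axis)
qed

lemma has_derivative_vec_nth:
  "(f has_derivative f') F \<Longrightarrow> ((\<lambda>x. f x $ i) has_derivative (\<lambda>v. f' v $ i)) F"
  by (rule bounded_linear.has_derivative[OF bounded_linear_vec_nth])

lemma differentiable_vecI:
  fixes f :: "'a::real_normed_vector \<Rightarrow> 'b::real_normed_vector^'n"
  assumes "\<And>i. (\<lambda>x. f x $ i) differentiable F"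
  shows "f differentiable F"
proof -
  obtain f' where "\<And>i. ((\<lambda>x. f x $ i) has_derivative f' i) F"
    using assms unfolding differentiable_def by metis
  then have "(f has_derivative (\<lambda>v. \<chi> i. f' i v)) F" by (intro has_derivative_vecI) simp
  then show ?thesis by (auto simp: differentiable_def)
qed

lemma Ck_on_vec_nth: "open S \<Longrightarrow> Ck_on r S f \<Longrightarrow> Ck_on r S (\<lambda>x. f x $ i)"
  by (rule Ck_on_linear_compose[OF _ bounded_linear_vec_nth])

lemma Ck_on_vecI:
  fixes f :: "'a::real_normed_vector \<Rightarrow> 'b::real_normed_vector^'n"
  assumes "open S" "\<And>i. Ck_on r S (\<lambda>x. f x $ i)"
  shows "Ck_on r S f"
proof -
  have "Ck_on r S (\<lambda>x. \<Sum>i\<in>UNIV. axis i (f x $ i))"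
    by (intro Ck_on_sum Ck_on_linear_compose[OF _ bounded_linear_axis] assms) simp
  then show ?thesis by (simp flip: vec_eq_sum_axis)
qed

lemma matrix_inv_inverse:
  fixes A :: "'f::field^'n^'n"
  assumes "det A \<noteq> 0"
  shows "A ** matrix_inv A = mat 1" "matrix_inv A ** A = mat 1"
proof -
  have "\<exists>A'. A ** A' = mat 1 \<and> A' ** A = mat 1"
    using assms unfolding invertible_det_nz[symmetric] invertible_def .
  then have "A ** matrix_inv A = mat 1 \<and> matrix_inv A ** A = mat 1"
    unfolding matrix_inv_def by (rule someI_ex)
  then show "A ** matrix_inv A = mat 1" "matrix_inv A ** A = mat 1" by auto
qed

lemma matrix_inv_eqI:
  fixes A B :: "'f::field^'n^'n"
  assumes "A ** B = mat 1"
  shows "matrix_inv A = B" "det A \<noteq> 0"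
proof -
  have "det A * det B = 1" using assms by (metis det_I det_mul)
  then show nz: "det A \<noteq> 0" by auto
  have "matrix_inv A ** (A ** B) = B"
    by (simp add: matrix_mul_assoc matrix_inv_inverse[OF nz])
  then show "matrix_inv A = B" by (simp add: assms)
qed

text \<open>
  Cramer's rule turns the entries of the inverse into quotients of polynomials in the entries of the
  matrix, which is all that differentiability and smoothness need.
\<close>

lemma matrix_inv_nth:
  fixes A :: "'f::field^'n^'n"
  assumes "det A \<noteq> 0"
  shows "matrix_inv A $ i $ j = det (\<chi> k l. if l = i then axis j 1 $ k else A $ k $ l) / det A"
proof -
  have "A *v (matrix_inv A *v axis j 1) = axis j 1"
    by (simp add: matrix_vector_mul_assoc matrix_inv_inverse[OF assms])
  then have "(matrix_inv A *v axis j 1) $ i = det (\<chi> k l. if l = i then axis j 1 $ k else A $ k $ l) / det A"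
    unfolding cramer[OF assms] by simp
  moreover have "(matrix_inv A *v axis j 1) $ i = matrix_inv A $ i $ j"
    by (simp add: matrix_vector_mult_def axis_def if_distrib cong: if_cong)
  ultimately show ?thesis by simp
qed

lemma Ck_on_det:
  fixes M :: "'a::real_normed_vector \<Rightarrow> 'f::real_normed_field^'n^'n"
  assumes "open S" "\<And>i j. Ck_on r S (\<lambda>x. M x $ i $ j)"
  shows "Ck_on r S (\<lambda>x. det (M x))"
  unfolding det_def by (intro Ck_on_sum Ck_on_mult Ck_on_prod Ck_on_const assms) auto

lemma Ck_on_matrix_inv_nth:
  fixes M :: "'a::real_normed_vector \<Rightarrow> 'f::real_normed_field^'n^'n"
  assumes "open S" "\<And>i j. Ck_on r S (\<lambda>x. M x $ i $ j)" "\<And>x. x \<in> S \<Longrightarrow> det (M x) \<noteq> 0"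
  shows "Ck_on r S (\<lambda>x. matrix_inv (M x) $ i $ j)"
proof (rule Ck_on_cong[OF \<open>open S\<close>])
  show "det (\<chi> k l. if l = i then axis j 1 $ k else M x $ k $ l) * inverse (det (M x)) =
      matrix_inv (M x) $ i $ j" if "x \<in> S" for x
    by (simp add: matrix_inv_nth[OF assms(3)[OF that]] divide_inverse)
  have "Ck_on r S (\<lambda>x. if l = i then axis j 1 $ k else M x $ k $ l)" for k l
    by (cases "l = i") (auto intro: assms Ck_on_const)
  then show "Ck_on r S (\<lambda>x. det (\<chi> k l. if l = i then axis j 1 $ k else M x $ k $ l) * inverse (det (M x)))"
    by (intro Ck_on_mult Ck_on_inverse Ck_on_det assms) auto
qed

lemma differentiable_det:
  fixes M :: "'a::real_normed_vector \<Rightarrow> 'f::real_normed_field^'n^'n"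
  assumes "\<And>i j. (\<lambda>x. M x $ i $ j) differentiable (at x)"
  shows "(\<lambda>x. det (M x)) differentiable (at x)"
proof -
  obtain M' where "\<And>i j. ((\<lambda>x. M x $ i $ j) has_derivative M' i j) (at x)"
    using assms unfolding differentiable_def by metis
  then have "((\<lambda>x. \<Sum>p\<in>{p. p permutes UNIV}. of_int (sign p) * (\<Prod>i\<in>UNIV. M x $ i $ p i)) has_derivative
     (\<lambda>v. \<Sum>p\<in>{p. p permutes UNIV}. of_int (sign p) *
        (\<Sum>i\<in>UNIV. M' i (p i) v * (\<Prod>j\<in>UNIV - {i}. M x $ j $ p j)))) (at x)"
    by (intro has_derivative_sum has_derivative_mult_right has_derivative_prod)
  then show ?thesis unfolding det_def by (rule differentiableI)
qed

lemma differentiable_matrix_inv: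
  fixes M :: "'a::real_normed_vector \<Rightarrow> 'f::real_normed_field^'n^'n"
  assumes diff: "\<And>i j. (\<lambda>x. M x $ i $ j) differentiable (at x)" and nz: "det (M x) \<noteq> 0"
  shows "(\<lambda>x. matrix_inv (M x)) differentiable (at x)"
proof -
  have "(\<lambda>x. matrix_inv (M x) $ i $ j) differentiable (at x)" for i j
  proof -
    have "(\<lambda>x. if l = i then axis j 1 $ k else M x $ k $ l) differentiable (at x)" for k l
      by (cases "l = i") (auto intro: diff)
    then have "(\<lambda>x. det (\<chi> k l. if l = i then axis j 1 $ k else M x $ k $ l)) differentiable (at x)"
      by (intro differentiable_det) simp
    with differentiable_det[OF diff]
    have q: "(\<lambda>x. det (\<chi> k l. if l = i then axis j 1 $ k else M x $ k $ l) / det (M x)) differentiable (at x)"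
      using nz by (intro differentiable_divide)
    have "isCont (\<lambda>x. det (M x)) x"
      by (intro differentiable_imp_continuous_within differentiable_det diff)
    then obtain e where e: "e > 0" "\<And>y. y \<in> ball x e \<Longrightarrow> det (M y) \<noteq> 0"
      using continuous_at_avoid[of x "\<lambda>x. det (M x)" 0] nz by auto
    obtain D where D: "((\<lambda>x. det (\<chi> k l. if l = i then axis j 1 $ k else M x $ k $ l) / det (M x)) has_derivative D) (at x)"
      using q unfolding differentiable_def by blast
    have "((\<lambda>x. matrix_inv (M x) $ i $ j) has_derivative D) (at x)"
    proof (rule has_derivative_transform_within_open[OF D open_ball[of x e]])
      show "det (\<chi> k l. if l = i then axis j 1 $ k else M y $ k $ l) / det (M y) = matrix_inv (M y) $ i $ j"
        if "y \<in> ball x e" for y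
        by (rule matrix_inv_nth[OF e(2)[OF that], symmetric])
    qed (use e(1) in simp)
    then show ?thesis by (rule differentiableI)
  qed
  then show ?thesis by (intro differentiable_vecI)
qed

lemma has_derivative_det_at_mat_1:
  fixes M :: "'a::real_normed_vector \<Rightarrow> 'f::real_normed_field^'n^'n"
  assumes M': "(M has_derivative M') (at x)" and "M x = mat 1"
  shows "((\<lambda>x. det (M x)) has_derivative (\<lambda>v. trace (M' v))) (at x)"
proof -
  have *: "((\<lambda>x. det (M x)) has_derivative
     (\<lambda>v. \<Sum>p\<in>{p. p permutes UNIV}. of_int (sign p) *
        (\<Sum>i\<in>UNIV. M' v $ i $ p i * (\<Prod>j\<in>UNIV - {i}. M x $ j $ p j)))) (at x)"
    unfolding det_def
    by (intro has_derivative_sum has_derivative_mult_right has_derivative_prod has_derivative_vec_nth M')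
  have "(\<Sum>p\<in>{p. p permutes UNIV}. of_int (sign p) *
        (\<Sum>i\<in>UNIV. M' v $ i $ p i * (\<Prod>j\<in>UNIV - {i}. M x $ j $ p j))) = trace (M' v)" for v
  proof -
    \<comment> \<open>A permutation that moves a point moves at least two, so one of the remaining factors is an off-diagonal entry.\<close>
    have 0: "(\<Prod>j\<in>UNIV - {i}. M x $ j $ p j) = 0" if p: "p permutes UNIV" "p \<noteq> id" for p and i :: 'n
    proof -
      obtain j where j: "p j \<noteq> j" using p(2) by (auto simp: fun_eq_iff)
      have "\<exists>j. j \<noteq> i \<and> p j \<noteq> j"
      proof (cases "j = i")
        case True
        then have "p (p j) \<noteq> p j" "p j \<noteq> i"
          using j permutes_inj[OF p(1)] by (auto dest: injD)
        then show ?thesis by blast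
      qed (use j in auto)
      then obtain j where "j \<in> UNIV - {i}" "p j \<noteq> j" by blast
      then show ?thesis
        by (intro prod_zero bexI[of _ j]) (auto simp: assms(2) mat_def)
    qed
    have "(\<Sum>p\<in>{p. p permutes UNIV}. of_int (sign p) *
        (\<Sum>i\<in>UNIV. M' v $ i $ p i * (\<Prod>j\<in>UNIV - {i}. M x $ j $ p j))) =
      (\<Sum>p\<in>{id}. of_int (sign p) *
        (\<Sum>i\<in>UNIV. M' v $ i $ p i * (\<Prod>j\<in>UNIV - {i}. M x $ j $ p j)))"
      by (rule sum.mono_neutral_right) (auto simp: 0 permutes_id)
    then show ?thesis by (simp add: trace_def assms(2) mat_def)
  qed
  with * show ?thesis by simp
qed

text \<open>Jacobi's formula, by translation to the identity matrix.\<close>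

lemma has_derivative_det:
  fixes M :: "'a::real_normed_vector \<Rightarrow> real^'n^'n"
  assumes M': "(M has_derivative M') (at x)" and nz: "det (M x) \<noteq> 0"
  shows "((\<lambda>x. det (M x)) has_derivative (\<lambda>v. det (M x) * trace (matrix_inv (M x) ** M' v))) (at x)"
proof -
  let ?I = "matrix_inv (M x)"
  have bl: "bounded_linear (\<lambda>X. ?I ** X)"
    by (intro linear_conv_bounded_linear[THEN iffD1] linearI)
      (simp_all add: vec_eq_iff matrix_matrix_mult_def sum_distrib_left sum.distrib algebra_simps)
  have "((\<lambda>y. det (?I ** M y)) has_derivative (\<lambda>v. trace (?I ** M' v))) (at x)"
    by (intro has_derivative_det_at_mat_1 bounded_linear.has_derivative[OF bl] M' matrix_inv_inverse nz)
  then have "((\<lambda>y. det (M x) * det (?I ** M y)) has_derivative (\<lambda>v. det (M x) * trace (?I ** M' v))) (at x)"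
    by (rule has_derivative_mult_right)
  moreover have "det (M x) * det (?I ** M y) = det (M y)" for y
    by (metis det_mul matrix_inv_inverse(1)[OF nz] matrix_mul_assoc matrix_mul_lid)
  ultimately show ?thesis by simp
qed

section \<open>Regular level sets\<close>

lemma dim_kernel_of_surjective:
  fixes L :: "'e::euclidean_space \<Rightarrow> 'c::euclidean_space"
  assumes "linear L" "surj L"
  shows "dim {v. L v = 0} + DIM('c) = DIM('e)"
proof -
  obtain C where C: "linear C" "L \<circ> C = id"
    using linear_surjective_right_inverse[OF assms] by blast
  then have LC: "L (C s) = s" for s by (metis comp_apply id_apply)
  have sub: "subspace {v. L v = 0}" "subspace (range C)"
    using assms(1) C(1) by (auto intro: linear_subspace_kernel linear_subspace_image)
  have "inj C" using LC by (metis injI)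
  then have "dim (range C) = DIM('c)"
    using dim_image_eq[of C UNIV] C(1) by (simp add: inj_on_subset)
  moreover have "{v. L v = 0} \<inter> range C = {0}"
    using LC C(1) assms(1) by (auto simp: linear_0 image_iff) (metis linear_0)+
  moreover have "{x + y |x y. x \<in> {v. L v = 0} \<and> y \<in> range C} = UNIV"
  proof -
    have "v = (v - C (L v)) + C (L v)" "L (v - C (L v)) = 0" for v
      using LC assms(1) by (auto simp: linear_diff)
    then show ?thesis by blast
  qed
  ultimately show ?thesis
    using dim_sums_Int[OF sub] by simp
qed

text \<open>
  Implicit function theorem. Split \<open>'e\<close> into the kernel of the derivative at \<open>w0\<close> (the image of
  \<open>J\<close>) and a complement (the image of \<open>C\<close>); the inverse function theorem for
  \<open>(t, s) \<mapsto> (t, F (w0 + J t + C s))\<close> solves \<open>F = 0\<close> for \<open>s\<close>. Differentiating the equation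
  expresses the derivative of the solution through the solution itself, which gives smoothness to
  all orders by induction.
\<close>

theorem regular_level_set_parametrization:
  fixes F :: "'e::euclidean_space \<Rightarrow> real^'c"
  assumes smooth: "smooth_on UNIV F" and dim: "DIM('e) = CARD('d::finite) + CARD('c)"
    and F0: "F w0 = 0" and surj: "surj (frechet_derivative F (at w0))"
  shows "\<exists>V (\<phi> :: real^'d \<Rightarrow> 'e). local_parametrization {w. F w = 0} V \<phi> \<and> w0 \<in> \<phi> ` V"
proof -
  define DF where "DF w = frechet_derivative F (at w)" for w
  have Ck: "Ck_on r UNIV F" for r using smooth by (simp add: smooth_on_def)
  have dF: "(F has_derivative DF w) (at w)" for w
    unfolding DF_def by (rule Ck_on_SucD(1)[OF Ck]) simp
  have linDF: "linear (DF w)" for w by (rule has_derivative_linear[OF dF])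
  have CkDF: "Ck_on r UNIV (\<lambda>w. DF w v)" for r v
    unfolding DF_def by (rule Ck_on_SucD(2)[OF Ck])
  obtain C where C: "linear C" "DF w0 \<circ> C = id"
    using linear_surjective_right_inverse[OF linDF surj[folded DF_def]] by blast
  have LC: "DF w0 (C s) = s" for s using C(2) by (metis comp_apply id_apply)
  have "dim {v. DF w0 v = 0} = dim (UNIV :: (real^'d) set)"
    using dim_kernel_of_surjective[OF linDF surj[folded DF_def]] dim by simp
  moreover have "subspace {v. DF w0 v = 0}"
    by (rule linear_subspace_kernel[OF linDF])
  ultimately obtain J :: "real^'d \<Rightarrow> 'e" where J: "linear J" "range J = {v. DF w0 v = 0}" "inj J"
    using subspace_isomorphism[OF subspace_UNIV] by metis
  obtain J' where J': "linear J'" "J' \<circ> J = id"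
    using linear_injective_left_inverse[OF J(1,3)] by blast
  have J'J: "J' (J t) = t" for t using J'(2) by (metis comp_apply id_apply)
  have LJ: "DF w0 (J t) = 0" for t using J(2) by blast
  define \<iota> where "\<iota> z = w0 + J (fst z) + C (snd z)" for z :: "(real^'d) \<times> (real^'c)"
  define \<kappa> where "\<kappa> w = (J' ((w - w0) - C (DF w0 (w - w0))), DF w0 (w - w0))" for w
  have \<kappa>\<iota>: "\<kappa> (\<iota> z) = z" for z
    using linear_add[OF linDF] by (simp add: \<kappa>_def \<iota>_def add.assoc LJ LC J'J)
  have \<iota>\<kappa>: "\<iota> (\<kappa> w) = w" for w
  proof -
    have "DF w0 ((w - w0) - C (DF w0 (w - w0))) = 0"
      using linDF[of w0] by (simp add: linear_diff LC)
    then obtain t where t: "(w - w0) - C (DF w0 (w - w0)) = J t" using J(2) by blast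
    then have "\<iota> (\<kappa> w) = w0 + J t + C (DF w0 (w - w0))" by (simp only: \<kappa>_def \<iota>_def J'J fst_conv snd_conv)
    also have "\<dots> = w" unfolding t[symmetric] by simp
    finally show ?thesis .
  qed
  have blJ: "bounded_linear J" and blC: "bounded_linear C" and blJ': "bounded_linear J'"
    using J(1) C(1) J'(1) by (auto simp: linear_conv_bounded_linear)
  have blDF: "bounded_linear (DF w)" for w using linDF by (simp add: linear_conv_bounded_linear)
  have cont\<kappa>: "continuous_on UNIV \<kappa>"
    unfolding \<kappa>_def
    by (intro continuous_intros bounded_linear.continuous_on[OF blJ'] bounded_linear.continuous_on[OF blC]
        bounded_linear.continuous_on[OF blDF])
  have d\<iota>: "(\<iota> has_derivative (\<lambda>h. J (fst h) + C (snd h))) (at z)" for z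
    unfolding \<iota>_def
    by (auto intro!: derivative_eq_intros bounded_linear.has_derivative[OF blJ] bounded_linear.has_derivative[OF blC])
  have cont\<iota>: "continuous_on S \<iota>" for S
    using d\<iota> by (meson has_derivative_at_withinI has_derivative_continuous_on)
  define \<Phi> where "\<Phi> z = (fst z, F (\<iota> z))" for z
  define \<Phi>' where "\<Phi>' z h = (fst h, DF (\<iota> z) (J (fst h) + C (snd h)))" for z h
  have d\<Phi>: "(\<Phi> has_derivative \<Phi>' z) (at z)" for z
    unfolding \<Phi>_def \<Phi>'_def
    by (intro has_derivative_Pair has_derivative_fst has_derivative_ident has_derivative_compose[OF d\<iota> dF])
  then have bl\<Phi>': "bounded_linear (\<Phi>' z)" for z by (rule has_derivative_bounded_linear)
  have contDF: "continuous_on UNIV (\<lambda>w. DF w v)" for v using CkDF[of 0] by simp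
  have "continuous_on UNIV (\<lambda>z. \<Phi>' z h)" for h
    unfolding \<Phi>'_def by (intro continuous_intros continuous_on_compose2[OF contDF cont\<iota>]) auto
  then have cont\<Phi>': "continuous_on UNIV (\<lambda>z. Blinfun (\<Phi>' z))"
    by (intro continuous_on_blinfun_componentwise) (simp add: bounded_linear_Blinfun_apply[OF bl\<Phi>'])
  have "\<iota> 0 = w0" using J(1) C(1) by (simp add: \<iota>_def linear_0)
  then have \<Phi>'0: "\<Phi>' 0 = id"
    using linear_add[OF linDF] by (simp add: \<Phi>'_def LJ LC fun_eq_iff)
  have \<Phi>0: "\<Phi> 0 = 0" using \<open>\<iota> 0 = w0\<close> F0 by (simp add: \<Phi>_def zero_prod_def)
  obtain U' V' g g' where U': "open U'" "0 \<in> U'" and V': "open V'" "0 \<in> V'"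
    and hom: "homeomorphism U' V' \<Phi> g"
    and dg: "\<And>y. y \<in> V' \<Longrightarrow> (g has_derivative g' y) (at y)"
    and g': "\<And>y. y \<in> V' \<Longrightarrow> g' y = inv (\<Phi>' (g y))"
    and bij: "\<And>y. y \<in> V' \<Longrightarrow> bij (\<Phi>' (g y))"
  proof (rule inverse_function_theorem[of UNIV \<Phi> "\<lambda>z. Blinfun (\<Phi>' z)" 0 id_blinfun])
    show "id_blinfun o\<^sub>L Blinfun (\<Phi>' 0) = id_blinfun"
      using bounded_linear_Blinfun_apply[OF bl\<Phi>', of 0] by (intro blinfun_eqI) (simp add: \<Phi>'0)
  qed (use d\<Phi> cont\<Phi>' \<Phi>0 in \<open>auto simp: bounded_linear_Blinfun_apply[OF bl\<Phi>']\<close>)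
  define V :: "(real^'d) set" where "V = {t. (t, 0) \<in> V'}"
  define \<phi> where "\<phi> t = \<iota> (g (t, 0))" for t
  have "open V"
  proof -
    have "V = (\<lambda>t. (t, 0)) -` V'" by (auto simp: V_def)
    then show ?thesis using V'(1) by (simp add: open_vimage continuous_on_Pair)
  qed
  have \<Phi>g: "\<Phi> (g (t, 0)) = (t, 0)" "g (t, 0) \<in> U'" if "t \<in> V" for t
    using that hom by (auto simp: V_def homeomorphism_def)
  have fst_g: "fst (g (t, 0)) = t" and F\<phi>: "F (\<phi> t) = 0" if "t \<in> V" for t
    using \<Phi>g[OF that] by (auto simp: \<Phi>_def \<phi>_def)

  \<comment> \<open>The derivative of \<open>F\<close> in the directions of the complement, as a matrix. Where it is invertible,
    \<open>\<Theta> v\<close> is the derivative along \<open>v\<close> of the solution through a given point.\<close>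
  define M :: "'e \<Rightarrow> real^'c^'c" where "M w = (\<chi> i j. DF w (C (axis j 1)) $ i)" for w
  have M: "M w *v s = DF w (C s)" for w s
  proof -
    have lin: "linear (\<lambda>s. DF w (C s))"
      using linear_compose[OF C(1) linDF] by (simp add: o_def)
    have "DF w (C (\<Sum>i\<in>UNIV. s $ i *\<^sub>R axis i 1)) = (\<Sum>i\<in>UNIV. s $ i *\<^sub>R DF w (C (axis i 1)))"
      by (simp add: linear_sum[OF lin] linear_cmul[OF lin])
    moreover have "(\<Sum>i\<in>UNIV. s $ i *\<^sub>R axis i 1) = s"
      using basis_expansion[of s] by (simp add: scalar_mult_eq_scaleR)
    ultimately show ?thesis
      by (simp add: M_def matrix_vector_mult_def vec_eq_iff mult.commute)
  qed
  define T where "T = {w. det (M w) \<noteq> 0}"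
  have CkM: "Ck_on r UNIV (\<lambda>w. M w $ i $ j)" for r i j
    unfolding M_def by (simp add: Ck_on_vec_nth CkDF)
  have "continuous_on UNIV (\<lambda>w. det (M w))"
    using Ck_on_det[of UNIV 0 M] CkM[of 0] by simp
  then have "open T"
    unfolding T_def by (intro open_Collect_neq) (auto intro: continuous_intros)
  define \<Theta> where "\<Theta> v w = J v - C (matrix_inv (M w) *v DF w (J v))" for v w
  have Ck\<Theta>: "Ck_on r T (\<Theta> v)" for r v
  proof -
    have 1: "Ck_on r T (\<lambda>w. matrix_inv (M w) $ i $ j)" for i j
      by (intro Ck_on_matrix_inv_nth \<open>open T\<close> Ck_on_subset[OF CkM]) (auto simp: T_def)
    have 2: "Ck_on r T (\<lambda>w. DF w (J v) $ j)" for j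
      by (intro Ck_on_vec_nth \<open>open T\<close> Ck_on_subset[OF CkDF]) auto
    have "Ck_on r T (\<lambda>w. matrix_inv (M w) *v DF w (J v))"
      by (rule Ck_on_vecI[OF \<open>open T\<close>])
        (auto simp: matrix_vector_mult_def intro!: Ck_on_sum Ck_on_mult 1 2 \<open>open T\<close>)
    then have "Ck_on r T (\<lambda>w. J v + (-1) *\<^sub>R C (matrix_inv (M w) *v DF w (J v)))"
      by (intro Ck_on_add Ck_on_scaleR Ck_on_const Ck_on_linear_compose[OF _ blC] \<open>open T\<close>)
    then show ?thesis by (simp add: \<Theta>_def[abs_def])
  qed
  have \<phi>T: "\<phi> t \<in> T" and d\<phi>: "(\<phi> has_derivative (\<lambda>v. \<Theta> v (\<phi> t))) (at t)"
    and inj\<Theta>: "inj (\<lambda>v. \<Theta> v (\<phi> t))" if t: "t \<in> V" for t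
  proof -
    have tV': "(t, 0) \<in> V'" using t by (simp add: V_def)
    have "s = 0" if "M (\<phi> t) *v s = 0" for s
    proof -
      have "\<Phi>' (g (t, 0)) (0, s) = \<Phi>' (g (t, 0)) (0, 0)"
        using that linDF J(1) C(1) by (simp add: \<Phi>'_def M \<phi>_def linear_0)
      then show ?thesis using bij[OF tV'] by (auto simp: bij_def dest: injD)
    qed
    then show T: "\<phi> t \<in> T"
      unfolding T_def by (simp add: invertible_det_nz[symmetric] invertible_left_inverse matrix_left_invertible_ker)
    have *: "((\<lambda>t. g (t, 0)) has_derivative (\<lambda>v. g' (t, 0) (v, 0))) (at t)"
      by (rule has_derivative_compose[where f="\<lambda>t. (t, 0)" and g=g, OF _ dg[OF tV']])
        (intro has_derivative_Pair has_derivative_ident has_derivative_const)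
    have eq: "J (fst (g' (t, 0) (v, 0))) + C (snd (g' (t, 0) (v, 0))) = \<Theta> v (\<phi> t)" for v
    proof -
      let ?h = "g' (t, 0) (v, 0)"
      have "\<Phi>' (g (t, 0)) ?h = (v, 0)"
        using g'[OF tV'] bij[OF tV'] by (simp add: bij_def surj_f_inv_f)
      then have h: "fst ?h = v" "DF (\<phi> t) (J v) + M (\<phi> t) *v snd ?h = 0"
        using linear_add[OF linDF] by (auto simp: \<Phi>'_def M \<phi>_def)
      have "matrix_inv (M (\<phi> t)) *v (M (\<phi> t) *v snd ?h) = snd ?h"
        using T by (simp add: T_def matrix_vector_mul_assoc matrix_inv_inverse)
      moreover have "M (\<phi> t) *v snd ?h = - DF (\<phi> t) (J v)" using h(2) by (simp add: eq_neg_iff_add_eq_0 add.commute)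
      ultimately have "snd ?h = - (matrix_inv (M (\<phi> t)) *v DF (\<phi> t) (J v))"
        by (metis matrix_vector_mult_diff_distrib diff_0 matrix_vector_mult_0_right)
      then show ?thesis using C(1) by (simp add: \<Theta>_def h(1) linear_neg)
    qed
    show "(\<phi> has_derivative (\<lambda>v. \<Theta> v (\<phi> t))) (at t)"
      using has_derivative_compose[OF * d\<iota>] unfolding eq \<phi>_def .
    show "inj (\<lambda>v. \<Theta> v (\<phi> t))"
    proof (rule injI)
      fix a b assume "\<Theta> a (\<phi> t) = \<Theta> b (\<phi> t)"
      then have "\<kappa> (w0 + \<Theta> a (\<phi> t)) = \<kappa> (w0 + \<Theta> b (\<phi> t))" by simp
      moreover have "fst (\<kappa> (w0 + \<Theta> v (\<phi> t))) = v" for v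
      proof -
        have "w0 + \<Theta> v (\<phi> t) = \<iota> (v, - (matrix_inv (M (\<phi> t)) *v DF (\<phi> t) (J v)))"
          using C(1) by (simp add: \<Theta>_def \<iota>_def linear_neg)
        then show ?thesis by (simp add: \<kappa>\<iota>)
      qed
      ultimately show "a = b" by metis
    qed
  qed
  have Ck\<phi>: "Ck_on r V \<phi>" for r
  proof (induction r)
    case 0
    then show ?case
      unfolding Ck_on.simps by (rule has_derivative_continuous_on) (rule has_derivative_at_withinI[OF d\<phi>])
  next
    case (Suc r)
    show ?case
    proof (rule Ck_on_SucI[OF \<open>open V\<close> d\<phi>])
      fix v show "Ck_on r V (\<lambda>t. \<Theta> v (\<phi> t))"
        using \<phi>T by (intro Ck_on_compose[OF \<open>open V\<close> _ Ck\<Theta> Suc]) auto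
    qed
  qed
  have img: "\<phi> ` V = {w. F w = 0} \<inter> \<kappa> -` U'"
  proof (intro equalityI subsetI)
    fix w assume "w \<in> \<phi> ` V"
    then show "w \<in> {w. F w = 0} \<inter> \<kappa> -` U'" using F\<phi> \<Phi>g(2) by (auto simp: \<phi>_def \<kappa>\<iota>)
  next
    fix w assume "w \<in> {w. F w = 0} \<inter> \<kappa> -` U'"
    then have w: "F w = 0" "\<kappa> w \<in> U'" by auto
    have *: "\<Phi> (\<kappa> w) = (fst (\<kappa> w), 0)" using w(1) by (simp add: \<Phi>_def \<iota>\<kappa>)
    then have "(fst (\<kappa> w), 0) \<in> V'" "g (fst (\<kappa> w), 0) = \<kappa> w"
      using w(2) hom unfolding homeomorphism_def by (metis imageI, metis)
    then have "fst (\<kappa> w) \<in> V" "\<phi> (fst (\<kappa> w)) = w" by (auto simp: V_def \<phi>_def \<iota>\<kappa>)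
    then show "w \<in> \<phi> ` V" by (metis imageI)
  qed
  have "open (\<kappa> -` U')" using cont\<kappa> U'(1) by (rule open_vimage[rotated])
  then have ope: "openin (top_of_set {w. F w = 0}) (\<phi> ` V)"
    unfolding img by (rule openin_open_Int)
  have "homeomorphism V (\<phi> ` V) \<phi> (\<lambda>w. fst (\<kappa> w))"
    using Ck\<phi>[of 0] cont\<kappa> fst_g
    by (intro homeomorphismI) (auto simp: \<phi>_def \<kappa>\<iota> intro!: continuous_intros intro: continuous_on_subset)
  moreover have "inj (frechet_derivative \<phi> (at t))" if "t \<in> V" for t
    using inj\<Theta>[OF that] frechet_derivative_at[OF d\<phi>[OF that]] by simp
  ultimately have "local_parametrization {w. F w = 0} V \<phi>"
    unfolding local_parametrization_def smooth_on_def using \<open>open V\<close> Ck\<phi> ope by blast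
  moreover have "w0 \<in> \<phi> ` V"
    unfolding img using F0 U'(2) \<kappa>\<iota>[of 0] \<open>\<iota> 0 = w0\<close> by auto
  ultimately show ?thesis by blast
qed

lemma local_parametrizationD:
  assumes "local_parametrization M V \<phi>"
  shows "open V" "Ck_on r V \<phi>" "z \<in> V \<Longrightarrow> \<phi> z \<in> M" "z \<in> V \<Longrightarrow> inj (frechet_derivative \<phi> (at z))"
    "z \<in> V \<Longrightarrow> (\<phi> has_derivative frechet_derivative \<phi> (at z)) (at z)"
    "z \<in> V \<Longrightarrow> linear (frechet_derivative \<phi> (at z))"
proof -
  show V: "open V" "Ck_on r V \<phi>" for r using assms by (auto simp: local_parametrization_def smooth_on_def)
  show "z \<in> V \<Longrightarrow> \<phi> z \<in> M" "z \<in> V \<Longrightarrow> inj (frechet_derivative \<phi> (at z))"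
    using assms unfolding local_parametrization_def by (blast dest: openin_imp_subset)+
  show d: "z \<in> V \<Longrightarrow> (\<phi> has_derivative frechet_derivative \<phi> (at z)) (at z)"
    by (rule Ck_on_SucD(1)[OF V(2)])
  show "z \<in> V \<Longrightarrow> linear (frechet_derivative \<phi> (at z))"
    by (rule has_derivative_linear[OF d])
qed

text \<open>
  The chain rule gives one inclusion between the tangent spaces, and their dimensions agree.
\<close>

lemma range_derivative_local_parametrization:
  fixes F :: "'e::euclidean_space \<Rightarrow> real^'c" and \<phi> :: "real^'d::finite \<Rightarrow> 'e"
  assumes \<phi>: "local_parametrization {w. F w = 0} V \<phi>" and y: "y \<in> V"
    and dim: "DIM('e) = CARD('d) + CARD('c)"
    and dF: "(F has_derivative F') (at (\<phi> y))" and surj: "surj F'"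
  shows "range (frechet_derivative \<phi> (at y)) = {v. F' v = 0}"
proof -
  let ?D = "frechet_derivative \<phi> (at y)"
  note V = local_parametrizationD(1)[OF \<phi>] and d\<phi> = local_parametrizationD(5)[OF \<phi> y]
  have lin: "linear ?D" "linear F'" using d\<phi> dF by (auto intro: has_derivative_linear)
  have "F (\<phi> z) = 0" if "z \<in> V" for z using local_parametrizationD(3)[OF \<phi> that] by simp
  then have "((\<lambda>z. F (\<phi> z)) has_derivative (\<lambda>v. 0)) (at y)"
    by (intro has_derivative_transform_within_open[OF has_derivative_const[of 0] V y]) auto
  from has_derivative_unique[OF this has_derivative_compose[OF d\<phi> dF]]
  have sub: "range ?D \<subseteq> {v. F' v = 0}" by (auto simp: fun_eq_iff)
  have "inj ?D" by (rule local_parametrizationD(4)[OF \<phi> y])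
  then have "dim (range ?D) = CARD('d)"
    using dim_image_eq[of ?D UNIV] lin by (simp add: inj_on_subset)
  moreover have "dim {v. F' v = 0} = CARD('d)"
    using dim_kernel_of_surjective[OF lin(2) surj] dim by simp
  ultimately show ?thesis
    using sub lin by (intro subspace_dim_equal) (auto intro: linear_subspace_kernel linear_subspace_image)
qed

section \<open>The Laplacian of a metric with a frame of Killing fields\<close>

text \<open>Leibniz rule for the derivative of \<open>f\<close> along a vector field.\<close>

lemma has_derivative_moving_direction:
  fixes f :: "'a::euclidean_space \<Rightarrow> 'b::real_normed_vector"
  assumes S: "open S" "x \<in> S" and C2: "Ck_on 2 S f" and X: "(X has_derivative X') (at x)"
  shows "((\<lambda>y. frechet_derivative f (at y) (X y)) has_derivative
    (\<lambda>v. frechet_derivative (\<lambda>y. frechet_derivative f (at y) (X x)) (at x) v + frechet_derivative f (at x) (X' v))) (at x)"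
proof -
  have C2': "Ck_on (Suc (Suc 0)) S f" using C2 by (simp only: numeral_2_eq_2)
  let ?D = "\<lambda>y. frechet_derivative f (at y)"
  have lin: "linear (?D y)" if "y \<in> S" for y
    by (rule has_derivative_linear[OF Ck_on_SucD(1)[OF C2' that]])
  have ex: "(\<Sum>b\<in>Basis. (u \<bullet> b) *\<^sub>R ?D y b) = ?D y u" if "y \<in> S" for y u
    using euclidean_representation[of u] linear_sum[OF lin[OF that], of "\<lambda>b. (u \<bullet> b) *\<^sub>R b" Basis]
    by (simp add: linear_cmul[OF lin[OF that]])
  let ?H = "\<lambda>b. frechet_derivative (\<lambda>y. ?D y b) (at x)"
  have dD: "((\<lambda>y. ?D y b) has_derivative ?H b) (at x)" for b
    by (rule Ck_on_SucD(1)[OF Ck_on_SucD(2)[OF C2'] S(2)])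
  have "((\<lambda>y. \<Sum>b\<in>Basis. (X y \<bullet> b) *\<^sub>R ?D y b) has_derivative
      (\<lambda>v. \<Sum>b\<in>Basis. (X x \<bullet> b) *\<^sub>R ?H b v + (X' v \<bullet> b) *\<^sub>R ?D x b)) (at x)"
    by (intro has_derivative_sum has_derivative_scaleR has_derivative_inner_left X dD)
  then have 1: "((\<lambda>y. ?D y (X y)) has_derivative
      (\<lambda>v. \<Sum>b\<in>Basis. (X x \<bullet> b) *\<^sub>R ?H b v + (X' v \<bullet> b) *\<^sub>R ?D x b)) (at x)"
    by (rule has_derivative_transform_within_open[OF _ S]) (rule ex)
  have "((\<lambda>y. \<Sum>b\<in>Basis. (X x \<bullet> b) *\<^sub>R ?D y b) has_derivative
      (\<lambda>v. \<Sum>b\<in>Basis. (X x \<bullet> b) *\<^sub>R ?H b v)) (at x)"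
    by (intro has_derivative_sum has_derivative_scaleR_right dD)
  then have "((\<lambda>y. ?D y (X x)) has_derivative (\<lambda>v. \<Sum>b\<in>Basis. (X x \<bullet> b) *\<^sub>R ?H b v)) (at x)"
    by (rule has_derivative_transform_within_open[OF _ S]) (rule ex)
  note 2 = frechet_derivative_at[OF this, symmetric]
  from 1 show ?thesis
    unfolding 2 by (simp add: sum.distrib ex[OF S(2)])
qed

lemma linear_eq_sum_axis:
  fixes L :: "real^'d::finite \<Rightarrow> 'b::real_normed_vector"
  assumes "linear L"
  shows "L t = (\<Sum>a\<in>UNIV. t $ a *\<^sub>R L (axis a 1))"
proof -
  have "t = (\<Sum>a\<in>UNIV. t $ a *\<^sub>R axis a 1)"
    using basis_expansion[of t] by (simp add: scalar_mult_eq_scaleR)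
  then have "L t = L (\<Sum>a\<in>UNIV. t $ a *\<^sub>R axis a 1)" by simp
  then show ?thesis by (simp add: linear_sum[OF assms] linear_cmul[OF assms])
qed

text \<open>
  The pulled back field solves the normal equations of the overdetermined system
  \<open>d\<phi> k = X\<close>, whose matrix is the invertible Gram matrix of the partial derivatives of \<open>\<phi>\<close>.
\<close>

lemma pullback_tangent_field:
  fixes \<phi> :: "real^'d::finite \<Rightarrow> 'e::euclidean_space"
  assumes \<phi>: "local_parametrization M V \<phi>"
    and X: "\<And>z. z \<in> V \<Longrightarrow> X differentiable (at (\<phi> z))"
    and tangent: "\<And>z. z \<in> V \<Longrightarrow> X (\<phi> z) \<in> range (frechet_derivative \<phi> (at z))"
  obtains k where "\<And>z. z \<in> V \<Longrightarrow> frechet_derivative \<phi> (at z) (k z) = X (\<phi> z)"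
    and "\<And>z. z \<in> V \<Longrightarrow> k differentiable (at z)"
proof -
  define P where "P z a = partial_deriv a \<phi> z" for z a
  define N where "N z = (\<chi> a b. P z a \<bullet> P z b)" for z
  define k where "k z = matrix_inv (N z) *v (\<chi> a. P z a \<bullet> X (\<phi> z))" for z
  note V = local_parametrizationD[OF \<phi>]
  have D: "frechet_derivative \<phi> (at z) t = (\<Sum>a\<in>UNIV. t $ a *\<^sub>R P z a)" if "z \<in> V" for z t
    unfolding P_def partial_deriv_def by (rule linear_eq_sum_axis[OF V(6)[OF that]])
  have N: "N z *v t = (\<chi> a. P z a \<bullet> frechet_derivative \<phi> (at z) t)" if "z \<in> V" for z t
    by (simp add: N_def matrix_vector_mult_def vec_eq_iff D[OF that] inner_sum_right mult.commute)
  have nz: "det (N z) \<noteq> 0" if "z \<in> V" for z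
  proof -
    have "t = 0" if t: "N z *v t = 0" for t
    proof -
      let ?u = "frechet_derivative \<phi> (at z) t"
      have "P z a \<bullet> ?u = 0" for a
        using t unfolding N[OF \<open>z \<in> V\<close>] by (simp add: vec_eq_iff)
      then have "(\<Sum>a\<in>UNIV. t $ a *\<^sub>R P z a) \<bullet> ?u = 0" by (simp add: inner_sum_left)
      then have "?u = frechet_derivative \<phi> (at z) 0"
        unfolding D[OF \<open>z \<in> V\<close>, symmetric] using V(6)[OF \<open>z \<in> V\<close>] by (simp add: linear_0)
      then show ?thesis by (rule injD[OF V(4)[OF \<open>z \<in> V\<close>]])
    qed
    then show ?thesis
      by (simp add: invertible_det_nz[symmetric] invertible_left_inverse matrix_left_invertible_ker)
  qed
  show ?thesis
  proof (rule that[of k])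
    fix z assume z: "z \<in> V"
    obtain t where t: "X (\<phi> z) = frechet_derivative \<phi> (at z) t" using tangent[OF z] by blast
    have "k z = matrix_inv (N z) *v (N z *v t)" by (simp add: k_def t N[OF z])
    also have "\<dots> = t" by (simp add: matrix_vector_mul_assoc matrix_inv_inverse[OF nz[OF z]])
    finally show "frechet_derivative \<phi> (at z) (k z) = X (\<phi> z)" by (simp add: t)
    have "(\<lambda>z. P z a) differentiable (at z)" for a
      using Ck_on_SucD(1)[OF Ck_on_SucD(2)[OF V(2)] z] unfolding P_def partial_deriv_def
      by (blast intro: differentiableI)
    then obtain P' where P': "((\<lambda>z. P z a) has_derivative P' a) (at z)" for a
      unfolding differentiable_def by metis
    have "(\<lambda>z. P z a \<bullet> P z b) differentiable (at z)" for a b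
      using has_derivative_inner[OF P'[of a] P'[of b]] by (rule differentiableI)
    then have inv: "(\<lambda>z. matrix_inv (N z)) differentiable (at z)"
      by (intro differentiable_matrix_inv nz z) (simp add: N_def)
    then obtain I' where I': "((\<lambda>z. matrix_inv (N z)) has_derivative I') (at z)"
      unfolding differentiable_def by blast
    obtain X' where X': "(X has_derivative X') (at (\<phi> z))"
      using X[OF z] unfolding differentiable_def by blast
    have "((\<lambda>z. \<Sum>a\<in>UNIV. matrix_inv (N z) $ i $ a * (P z a \<bullet> X (\<phi> z))) has_derivative
        (\<lambda>v. \<Sum>a\<in>UNIV. matrix_inv (N z) $ i $ a * (P z a \<bullet> X' (frechet_derivative \<phi> (at z) v) + P' a v \<bullet> X (\<phi> z)) +
          I' v $ i $ a * (P z a \<bullet> X (\<phi> z)))) (at z)" for i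
      by (intro has_derivative_sum has_derivative_mult has_derivative_inner has_derivative_vec_nth I' P'
          has_derivative_compose[OF V(5)[OF z] X'])
    then show "k differentiable (at z)"
      unfolding k_def matrix_vector_mult_def by (intro differentiable_vecI) (auto intro: differentiableI)
  qed
qed

text \<open>
  Differentiating \<open>d\<phi> k\<^sub>i = X\<^sub>i \<circ> \<phi>\<close> produces second derivatives of \<open>\<phi>\<close>. They are symmetric and
  cancel in the commutator.
\<close>

lemma commutator_pullback:
  fixes \<phi> :: "real^'d::finite \<Rightarrow> 'e::euclidean_space"
  assumes \<phi>: "local_parametrization M V \<phi>" and y: "y \<in> V"
    and k1: "\<And>z. z \<in> V \<Longrightarrow> frechet_derivative \<phi> (at z) (k1 z) = X1 (\<phi> z)" "(k1 has_derivative k1') (at y)"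
    and k2: "\<And>z. z \<in> V \<Longrightarrow> frechet_derivative \<phi> (at z) (k2 z) = X2 (\<phi> z)" "(k2 has_derivative k2') (at y)"
    and X1: "(X1 has_derivative X1') (at (\<phi> y))" and X2: "(X2 has_derivative X2') (at (\<phi> y))"
  shows "frechet_derivative \<phi> (at y) (k2' (k1 y) - k1' (k2 y)) = X2' (X1 (\<phi> y)) - X1' (X2 (\<phi> y))"
proof -
  note V = local_parametrizationD[OF \<phi>]
  let ?D = "frechet_derivative \<phi> (at y)"
  let ?D2 = "\<lambda>u. frechet_derivative (\<lambda>z. frechet_derivative \<phi> (at z) u) (at y)"
  have *: "?D2 (k y) v + ?D (k' v) = X' (?D v)"
    if k: "\<And>z. z \<in> V \<Longrightarrow> frechet_derivative \<phi> (at z) (k z) = X (\<phi> z)" "(k has_derivative k') (at y)"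
    and X: "(X has_derivative X') (at (\<phi> y))" for k k' X X' v
  proof -
    have "((\<lambda>z. frechet_derivative \<phi> (at z) (k z)) has_derivative (\<lambda>v. X' (?D v))) (at y)"
      by (rule has_derivative_transform_within_open[OF has_derivative_compose[OF V(5)[OF y] X] V(1) y])
        (simp add: k)
    from has_derivative_unique[OF has_derivative_moving_direction[OF V(1) y V(2) k(2)] this]
    show ?thesis by (simp add: fun_eq_iff)
  qed
  have "?D (k1' (k2 y)) = X1' (X2 (\<phi> y)) - ?D2 (k1 y) (k2 y)"
    using *[OF k1 X1, of "k2 y"] k2(1)[OF y] by (simp add: algebra_simps)
  moreover have "?D (k2' (k1 y)) = X2' (X1 (\<phi> y)) - ?D2 (k2 y) (k1 y)"
    using *[OF k2 X2, of "k1 y"] k1(1)[OF y] by (simp add: algebra_simps)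
  moreover have "?D2 (k1 y) (k2 y) = ?D2 (k2 y) (k1 y)"
    by (rule symmetric_second_derivative[OF V(1) y V(2)])
  ultimately show ?thesis using V(6)[OF y] by (simp add: linear_diff)
qed

text \<open>
  The Lie derivative of the inverse metric \<open>H = \<Sum>\<^sub>j k\<^sub>j k\<^sub>j\<^sup>T\<close> along \<open>k\<^sub>i\<close> vanishes, because the
  structure constants are antisymmetric. Its trace against the metric compares the derivative of the
  volume density with the divergence of \<open>k\<^sub>i\<close>.
\<close>

lemma trace_derivative_of_frame_metric:
  fixes k :: "'i::finite \<Rightarrow> real^'d::finite"
  assumes lin: "linear (k' i)"
    and commutator: "\<And>j. k' j (k i) - k' i (k j) = (\<Sum>l\<in>UNIV. c j l *\<^sub>R k l)"
    and anti: "\<And>j l. c j l = - c l j"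
    and H: "H = (\<chi> a b. \<Sum>j\<in>UNIV. k j $ a * k j $ b)" and g: "g ** H = mat 1"
  shows "trace (g ** (\<chi> a b. \<Sum>j\<in>UNIV. k' j (k i) $ a * k j $ b + k j $ a * k' j (k i) $ b)) =
    2 * (\<Sum>a\<in>UNIV. k' i (axis a 1) $ a)"
proof -
  define Q :: "real^'d^'d" where "Q = (\<chi> a b. k' i (axis b 1) $ a)"
  have Hg: "H ** g = mat 1" using g by (simp add: matrix_left_right_inverse)
  have Q: "k' i (k j) $ a = (\<Sum>b\<in>UNIV. k j $ b * Q $ a $ b)" for j a
    by (subst linear_eq_sum_axis[OF lin]) (simp add: Q_def)
  have k': "k' j (k i) = k' i (k j) + (\<Sum>l\<in>UNIV. c j l *\<^sub>R k l)" for j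
    using commutator[of j] by (simp add: algebra_simps)
  have cancel: "(\<Sum>j\<in>UNIV. (\<Sum>l\<in>UNIV. c j l *\<^sub>R k l) $ a * k j $ b + k j $ a * (\<Sum>l\<in>UNIV. c j l *\<^sub>R k l) $ b) = 0" for a b
  proof -
    have "(\<Sum>j\<in>UNIV. k j $ a * (\<Sum>l\<in>UNIV. c j l *\<^sub>R k l) $ b) = (\<Sum>j\<in>UNIV. \<Sum>l\<in>UNIV. c j l * k l $ b * k j $ a)"
      by (simp add: sum_distrib_left mult_ac)
    also have "\<dots> = (\<Sum>l\<in>UNIV. \<Sum>j\<in>UNIV. c j l * k l $ b * k j $ a)"
      by (rule sum.swap)
    also have "\<dots> = - (\<Sum>l\<in>UNIV. \<Sum>j\<in>UNIV. c l j * k j $ a * k l $ b)"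
      unfolding sum_negf[symmetric] by (intro sum.cong refl) (subst anti, simp add: mult_ac)
    also have "\<dots> = - (\<Sum>j\<in>UNIV. (\<Sum>l\<in>UNIV. c j l *\<^sub>R k l) $ a * k j $ b)"
      by (simp add: sum_distrib_right)
    finally show ?thesis by (simp add: sum.distrib)
  qed
  have "(\<Sum>j\<in>UNIV. k' j (k i) $ a * k j $ b + k j $ a * k' j (k i) $ b) =
      (\<Sum>j\<in>UNIV. k' i (k j) $ a * k j $ b + k j $ a * k' i (k j) $ b)" for a b
    using cancel[of a b] by (simp add: k' sum.distrib algebra_simps)
  moreover have "(\<Sum>j\<in>UNIV. k' i (k j) $ a * k j $ b) = (Q ** H) $ a $ b" for a b
  proof -
    have "(\<Sum>j\<in>UNIV. k' i (k j) $ a * k j $ b) = (\<Sum>j\<in>UNIV. \<Sum>c\<in>UNIV. Q $ a $ c * (k j $ c * k j $ b))"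
      by (simp add: Q sum_distrib_right sum_distrib_left mult_ac)
    also have "\<dots> = (\<Sum>c\<in>UNIV. \<Sum>j\<in>UNIV. Q $ a $ c * (k j $ c * k j $ b))" by (rule sum.swap)
    finally show ?thesis by (simp add: H matrix_matrix_mult_def sum_distrib_left)
  qed
  moreover have "(\<Sum>j\<in>UNIV. k j $ a * k' i (k j) $ b) = (H ** transpose Q) $ a $ b" for a b
  proof -
    have "(\<Sum>j\<in>UNIV. k j $ a * k' i (k j) $ b) = (\<Sum>j\<in>UNIV. \<Sum>c\<in>UNIV. (k j $ a * k j $ c) * Q $ b $ c)"
      by (simp add: Q sum_distrib_left mult_ac)
    also have "\<dots> = (\<Sum>c\<in>UNIV. \<Sum>j\<in>UNIV. (k j $ a * k j $ c) * Q $ b $ c)" by (rule sum.swap)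
    finally show ?thesis by (simp add: H matrix_matrix_mult_def sum_distrib_right transpose_def)
  qed
  ultimately have "(\<chi> a b. \<Sum>j\<in>UNIV. k' j (k i) $ a * k j $ b + k j $ a * k' j (k i) $ b) = Q ** H + H ** transpose Q"
    by (simp add: vec_eq_iff sum.distrib)
  moreover have "trace (g ** (Q ** H)) = trace Q"
    by (metis trace_mul_sym matrix_mul_assoc Hg matrix_mul_rid)
  moreover have "trace (g ** (H ** transpose Q)) = trace Q"
    by (simp add: matrix_mul_assoc g trace_def transpose_def)
  ultimately show ?thesis
    by (simp add: matrix_add_ldistrib trace_add) (simp add: trace_def Q_def)
qed


text \<open>
  In the coordinates of \<open>\<phi>\<close> the inverse metric is \<open>\<Sum>\<^sub>i k\<^sub>i k\<^sub>i\<^sup>T\<close>, so the gradient of \<open>h = f \<circ> \<phi>\<close> is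
  \<open>\<Sum>\<^sub>i (k\<^sub>i h) k\<^sub>i\<close>. Every \<open>k\<^sub>i\<close> is divergence free for the Riemannian volume, hence the divergence of
  the gradient is \<open>\<Sum>\<^sub>i k\<^sub>i (k\<^sub>i h)\<close>.
\<close>

theorem laplace_beltrami_in_chart_killing_frame:
  fixes K :: "'i::finite \<Rightarrow> 'e::euclidean_space \<Rightarrow> 'e" and \<phi> :: "real^'d::finite \<Rightarrow> 'e"
    and f :: "'e \<Rightarrow> 'b::real_normed_vector"
  assumes \<phi>: "local_parametrization M V \<phi>" and y: "y \<in> V"
    and K: "\<And>i w. w \<in> M \<Longrightarrow> (K i has_derivative K' i w) (at w)"
    and tangent: "\<And>z i. z \<in> V \<Longrightarrow> K i (\<phi> z) \<in> range (frechet_derivative \<phi> (at z))"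
    and metric: "\<And>z u v. z \<in> V \<Longrightarrow> u \<in> range (frechet_derivative \<phi> (at z)) \<Longrightarrow>
      v \<in> range (frechet_derivative \<phi> (at z)) \<Longrightarrow> G (\<phi> z) u v = B (\<phi> z) u v"
    and bilinear: "\<And>w u. w \<in> M \<Longrightarrow> linear (B w u)" "\<And>w v. w \<in> M \<Longrightarrow> linear (\<lambda>u. B w u v)"
    and frame: "\<And>z u. z \<in> V \<Longrightarrow> u \<in> range (frechet_derivative \<phi> (at z)) \<Longrightarrow>
      (\<Sum>i\<in>UNIV. B (\<phi> z) (K i (\<phi> z)) u *\<^sub>R K i (\<phi> z)) = u"
    and bracket: "\<And>w i j. w \<in> M \<Longrightarrow> K' j w (K i w) - K' i w (K j w) = (\<Sum>l\<in>UNIV. c i j l *\<^sub>R K l w)"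
    and anti: "\<And>i j l. c i j l = - c i l j"
    and f: "open W" "M \<subseteq> W" "Ck_on 2 W f"
  shows "laplace_beltrami_in_chart G \<phi> f y =
    (\<Sum>i\<in>UNIV. frechet_derivative (\<lambda>w. frechet_derivative f (at w) (K i w)) (at (\<phi> y)) (K i (\<phi> y)))"
proof -
  note V = local_parametrizationD[OF \<phi>]
  let ?D = "\<lambda>z. frechet_derivative \<phi> (at z)"
  have "\<exists>k. (\<forall>z\<in>V. ?D z (k z) = K i (\<phi> z)) \<and> (\<forall>z\<in>V. k differentiable (at z))" for i
  proof -
    obtain k where "\<And>z. z \<in> V \<Longrightarrow> ?D z (k z) = K i (\<phi> z)" "\<And>z. z \<in> V \<Longrightarrow> k differentiable (at z)"
    proof (rule pullback_tangent_field[OF \<phi>, of "K i"])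
      show "K i differentiable at (\<phi> z)" if "z \<in> V" for z
        using K[OF V(3)[OF that]] by (rule differentiableI)
    qed (use tangent in auto)
    then show ?thesis by blast
  qed
  then obtain k where k: "\<And>i z. z \<in> V \<Longrightarrow> ?D z (k i z) = K i (\<phi> z)"
    and kdiff: "\<And>i z. z \<in> V \<Longrightarrow> k i differentiable (at z)" by metis
  define k' where "k' i = frechet_derivative (k i) (at y)" for i
  have k': "(k i has_derivative k' i) (at y)" for i
    unfolding k'_def using kdiff[OF y] by (simp add: frechet_derivative_works)
  have lin_k': "linear (k' i)" for i by (rule has_derivative_linear[OF k'])

  \<comment> \<open>The frame identity, read in the chart, says that \<open>H\<close> is the inverse of the metric.\<close>
  define H where "H z = (\<chi> a b. \<Sum>i\<in>UNIV. k i z $ a * k i z $ b)" for z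
  have Hg: "H z ** gram G \<phi> z = mat 1" if z: "z \<in> V" for z
  proof -
    have "H z *v (gram G \<phi> z *v t) = t" for t
    proof -
      have gt: "(gram G \<phi> z *v t) $ a = B (\<phi> z) (?D z (axis a 1)) (?D z t)" for a
        using bilinear(1)[OF V(3)[OF z]]
        by (subst (2) linear_eq_sum_axis[OF V(6)[OF z]])
          (simp add: gram_def partial_deriv_def matrix_vector_mult_def metric[OF z] linear_sum linear_cmul mult.commute)
      have "(\<Sum>a\<in>UNIV. k i z $ a * B (\<phi> z) (?D z (axis a 1)) (?D z t)) = B (\<phi> z) (K i (\<phi> z)) (?D z t)" for i
        by (subst k[OF z, symmetric], subst linear_eq_sum_axis[OF V(6)[OF z], of "k i z"])
          (simp add: linear_sum[OF bilinear(2)[OF V(3)[OF z]]] linear_cmul[OF bilinear(2)[OF V(3)[OF z]]])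
      note KB = this
      have "(H z *v (gram G \<phi> z *v t)) $ b = (\<Sum>i\<in>UNIV. B (\<phi> z) (K i (\<phi> z)) (?D z t) *\<^sub>R k i z) $ b" for b
      proof -
        have "(H z *v (gram G \<phi> z *v t)) $ b =
            (\<Sum>a\<in>UNIV. \<Sum>i\<in>UNIV. k i z $ b * (k i z $ a * B (\<phi> z) (?D z (axis a 1)) (?D z t)))"
          by (simp add: H_def matrix_vector_mult_def[of "\<chi> a b. _ a b"] gt sum_distrib_right mult.assoc)
        also have "\<dots> = (\<Sum>i\<in>UNIV. \<Sum>a\<in>UNIV. k i z $ b * (k i z $ a * B (\<phi> z) (?D z (axis a 1)) (?D z t)))"
          by (rule sum.swap)
        also have "\<dots> = (\<Sum>i\<in>UNIV. k i z $ b * B (\<phi> z) (K i (\<phi> z)) (?D z t))"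
          by (simp only: sum_distrib_left[symmetric] KB)
        finally show ?thesis by (simp add: mult.commute)
      qed
      then have "H z *v (gram G \<phi> z *v t) = (\<Sum>i\<in>UNIV. B (\<phi> z) (K i (\<phi> z)) (?D z t) *\<^sub>R k i z)"
        by (simp add: vec_eq_iff)
      then have "?D z (H z *v (gram G \<phi> z *v t)) = ?D z t"
        using V(6)[OF z] frame[OF z] by (simp add: linear_sum linear_cmul k[OF z])
      then show ?thesis by (rule injD[OF V(4)[OF z]])
    qed
    then show ?thesis by (simp add: matrix_eq matrix_vector_mul_assoc[symmetric])
  qed
  have gH: "gram G \<phi> z ** H z = mat 1" if "z \<in> V" for z
    using Hg[OF that] by (simp add: matrix_left_right_inverse)
  have inv_gram: "matrix_inv (gram G \<phi> z) = H z" if "z \<in> V" for z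
    by (rule matrix_inv_eqI(1)[OF gH[OF that]])
  have inv_H: "matrix_inv (H z) = gram G \<phi> z" and det_H: "det (H z) \<noteq> 0" if "z \<in> V" for z
    using matrix_inv_eqI[OF Hg[OF that]] by auto
  have det_gram: "det (gram G \<phi> z) = inverse (det (H z))" if "z \<in> V" for z
    using arg_cong[OF Hg[OF that], of det] det_H[OF that] by (simp add: det_mul field_simps)

  \<comment> \<open>The derivative \<open>r'\<close> of the volume density \<open>r\<close> comes from Jacobi's formula for \<open>det H\<close>.\<close>
  define r where "r z = sqrt (inverse (det (H z)))" for z
  define H' where "H' v = (\<chi> a b. \<Sum>j\<in>UNIV. k' j v $ a * k j y $ b + k j y $ a * k' j v $ b)" for v
  define r' where "r' v = - r y * trace (gram G \<phi> y ** H' v) / 2" for v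
  have "((\<lambda>z. \<Sum>j\<in>UNIV. k j z $ a * k j z $ b) has_derivative
        (\<lambda>v. \<Sum>j\<in>UNIV. k j y $ a * k' j v $ b + k' j v $ a * k j y $ b)) (at y)" for a b
    by (intro has_derivative_sum has_derivative_mult has_derivative_vec_nth k')
  then have "(H has_derivative H') (at y)"
    by (intro has_derivative_vecI) (simp add: H_def H'_def add.commute)
  from has_derivative_det[OF this det_H[OF y]]
  have dH: "((\<lambda>z. det (H z)) has_derivative (\<lambda>v. det (H y) * trace (gram G \<phi> y ** H' v))) (at y)"
    by (simp add: inv_H[OF y])
  \<comment> \<open>Both signs of \<open>x\<close> are covered, since \<open>sqrt\<close> is extended to negative numbers as an odd function.\<close>
  have sqrt: "(sqrt has_real_derivative sqrt x / (2 * x)) (at x)" if "x \<noteq> 0" for x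
    using that real_sqrt_mult_self[of x]
    by (intro DERIV_real_sqrt_generic) (auto simp: field_simps)
  have r': "(r has_derivative r') (at y)"
  proof -
    let ?x = "inverse (det (H y))"
    have "?x \<noteq> 0" using det_H[OF y] by simp
    have "(r has_derivative (\<lambda>v. - (?x * (det (H y) * trace (gram G \<phi> y ** H' v)) * ?x) * (sqrt ?x / (2 * ?x)))) (at y)"
      using DERIV_compose_FDERIV[OF sqrt[OF \<open>?x \<noteq> 0\<close>] Deriv.has_derivative_inverse[OF det_H[OF y] dH]]
      by (simp add: r_def[abs_def])
    moreover have "- (?x * (det (H y) * trace (gram G \<phi> y ** H' v)) * ?x) * (sqrt ?x / (2 * ?x)) = r' v" for v
      using det_H[OF y] by (simp add: r'_def r_def)
    ultimately show ?thesis by simp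
  qed
  have r_nz: "r y \<noteq> 0" using det_H[OF y] by (simp add: r_def)

  \<comment> \<open>This is the coordinate divergence of \<open>r k\<^sub>i\<close> at \<open>y\<close>.\<close>
  have div: "r' (k i y) + r y * (\<Sum>a\<in>UNIV. k' i (axis a 1) $ a) = 0" for i
  proof -
    have "?D y (k' j (k i y) - k' i (k j y)) = ?D y (\<Sum>l\<in>UNIV. c i j l *\<^sub>R k l y)" for j
      using commutator_pullback[OF \<phi> y k k' k k' K[OF V(3)[OF y]] K[OF V(3)[OF y]], of j i]
        bracket[OF V(3)[OF y], of j i] V(6)[OF y]
      by (simp add: linear_sum linear_cmul k[OF y])
    then have "k' j (k i y) - k' i (k j y) = (\<Sum>l\<in>UNIV. c i j l *\<^sub>R k l y)" for j
      using V(4)[OF y] by (blast dest: injD)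
    from trace_derivative_of_frame_metric[OF lin_k' this anti _ gH[OF y]]
    have "trace (gram G \<phi> y ** H' (k i y)) = 2 * (\<Sum>a\<in>UNIV. k' i (axis a 1) $ a)"
      by (simp add: H_def H'_def)
    then show ?thesis by (simp add: r'_def)
  qed

  \<comment> \<open>In the frame, the components of the gradient of \<open>f \<circ> \<phi>\<close> are the derivatives \<open>u\<^sub>i\<close> of \<open>f\<close> along \<open>K\<^sub>i\<close>.\<close>
  define u where "u i z = frechet_derivative f (at (\<phi> z)) (K i (\<phi> z))" for i z
  have f1: "(f has_derivative frechet_derivative f (at (\<phi> z))) (at (\<phi> z))" if "z \<in> V" for z
    using Ck_on_SucD(1)[of 1 W f] f V(3)[OF that] by (auto simp: numeral_2_eq_2)
  have grad: "(\<Sum>b\<in>UNIV. matrix_inv (gram G \<phi> z) $ a $ b *\<^sub>R partial_deriv b (f \<circ> \<phi>) z) =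
      (\<Sum>i\<in>UNIV. k i z $ a *\<^sub>R u i z)" if z: "z \<in> V" for z a
  proof -
    have d: "((f \<circ> \<phi>) has_derivative (\<lambda>v. frechet_derivative f (at (\<phi> z)) (?D z v))) (at z)"
      unfolding o_def by (rule has_derivative_compose[OF V(5)[OF z] f1[OF z]])
    have lin: "linear (\<lambda>v. frechet_derivative f (at (\<phi> z)) (?D z v))" by (rule has_derivative_linear[OF d])
    have "u i z = (\<Sum>b\<in>UNIV. k i z $ b *\<^sub>R partial_deriv b (f \<circ> \<phi>) z)" for i
      unfolding u_def k[OF z, symmetric] partial_deriv_def frechet_derivative_at[OF d, symmetric]
      by (rule linear_eq_sum_axis[OF lin])
    then have "(\<Sum>i\<in>UNIV. k i z $ a *\<^sub>R u i z) =
        (\<Sum>i\<in>UNIV. \<Sum>b\<in>UNIV. (k i z $ a * k i z $ b) *\<^sub>R partial_deriv b (f \<circ> \<phi>) z)"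
      by (simp add: scaleR_sum_right)
    also have "\<dots> = (\<Sum>b\<in>UNIV. H z $ a $ b *\<^sub>R partial_deriv b (f \<circ> \<phi>) z)"
      by (subst sum.swap) (simp add: H_def scaleR_sum_left)
    finally show ?thesis by (simp add: inv_gram[OF z])
  qed
  define u' where "u' i v = frechet_derivative (\<lambda>w. frechet_derivative f (at w) (K i w)) (at (\<phi> y)) (?D y v)" for i v
  have u': "(u i has_derivative u' i) (at y)" for i
  proof -
    have "(\<lambda>w. frechet_derivative f (at w) (K i w)) differentiable (at (\<phi> y))"
      using has_derivative_moving_direction[OF f(1) _ f(3) K[OF V(3)[OF y]]] f(2) V(3)[OF y]
      by (blast intro: differentiableI)
    then show ?thesis
      unfolding u_def[abs_def] u'_def[abs_def] frechet_derivative_works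
      by (rule has_derivative_compose[OF V(5)[OF y]])
  qed
  have lin_u': "linear (u' i)" and lin_r': "linear r'" for i
    using u' r' by (auto intro: has_derivative_linear)

  define flux where "flux a z = r z *\<^sub>R (\<Sum>i\<in>UNIV. k i z $ a *\<^sub>R u i z)" for a z
  have flux: "(flux a has_derivative (\<lambda>v. r y *\<^sub>R (\<Sum>i\<in>UNIV. k i y $ a *\<^sub>R u' i v + k' i v $ a *\<^sub>R u i y) +
      r' v *\<^sub>R (\<Sum>i\<in>UNIV. k i y $ a *\<^sub>R u i y))) (at y)" for a
    unfolding flux_def[abs_def]
    by (intro has_derivative_scaleR has_derivative_sum has_derivative_vec_nth k' u' r')
  have "partial_deriv a (\<lambda>z. sqrt (det (gram G \<phi> z)) *\<^sub>R
        (\<Sum>b\<in>UNIV. matrix_inv (gram G \<phi> z) $ a $ b *\<^sub>R partial_deriv b (f \<circ> \<phi>) z)) y =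
      r y *\<^sub>R (\<Sum>i\<in>UNIV. k i y $ a *\<^sub>R u' i (axis a 1) + k' i (axis a 1) $ a *\<^sub>R u i y) +
      r' (axis a 1) *\<^sub>R (\<Sum>i\<in>UNIV. k i y $ a *\<^sub>R u i y)" for a
  proof -
    have "((\<lambda>z. sqrt (det (gram G \<phi> z)) *\<^sub>R
        (\<Sum>b\<in>UNIV. matrix_inv (gram G \<phi> z) $ a $ b *\<^sub>R partial_deriv b (f \<circ> \<phi>) z)) has_derivative
      (\<lambda>v. r y *\<^sub>R (\<Sum>i\<in>UNIV. k i y $ a *\<^sub>R u' i v + k' i v $ a *\<^sub>R u i y) +
      r' v *\<^sub>R (\<Sum>i\<in>UNIV. k i y $ a *\<^sub>R u i y))) (at y)"
      by (rule has_derivative_transform_within_open[OF flux V(1) y])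
        (simp add: flux_def r_def det_gram grad)
    note 1 = frechet_derivative_at[OF this, symmetric]
    show ?thesis unfolding partial_deriv_def[of a] 1 by (rule refl)
  qed
  then have "laplace_beltrami_in_chart G \<phi> f y = (1 / r y) *\<^sub>R (\<Sum>a\<in>UNIV.
      r y *\<^sub>R (\<Sum>i\<in>UNIV. k i y $ a *\<^sub>R u' i (axis a 1) + k' i (axis a 1) $ a *\<^sub>R u i y) +
      r' (axis a 1) *\<^sub>R (\<Sum>i\<in>UNIV. k i y $ a *\<^sub>R u i y))"
    unfolding laplace_beltrami_in_chart_def by (simp add: r_def det_gram[OF y])
  also have "(\<Sum>a\<in>UNIV.
      r y *\<^sub>R (\<Sum>i\<in>UNIV. k i y $ a *\<^sub>R u' i (axis a 1) + k' i (axis a 1) $ a *\<^sub>R u i y) +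
      r' (axis a 1) *\<^sub>R (\<Sum>i\<in>UNIV. k i y $ a *\<^sub>R u i y)) =
    (\<Sum>a\<in>UNIV. \<Sum>i\<in>UNIV. r y *\<^sub>R (k i y $ a *\<^sub>R u' i (axis a 1)) +
      (k i y $ a * r' (axis a 1) + r y * k' i (axis a 1) $ a) *\<^sub>R u i y)"
    by (simp add: scaleR_sum_right sum.distrib[symmetric] algebra_simps)
  also have "\<dots> = (\<Sum>i\<in>UNIV. r y *\<^sub>R (\<Sum>a\<in>UNIV. k i y $ a *\<^sub>R u' i (axis a 1)) +
      (r' (k i y) + r y * (\<Sum>a\<in>UNIV. k' i (axis a 1) $ a)) *\<^sub>R u i y)"
    by (subst sum.swap, subst linear_eq_sum_axis[OF lin_r'])
      (simp add: scaleR_sum_right scaleR_sum_left sum_distrib_left sum.distrib scaleR_add_left)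
  also have "\<dots> = r y *\<^sub>R (\<Sum>i\<in>UNIV. u' i (k i y))"
    by (simp add: div linear_eq_sum_axis[OF lin_u', symmetric] scaleR_sum_right)
  finally show ?thesis
    using r_nz by (simp add: u'_def k[OF y])
qed

section \<open>Complex matrices\<close>

lemma bounded_bilinear_matrix_mult:
  "bounded_bilinear ((**) :: complex^'n^'m \<Rightarrow> complex^'p^'n \<Rightarrow> complex^'p^'m)"
  unfolding bilinear_conv_bounded_bilinear[symmetric]
  by (auto simp: bilinear_def vec_eq_iff matrix_matrix_mult_def sum.distrib algebra_simps scaleR_sum_right
      intro!: linearI)

lemmas matrix_mult_add_left = bounded_bilinear.add_left[OF bounded_bilinear_matrix_mult]
  and matrix_mult_add_right = bounded_bilinear.add_right[OF bounded_bilinear_matrix_mult]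
  and matrix_mult_diff_left = bounded_bilinear.diff_left[OF bounded_bilinear_matrix_mult]
  and matrix_mult_diff_right = bounded_bilinear.diff_right[OF bounded_bilinear_matrix_mult]
  and matrix_mult_minus_left = bounded_bilinear.minus_left[OF bounded_bilinear_matrix_mult]
  and matrix_mult_minus_right = bounded_bilinear.minus_right[OF bounded_bilinear_matrix_mult]
  and matrix_mult_sum_left = bounded_bilinear.sum_left[OF bounded_bilinear_matrix_mult]
  and matrix_mult_sum_right = bounded_bilinear.sum_right[OF bounded_bilinear_matrix_mult]
  and matrix_mult_scaleR_left = bounded_bilinear.scaleR_left[OF bounded_bilinear_matrix_mult]
  and matrix_mult_scaleR_right = bounded_bilinear.scaleR_right[OF bounded_bilinear_matrix_mult]

lemmas matrix_distribs = matrix_mult_add_left matrix_mult_add_right matrix_mult_diff_left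
  matrix_mult_diff_right matrix_mult_minus_left matrix_mult_minus_right

lemmas matrix_assoc = matrix_mul_assoc[symmetric]

lemma has_derivative_matrix_inv:
  fixes M :: "'a::real_normed_vector \<Rightarrow> complex^'n^'n"
  assumes M': "(M has_derivative M') (at x)" and nz: "det (M x) \<noteq> 0"
  shows "((\<lambda>x. matrix_inv (M x)) has_derivative (\<lambda>v. - (matrix_inv (M x) ** M' v ** matrix_inv (M x)))) (at x)"
proof -
  have diff: "(\<lambda>x. M x $ i $ j) differentiable (at x)" for i j
    using has_derivative_vec_nth[OF has_derivative_vec_nth[OF M']] by (rule differentiableI)
  obtain I' where I': "((\<lambda>x. matrix_inv (M x)) has_derivative I') (at x)"
    using differentiable_matrix_inv[OF diff nz] unfolding differentiable_def by blast
  have "isCont (\<lambda>x. det (M x)) x"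
    by (intro differentiable_imp_continuous_within differentiable_det diff)
  then obtain e where e: "e > 0" "\<And>y. y \<in> ball x e \<Longrightarrow> det (M y) \<noteq> 0"
    using continuous_at_avoid[of x "\<lambda>x. det (M x)" 0] nz by auto
  have "((\<lambda>y. M y ** matrix_inv (M y)) has_derivative (\<lambda>v. 0)) (at x)"
  proof (rule has_derivative_transform_within_open[OF has_derivative_const[of "mat 1"] open_ball[of x e]])
    show "mat 1 = M y ** matrix_inv (M y)" if "y \<in> ball x e" for y
      using matrix_inv_inverse(1)[OF e(2)[OF that]] by simp
  qed (use e(1) in simp)
  from has_derivative_unique[OF bounded_bilinear.FDERIV[OF bounded_bilinear_matrix_mult M' I'] this]
  have 0: "M x ** I' v + M' v ** matrix_inv (M x) = 0" for v by (simp add: fun_eq_iff)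
  have "I' v = - (matrix_inv (M x) ** M' v ** matrix_inv (M x))" for v
  proof -
    have "matrix_inv (M x) ** (M x ** I' v) = - (matrix_inv (M x) ** M' v ** matrix_inv (M x))"
      using 0[of v] by (simp add: eq_neg_iff_add_eq_0[symmetric] matrix_distribs matrix_assoc)
    then show ?thesis by (simp add: matrix_mul_assoc matrix_inv_inverse[OF nz])
  qed
  then show ?thesis using I' by presburger
qed

lemma bounded_linear_ctranspose: "bounded_linear (ctranspose :: complex^'n^'m \<Rightarrow> complex^'m^'n)"
  unfolding linear_conv_bounded_linear[symmetric]
  by (auto simp: ctranspose_def vec_eq_iff intro!: linearI)

lemmas ctranspose_add = linear_add[OF bounded_linear.linear[OF bounded_linear_ctranspose]]
  and ctranspose_diff = linear_diff[OF bounded_linear.linear[OF bounded_linear_ctranspose]]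

lemma ctranspose_mult: "ctranspose (A ** B) = ctranspose B ** ctranspose A"
  by (simp add: ctranspose_def matrix_matrix_mult_def vec_eq_iff mult.commute)

lemma ctranspose_ctranspose [simp]: "ctranspose (ctranspose A) = A"
  by (simp add: ctranspose_def vec_eq_iff)

lemma ctranspose_mat_1 [simp]: "ctranspose (mat 1) = mat 1"
  by (simp add: ctranspose_def vec_eq_iff mat_def)

lemma ctranspose_zero [simp]: "ctranspose 0 = 0"
  by (simp add: ctranspose_def vec_eq_iff)

lemma trace_ctranspose: "trace (ctranspose A) = cnj (trace A)"
  by (simp add: trace_def ctranspose_def)

lemma trace_minus: "trace (- A) = - trace (A :: complex^'n^'n)"
  by (simp add: trace_def sum_negf)

lemma trace_sum: "trace (\<Sum>i\<in>I. f i) = (\<Sum>i\<in>I. trace (f i :: complex^'n^'n))"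
  unfolding trace_def by (simp add: sum.swap[of _ I])

lemma trace_scaleR: "trace (r *\<^sub>R A) = r *\<^sub>R trace (A :: complex^'n^'n)"
  by (simp add: trace_def scaleR_sum_right)

lemma trace_mult_ctranspose: "trace (A ** ctranspose A) = of_real ((norm (A :: complex^'n^'n))\<^sup>2)"
proof -
  have "(norm A)\<^sup>2 = (\<Sum>i\<in>UNIV. \<Sum>j\<in>UNIV. (norm (A $ i $ j))\<^sup>2)"
    by (simp add: norm_vec_def L2_set_def sum_nonneg)
  then show ?thesis
    by (simp add: trace_def matrix_matrix_mult_def ctranspose_def complex_norm_square del: of_real_power)
qed

lemma u_inner_commute: "u_inner A B = u_inner B A"
proof -
  have "trace (B ** ctranspose A) = cnj (trace (A ** ctranspose B))"
    unfolding trace_ctranspose[symmetric] by (simp add: ctranspose_mult)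
  then show ?thesis by (simp add: u_inner_def)
qed

lemma bounded_bilinear_u_inner: "bounded_bilinear u_inner"
  unfolding bilinear_conv_bounded_bilinear[symmetric]
  by (auto simp: bilinear_def u_inner_def matrix_distribs trace_add ctranspose_add
      matrix_mult_scaleR_left matrix_mult_scaleR_right trace_scaleR
      linear_cmul[OF bounded_linear.linear[OF bounded_linear_ctranspose]] add_divide_distrib
      intro!: linearI)

lemma u_inner_conjugate:
  assumes "ctranspose A ** A = mat 1"
  shows "u_inner (A ** X ** ctranspose A) (A ** Y ** ctranspose A) = u_inner X Y"
proof -
  have "trace (A ** X ** ctranspose A ** ctranspose (A ** Y ** ctranspose A)) =
      trace (A ** (X ** (ctranspose A ** A) ** ctranspose Y ** ctranspose A))"
    by (simp add: ctranspose_mult matrix_assoc)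
  also have "\<dots> = trace (X ** ctranspose Y ** (ctranspose A ** A))"
    by (subst trace_mul_sym) (simp add: assms matrix_assoc)
  finally show ?thesis by (simp add: u_inner_def assms)
qed

text \<open>
  Gram--Schmidt orthonormalization of the columns. The vectors are pulled back along \<open>W\<close>, so that the
  Hermitian form \<open>h\<close> lives on the space of the coefficients.
\<close>

lemma exists_orthonormalizing_matrix:
  fixes W :: "complex^'m^'n"
  assumes inj: "\<And>x. W *v x = 0 \<Longrightarrow> x = 0"
  obtains B :: "complex^'m^'m" where "ctranspose (W ** B) ** (W ** B) = mat 1"
proof -
  define h where "h x y = (\<Sum>r\<in>UNIV. cnj ((W *v x) $ r) * (W *v y) $ r)" for x y
  have h_self: "h x x = of_real ((norm (W *v x))\<^sup>2)" for x
    by (simp add: h_def norm_vec_def L2_set_def sum_nonneg complex_norm_square mult.commute del: of_real_power)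
  have h_cnj: "h y x = cnj (h x y)" for x y
    by (simp add: h_def mult.commute)
  have h_scale: "h (c *\<^sub>R x) y = of_real c * h x y" "h x (c *\<^sub>R y) = of_real c * h x y" for c x y
  proof -
    have "W *v (c *\<^sub>R x) = c *\<^sub>R (W *v x)" for x
      by (simp add: matrix_vector_mult_def vec_eq_iff scaleR_sum_right)
    then show "h (c *\<^sub>R x) y = of_real c * h x y" "h x (c *\<^sub>R y) = of_real c * h x y"
      by (simp_all add: h_def sum_distrib_left scaleR_conv_of_real[where 'a=complex] mult_ac)
  qed
  have "\<exists>b. \<forall>i\<in>I. \<forall>j\<in>I. h (b i) (b j) = (if i = j then 1 else 0)" if "finite I" for I :: "'m set"
    using that
  proof (induction I rule: finite_induct)
    case (insert i0 I)
    then obtain b where b: "\<And>i j. i \<in> I \<Longrightarrow> j \<in> I \<Longrightarrow> h (b i) (b j) = (if i = j then 1 else 0)"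
      by blast
    \<comment> \<open>Orthogonality to the earlier vectors is a square linear system with a zero row.\<close>
    define R :: "complex^'m^'m" where
      "R = (\<chi> i s. if i \<in> I then \<Sum>r\<in>UNIV. cnj ((W *v b i) $ r) * W $ r $ s else 0)"
    have "row i0 R = 0" using insert by (simp add: R_def row_def vec_eq_iff)
    then have "det R = 0" by (rule det_zero_row)
    then have "\<not> invertible R" by (simp add: invertible_det_nz)
    then obtain x where x: "R *v x = 0" "x \<noteq> 0"
      unfolding invertible_left_inverse matrix_left_invertible_ker by blast
    have orth: "h (b i) x = 0" if "i \<in> I" for i
    proof -
      have "h (b i) x = (\<Sum>r\<in>UNIV. \<Sum>s\<in>UNIV. cnj ((W *v b i) $ r) * W $ r $ s * x $ s)"
        unfolding h_def by (subst (2) matrix_vector_mult_def) (simp add: sum_distrib_left mult.assoc)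
      also have "\<dots> = (R *v x) $ i"
        using that by (subst sum.swap) (simp add: R_def matrix_vector_mult_def[of "\<chi> i s. _ i s"] sum_distrib_right)
      finally show ?thesis using x by simp
    qed
    define n where "n = norm (W *v x)"
    have "n \<noteq> 0" using x inj by (auto simp: n_def)
    have "h ((1 / n) *\<^sub>R x) ((1 / n) *\<^sub>R x) = of_real (1 / n) * (of_real (1 / n) * of_real (n\<^sup>2))"
      by (simp only: h_scale) (simp only: h_self n_def)
    also have "\<dots> = 1" using \<open>n \<noteq> 0\<close> by (simp add: power2_eq_square)
    finally have hx: "h ((1 / n) *\<^sub>R x) ((1 / n) *\<^sub>R x) = 1" .
    have orth': "h (b i) ((1 / n) *\<^sub>R x) = 0" "h ((1 / n) *\<^sub>R x) (b i) = 0" if "i \<in> I" for i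
      using orth[OF that] h_cnj[of "b i" x] by (simp_all add: h_scale)
    show ?case
    proof (intro exI ballI)
      fix i j assume "i \<in> insert i0 I" "j \<in> insert i0 I"
      then show "h ((b(i0 := (1 / n) *\<^sub>R x)) i) ((b(i0 := (1 / n) *\<^sub>R x)) j) = (if i = j then 1 else 0)"
        using b hx orth' insert(2) by auto
    qed
  qed simp
  from this[OF finite, of UNIV] obtain b :: "'m \<Rightarrow> complex^'m" where b: "\<And>i j. h (b i) (b j) = (if i = j then 1 else 0)"
    unfolding ball_UNIV by blast
  define B where "B = (\<chi> s i. b i $ s)"
  have WB: "(W ** B) $ r $ i = (W *v b i) $ r" for r i
    by (simp add: B_def matrix_matrix_mult_def matrix_vector_mult_def)
  have "(ctranspose (W ** B) ** (W ** B)) $ i $ j = h (b i) (b j)" for i j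
    unfolding h_def WB[symmetric] by (subst matrix_matrix_mult_def) (simp add: ctranspose_def)
  then have "ctranspose (W ** B) ** (W ** B) = mat 1"
    by (simp add: vec_eq_iff b mat_def)
  then show ?thesis by (rule that)
qed

section \<open>A Parseval frame of the unitary Lie algebra\<close>

text \<open>
  Listing each off-diagonal pair in both orders, with half the weight, avoids an order on the
  index type. The result is no basis, but it satisfies Parseval's identity.
\<close>

definition u_frame :: "'n \<times> 'n \<times> bool \<Rightarrow> complex^'n^'n" where
  "u_frame = (\<lambda>(a, b, s). \<chi> i j.
     if s then (of_bool (i = a \<and> j = b) - of_bool (i = b \<and> j = a)) / of_real (sqrt 2)
     else \<i> * (of_bool (i = a \<and> j = b) + of_bool (i = b \<and> j = a)) / of_real (sqrt 2))"

lemma skew_hermitian_nth: "X \<in> skew_hermitian \<Longrightarrow> cnj (X $ i $ j) = - X $ j $ i"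
  by (auto simp: skew_hermitian_def ctranspose_def vec_eq_iff)

lemma u_frame_skew_hermitian: "u_frame x \<in> skew_hermitian"
proof (cases x)
  case (fields a b s)
  have "cnj (u_frame (a, b, s) $ j $ i) = - u_frame (a, b, s) $ i $ j" for i j
  proof -
    define p q r :: complex
      where "p = of_bool (i = a \<and> j = b)" and "q = of_bool (j = a \<and> i = b)" and "r = of_real (sqrt 2)"
    have "u_frame (a, b, s) $ i $ j = (if s then (p - q) / r else \<i> * (p + q) / r)"
      "u_frame (a, b, s) $ j $ i = (if s then (q - p) / r else \<i> * (q + p) / r)"
      unfolding u_frame_def p_def q_def r_def prod.case vec_lambda_beta
      by (simp_all only: conj_commute[of "i = b"] conj_commute[of "j = b"])
    moreover have "cnj p = p" "cnj q = q" "cnj r = r" by (simp_all add: p_def q_def r_def)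
    ultimately show ?thesis by (simp add: add.commute diff_divide_distrib)
  qed
  then show ?thesis by (simp add: skew_hermitian_def ctranspose_def vec_eq_iff fields)
qed

lemma sum_sum_delta:
  fixes c :: "'n::finite \<Rightarrow> 'p::finite \<Rightarrow> 'a::comm_monoid_add"
  shows "(\<Sum>a\<in>UNIV. \<Sum>b\<in>UNIV. if i = a then if j = b then c a b else 0 else 0) = c i j"
proof -
  have "(\<Sum>b\<in>UNIV. if i = a then if j = b then c a b else 0 else 0) = (if i = a then c i j else 0)" for a
    by (cases "i = a") simp_all
  then show ?thesis by simp
qed

text \<open>The sum of \<open>\<xi> \<otimes> \<xi>\<close> over the frame: \<open>-2\<close> times the Casimir tensor \<open>\<Sum> E\<^bsub>ij\<^esub> \<otimes> E\<^bsub>ji\<^esub>\<close> of the matrix algebra.\<close>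

lemma sum_u_frame_mult:
  fixes i j k l :: "'n::finite"
  shows "(\<Sum>x\<in>UNIV. u_frame x $ i $ j * u_frame x $ k $ l) = - 2 * of_bool (i = l \<and> j = k)"
proof -
  define x y x' y' :: "'n \<Rightarrow> 'n \<Rightarrow> complex"
    where "x a b = of_bool (i = a \<and> j = b)" and "y a b = of_bool (i = b \<and> j = a)"
      and "x' a b = of_bool (k = a \<and> l = b)" and "y' a b = of_bool (k = b \<and> l = a)" for a b
  have r2: "complex_of_real (sqrt 2) * complex_of_real (sqrt 2) = 2"
    by (metis of_real_mult of_real_numeral real_sqrt_mult_self abs_numeral)
  have "(\<Sum>x\<in>UNIV. u_frame x $ i $ j * u_frame x $ k $ l) =
      (\<Sum>a\<in>UNIV. \<Sum>b\<in>UNIV. \<Sum>s\<in>UNIV. u_frame (a, b, s) $ i $ j * u_frame (a, b, s) $ k $ l)"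
    by (simp add: UNIV_Times_UNIV[symmetric] sum.cartesian_product' del: UNIV_Times_UNIV)
  also have "\<dots> = (\<Sum>a\<in>UNIV. \<Sum>b\<in>UNIV. - (x a b * y' a b + y a b * x' a b))"
  proof (intro sum.cong refl)
    fix a b
    have "(\<Sum>s\<in>UNIV. u_frame (a, b, s) $ i $ j * u_frame (a, b, s) $ k $ l) =
        (x a b - y a b) / of_real (sqrt 2) * ((x' a b - y' a b) / of_real (sqrt 2)) +
        \<i> * (x a b + y a b) / of_real (sqrt 2) * (\<i> * (x' a b + y' a b) / of_real (sqrt 2))"
      by (simp only: UNIV_bool) (simp add: u_frame_def x_def y_def x'_def y'_def)
    also have "\<dots> = - (x a b * y' a b + y a b * x' a b)"
      by (simp add: r2 algebra_simps divide_simps)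
    finally show "(\<Sum>s\<in>UNIV. u_frame (a, b, s) $ i $ j * u_frame (a, b, s) $ k $ l) =
        - (x a b * y' a b + y a b * x' a b)" .
  qed
  also have "\<dots> = - ((\<Sum>a\<in>UNIV. \<Sum>b\<in>UNIV. x a b * y' a b) + (\<Sum>a\<in>UNIV. \<Sum>b\<in>UNIV. y a b * x' a b))"
    by (simp add: sum_negf sum_subtractf)
  also have "(\<Sum>a\<in>UNIV. \<Sum>b\<in>UNIV. x a b * y' a b) = of_bool (i = l \<and> j = k)"
  proof -
    have "x a b * y' a b = (if i = a then if j = b then of_bool (i = l \<and> j = k) else 0 else 0)" for a b
      by (auto simp: x_def y'_def)
    then show ?thesis by (simp only: sum_sum_delta)
  qed
  also have "(\<Sum>a\<in>UNIV. \<Sum>b\<in>UNIV. y a b * x' a b) = of_bool (i = l \<and> j = k)"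
  proof -
    have "y a b * x' a b = (if j = a then if i = b then of_bool (i = l \<and> j = k) else 0 else 0)" for a b
      by (auto simp: y_def x'_def)
    then show ?thesis by (simp only: sum_sum_delta)
  qed
  finally show ?thesis by simp
qed

lemma sum_u_frame_cnj:
  "(\<Sum>x\<in>UNIV. u_frame x $ i $ j * cnj (u_frame x $ k $ l)) = 2 * of_bool (i = k \<and> j = l)"
  using sum_u_frame_mult[of i j l k]
  by (simp add: skew_hermitian_nth[OF u_frame_skew_hermitian] sum_negf)

text \<open>
  All quadratic expressions in the frame reduce to the two tensors above. In the first, the two
  factors exchange their right-hand sides; in the second, skew-symmetry turns the exchange around.
\<close>

lemma sum_u_frame_contract:
  fixes P :: "complex^'n^'p" and W :: "complex^'q^'n" and P' :: "complex^'n^'r" and W' :: "complex^'s^'n"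
  shows "(\<Sum>x\<in>UNIV. (P ** u_frame x ** W) $ p $ q * (P' ** u_frame x ** W') $ r $ s) =
    - 2 * (P ** W') $ p $ s * (P' ** W) $ r $ q"
proof -
  have e: "(P ** X ** W) $ p $ q = (\<Sum>i\<in>UNIV. \<Sum>j\<in>UNIV. P $ p $ i * W $ j $ q * X $ i $ j)"
    for P :: "complex^'n^'a" and W :: "complex^'b^'n" and X p q
    unfolding matrix_matrix_mult_def
    by (simp add: sum_distrib_left sum_distrib_right) (subst sum.swap, simp add: mult_ac)
  have "(\<Sum>x\<in>UNIV. (P ** u_frame x ** W) $ p $ q * (P' ** u_frame x ** W') $ r $ s) =
    (\<Sum>x\<in>UNIV. \<Sum>i\<in>UNIV. \<Sum>j\<in>UNIV. \<Sum>k\<in>UNIV. \<Sum>l\<in>UNIV.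
      P $ p $ i * W $ j $ q * (P' $ r $ k * W' $ l $ s) * (u_frame x $ i $ j * u_frame x $ k $ l))"
    unfolding e sum_distrib_right unfolding sum_distrib_left by (intro sum.cong refl) (simp add: mult_ac)
  also have "\<dots> = (\<Sum>i\<in>UNIV. \<Sum>j\<in>UNIV. \<Sum>k\<in>UNIV. \<Sum>l\<in>UNIV.
      P $ p $ i * W $ j $ q * (P' $ r $ k * W' $ l $ s) * (\<Sum>x\<in>UNIV. u_frame x $ i $ j * u_frame x $ k $ l))"
    unfolding sum_distrib_left
    by (subst sum.swap, intro sum.cong refl, subst sum.swap, intro sum.cong refl,
        subst sum.swap, intro sum.cong refl, rule sum.swap)
  also have "\<dots> = (\<Sum>i\<in>UNIV. \<Sum>j\<in>UNIV. - 2 * (P $ p $ i * W' $ i $ s) * (P' $ r $ j * W $ j $ q))"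
  proof (intro sum.cong refl)
    fix i j
    have "P $ p $ i * W $ j $ q * (P' $ r $ k * W' $ l $ s) * (\<Sum>x\<in>UNIV. u_frame x $ i $ j * u_frame x $ k $ l) =
      (if j = k then if i = l then - 2 * (P $ p $ i * W' $ i $ s) * (P' $ r $ j * W $ j $ q) else 0 else 0)" for k l
      unfolding sum_u_frame_mult by auto
    then show "(\<Sum>k\<in>UNIV. \<Sum>l\<in>UNIV.
      P $ p $ i * W $ j $ q * (P' $ r $ k * W' $ l $ s) * (\<Sum>x\<in>UNIV. u_frame x $ i $ j * u_frame x $ k $ l)) =
      - 2 * (P $ p $ i * W' $ i $ s) * (P' $ r $ j * W $ j $ q)"
      by (simp only: sum_sum_delta)
  qed
  also have "\<dots> = - 2 * (P ** W') $ p $ s * (P' ** W) $ r $ q"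
    by (simp add: matrix_matrix_mult_def sum_distrib_left sum_distrib_right sum_negf mult_ac)
  finally show ?thesis .
qed

lemma sum_u_frame_contract_cnj:
  fixes P :: "complex^'n^'p" and W :: "complex^'q^'n" and P' :: "complex^'n^'r" and W' :: "complex^'s^'n"
  shows "(\<Sum>x\<in>UNIV. (P ** u_frame x ** W) $ p $ q * cnj ((P' ** u_frame x ** W') $ r $ s)) =
    2 * (P ** ctranspose P') $ p $ r * (ctranspose W' ** W) $ s $ q"
proof -
  have "cnj ((P' ** u_frame x ** W') $ r $ s) = - (ctranspose W' ** u_frame x ** ctranspose P') $ s $ r" for x
  proof -
    have "cnj ((P' ** u_frame x ** W') $ r $ s) = ctranspose (P' ** u_frame x ** W') $ s $ r"
      by (simp add: ctranspose_def)
    also have "\<dots> = (ctranspose W' ** (- u_frame x) ** ctranspose P') $ s $ r"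
      using u_frame_skew_hermitian[of x] by (simp add: ctranspose_mult skew_hermitian_def matrix_assoc)
    finally show ?thesis by (simp add: matrix_distribs)
  qed
  then show ?thesis
    using sum_u_frame_contract[of P W p q "ctranspose W'" "ctranspose P'" s r] by (simp add: sum_negf)
qed

lemma sum_u_frame_casimir:
  "(\<Sum>x\<in>UNIV. u_frame x ** M ** u_frame x) = mat (- 2 * trace M)"
proof -
  have "(\<Sum>x\<in>UNIV. u_frame x ** M ** u_frame x) $ i $ j =
      (\<Sum>x\<in>UNIV. \<Sum>k\<in>UNIV. (u_frame x ** M) $ i $ k * u_frame x $ k $ j)" for i j
    by (subst (2) matrix_matrix_mult_def) simp
  also have "\<dots> i j = (\<Sum>k\<in>UNIV. \<Sum>x\<in>UNIV. (u_frame x ** M) $ i $ k * u_frame x $ k $ j)" for i j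
    by (rule sum.swap)
  also have "\<dots> i j = (\<Sum>k\<in>UNIV. - 2 * mat 1 $ i $ j * M $ k $ k)" for i j
    using sum_u_frame_contract[of "mat 1" M i _ "mat 1" "mat 1" _ j] by simp
  also have "\<dots> i j = mat (- 2 * trace M) $ i $ j" for i j
    by (simp add: mat_def trace_def sum_distrib_left sum_negf)
  finally show ?thesis by (simp add: vec_eq_iff)
qed

lemma u_frame_parseval:
  assumes "X \<in> skew_hermitian"
  shows "(\<Sum>x\<in>UNIV. u_inner X (u_frame x) *\<^sub>R u_frame x) = X"
proof -
  have "of_real (u_inner X (u_frame x)) = (\<Sum>i\<in>UNIV. \<Sum>j\<in>UNIV. X $ i $ j * cnj (u_frame x $ i $ j)) / 2" for x
  proof -
    have t: "trace (X ** ctranspose (u_frame x)) = (\<Sum>i\<in>UNIV. \<Sum>j\<in>UNIV. X $ i $ j * cnj (u_frame x $ i $ j))"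
      by (simp add: trace_def matrix_matrix_mult_def ctranspose_def)
    have "cnj (trace (X ** ctranspose (u_frame x))) = trace (u_frame x ** ctranspose X)"
      unfolding trace_ctranspose[symmetric] by (simp add: ctranspose_mult)
    also have "\<dots> = trace (X ** ctranspose (u_frame x))"
      using assms u_frame_skew_hermitian[of x]
      by (simp add: skew_hermitian_def matrix_distribs trace_minus trace_mul_sym[of X])
    finally have "of_real (Re (trace (X ** ctranspose (u_frame x)))) = trace (X ** ctranspose (u_frame x))"
      by (simp add: complex_eq_iff)
    then show ?thesis by (simp add: u_inner_def t)
  qed
  then have "(\<Sum>x\<in>UNIV. u_inner X (u_frame x) *\<^sub>R u_frame x) $ k $ l =
      (\<Sum>x\<in>UNIV. \<Sum>i\<in>UNIV. \<Sum>j\<in>UNIV. X $ i $ j / 2 * (u_frame x $ k $ l * cnj (u_frame x $ i $ j)))" for k l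
    by (simp add: scaleR_conv_of_real[where 'a=complex] sum_distrib_left sum_distrib_right sum_divide_distrib mult_ac)
  also have "\<dots> k l = (\<Sum>i\<in>UNIV. \<Sum>j\<in>UNIV. X $ i $ j / 2 * (\<Sum>x\<in>UNIV. u_frame x $ k $ l * cnj (u_frame x $ i $ j)))" for k l
    unfolding sum_distrib_left by (subst sum.swap, intro sum.cong refl, rule sum.swap)
  also have "\<dots> k l = (\<Sum>i\<in>UNIV. \<Sum>j\<in>UNIV. if k = i then if l = j then X $ k $ l else 0 else 0)" for k l
    unfolding sum_u_frame_cnj by (intro sum.cong refl) auto
  also have "\<dots> k l = X $ k $ l" for k l by (rule sum_sum_delta)
  finally show ?thesis by (simp add: vec_eq_iff)
qed

text \<open>Invariance of the inner product under the adjoint representation.\<close>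

lemma u_inner_commutator_antisym:
  assumes "X \<in> skew_hermitian" "Y \<in> skew_hermitian" "Z \<in> skew_hermitian"
  shows "u_inner (Y ** X - X ** Y) Z = - u_inner (Z ** X - X ** Z) Y"
proof -
  have "trace (Y ** X ** Z) = trace (X ** Z ** Y)" "trace (X ** Y ** Z) = trace (Z ** X ** Y)"
    by (metis trace_mul_sym matrix_mul_assoc)+
  then show ?thesis
    using assms
    by (simp add: u_inner_def skew_hermitian_def matrix_distribs trace_minus trace_sub) (simp add: field_simps)
qed

section \<open>Affine coordinates and the action of the unitary group\<close>

text \<open>
  Block columns and block rows of a matrix are its products with these isometries. The rows selected
  by \<open>top_incl\<close> become the affine coordinates, those of \<open>block_incl None\<close> the denominator.
\<close>

definition block_incl :: "'k option \<Rightarrow> complex^'m::finite^('k::finite option \<times> 'm)" where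
  "block_incl l = (\<chi> r c. of_bool (r = (l, c)))"

definition top_incl :: "complex^('k::finite \<times> 'm::finite)^('k option \<times> 'm)" where
  "top_incl = (\<chi> r c. of_bool (r = (Some (fst c), snd c)))"

text \<open>
  In homogeneous coordinates the affine coordinate \<open>w\<^sub>j\<close> is the column space of the matrix
  \<open>(w\<^sub>j; I)\<close>, the kernel of \<open>(I, -w\<^sub>j)\<close>.
\<close>

definition homog :: "('k::finite, 'm::finite) affine_space \<Rightarrow> 'k option \<Rightarrow> complex^'m^('k option \<times> 'm)" where
  "homog w j = top_incl ** (w $ j) + block_incl None"

definition cohomog :: "('k::finite, 'm::finite) affine_space \<Rightarrow> 'k option \<Rightarrow> complex^('k option \<times> 'm)^('k \<times> 'm)" where
  "cohomog w j = ctranspose top_incl - (w $ j) ** ctranspose (block_incl None)"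

text \<open>
  The velocity of \<open>w\<close> under the one-parameter group generated by \<open>\<xi>\<close>, which acts by matrix
  fractional linear transformations.
\<close>

definition action_field :: "('k::finite, 'm::finite) block_matrix \<Rightarrow> ('k, 'm) affine_space \<Rightarrow> ('k, 'm) affine_space" where
  "action_field \<xi> w = (\<chi> j. cohomog w j ** \<xi> ** homog w j)"

lemma matrix_mult_nth: "(A ** B) $ i $ j = (\<Sum>k\<in>UNIV. A $ i $ k * B $ k $ j)"
  by (simp add: matrix_matrix_mult_def)

lemma sum_of_bool_mult:
  fixes f :: "'a::finite \<Rightarrow> complex"
  shows "(\<Sum>k\<in>UNIV. of_bool (k = a) * f k) = f a" "(\<Sum>k\<in>UNIV. of_bool (a = k) * f k) = f a"
proof -
  have "(\<Sum>k\<in>UNIV. of_bool (k = a) * f k) = (\<Sum>k\<in>UNIV. if k = a then f k else 0)"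
    by (rule sum.cong) auto
  then show "(\<Sum>k\<in>UNIV. of_bool (k = a) * f k) = f a" by simp
  then show "(\<Sum>k\<in>UNIV. of_bool (a = k) * f k) = f a" by (simp only: eq_commute[of a])
qed

lemma top_incl_nth [simp]:
  "top_incl $ (None, b) $ k = 0" "top_incl $ (Some a, b) $ k = of_bool ((a, b) = k)"
  by (cases k; auto simp: top_incl_def)+

lemma cnj_of_bool: "cnj (of_bool b) = of_bool b"
  by simp

lemma block_incl_orthonormal:
  "ctranspose (block_incl l) ** block_incl j = (if l = j then mat 1 else 0 :: complex^'m::finite^'m)"
  by (auto simp: vec_eq_iff matrix_mult_nth ctranspose_def block_incl_def mat_def)

lemma top_incl_orthonormal: "ctranspose top_incl ** top_incl = (mat 1 :: complex^('k::finite \<times> 'm::finite)^('k \<times> 'm))"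
proof -
  have "cnj (top_incl $ r $ a) * top_incl $ r $ b = (if r = (Some (fst a), snd a) then of_bool (a = b) else 0)" for r and a b :: "'k \<times> 'm"
    by (cases a; cases b) (auto simp: top_incl_def)
  then show ?thesis
    by (simp add: vec_eq_iff matrix_mult_nth ctranspose_def mat_def)
qed

lemma top_incl_block_incl: "ctranspose top_incl ** block_incl None = 0" "ctranspose (block_incl None) ** top_incl = 0"
  by (auto simp: vec_eq_iff matrix_mult_nth ctranspose_def block_incl_def top_incl_def)

lemma sum_block_incl: "(\<Sum>l\<in>UNIV. block_incl l ** ctranspose (block_incl l)) = (mat 1 :: complex^('k::finite option \<times> 'm::finite)^('k option \<times> 'm))"
proof -
  have "(block_incl l ** ctranspose (block_incl l)) $ (a, b) $ (c, d) = of_bool (a = l \<and> c = l \<and> b = d)"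
    for l a c :: "'k::finite option" and b d :: "'m::finite"
    by (simp add: matrix_mult_nth ctranspose_def block_incl_def cnj_of_bool mult.assoc sum_of_bool_mult) auto
  then show ?thesis
    by (auto simp: vec_eq_iff mat_def sum_of_bool_mult)
qed

lemma top_incl_complement:
  "top_incl ** ctranspose top_incl = (mat 1 :: complex^('k::finite option \<times> 'm::finite)^('k option \<times> 'm)) - block_incl None ** ctranspose (block_incl None)"
proof -
  have "(top_incl ** ctranspose top_incl) $ (a, b) $ (c, d) = of_bool (a = c \<and> b = d \<and> a \<noteq> None)"
    for a c :: "'k::finite option" and b d :: "'m::finite"
    by (cases a; cases c) (auto simp: matrix_mult_nth ctranspose_def sum_of_bool_mult cnj_of_bool simp del: of_bool_conj)
  moreover have "(block_incl None ** ctranspose (block_incl None)) $ (a, b) $ (c, d) = of_bool (a = None \<and> c = None \<and> b = d)"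
    for a c :: "'k::finite option" and b d :: "'m::finite"
    by (simp add: matrix_mult_nth ctranspose_def block_incl_def cnj_of_bool mult.assoc sum_of_bool_mult) auto
  ultimately show ?thesis by (auto simp: vec_eq_iff mat_def)
qed

lemma block_eq: "block A l j = ctranspose (block_incl l) ** A ** block_incl j"
proof -
  have "(ctranspose (block_incl l) ** A) $ a $ k = A $ (l, a) $ k" for a k
    by (simp add: matrix_mult_nth ctranspose_def block_incl_def cnj_of_bool sum_of_bool_mult del: of_bool_conj)
  then have "(ctranspose (block_incl l) ** A ** block_incl j) $ a $ b = A $ (l, a) $ (j, b)" for a b
    by (subst matrix_mult_nth) (simp add: block_incl_def mult.commute[of _ "of_bool _"] sum_of_bool_mult)
  then show ?thesis by (simp add: vec_eq_iff block_def)
qed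

lemma homog_parts:
  "ctranspose (block_incl None) ** homog w j = mat 1" "ctranspose top_incl ** homog w j = w $ j"
  by (simp_all add: homog_def matrix_distribs matrix_mul_assoc block_incl_orthonormal top_incl_orthonormal
      top_incl_block_incl)

lemma cohomog_homog: "cohomog w j ** homog w l = w $ l - w $ j"
  by (simp add: cohomog_def matrix_distribs homog_parts matrix_assoc)

lemma cohomog_top_incl: "cohomog w j ** top_incl = mat 1"
  by (simp add: cohomog_def matrix_distribs top_incl_orthonormal top_incl_block_incl matrix_assoc)

lemma top_incl_cohomog: "top_incl ** cohomog w j = mat 1 - homog w j ** ctranspose (block_incl None)"
  by (simp add: cohomog_def homog_def matrix_distribs top_incl_complement matrix_mul_assoc)

lemma cohomog_self: "cohomog w j ** ctranspose (cohomog w l) = mat 1 + w $ j ** ctranspose (w $ l)"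
  by (simp add: cohomog_def ctranspose_diff ctranspose_mult matrix_distribs top_incl_orthonormal
      top_incl_block_incl block_incl_orthonormal matrix_assoc)
     (simp add: matrix_mul_assoc block_incl_orthonormal top_incl_block_incl)

lemma homog_self: "ctranspose (homog w j) ** homog w l = mat 1 + ctranspose (w $ j) ** w $ l"
proof -
  have "ctranspose (homog w j) ** homog w l =
      ctranspose (w $ j) ** (ctranspose top_incl ** homog w l) + ctranspose (block_incl None) ** homog w l"
    by (subst homog_def) (simp add: ctranspose_add ctranspose_mult matrix_distribs matrix_assoc)
  then show ?thesis by (simp add: homog_parts)
qed

lemma homog_orthogonal:
  "w \<in> affine_image \<Longrightarrow> j \<noteq> l \<Longrightarrow> ctranspose (homog w j) ** homog w l = 0"
  by (simp add: homog_self affine_image_def)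

lemma linear_action_field: "linear (\<lambda>\<xi>. action_field \<xi> w)"
  by (auto simp: action_field_def vec_eq_iff matrix_distribs matrix_mult_scaleR_left matrix_mult_scaleR_right intro!: linearI)

text \<open>
  The blocks \<open>w\<^sub>l\<^sup>* v\<^sub>j\<close> with \<open>l \<noteq> j\<close> are linear coordinates of a vector \<open>v\<close> at \<open>w\<close>; for an action field
  they are the off-diagonal blocks of its generator in the frame of the homogeneous coordinates.
\<close>

lemma homog_action_field:
  assumes "w \<in> affine_image" "l \<noteq> j"
  shows "ctranspose (w $ l) ** action_field \<xi> w $ j = ctranspose (homog w l) ** \<xi> ** homog w j"
proof -
  have "ctranspose (w $ l) = ctranspose (homog w l) ** top_incl"
    by (metis homog_parts(2) ctranspose_mult ctranspose_ctranspose)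
  then have "ctranspose (w $ l) ** action_field \<xi> w $ j =
      ctranspose (homog w l) ** (top_incl ** cohomog w j) ** \<xi> ** homog w j"
    by (simp add: action_field_def matrix_assoc)
  also have "\<dots> = ctranspose (homog w l) ** \<xi> ** homog w j"
    using homog_orthogonal[OF assms]
    by (simp add: top_incl_cohomog matrix_distribs matrix_mul_assoc)
  finally show ?thesis .
qed

definition action_field_deriv ::
    "('k::finite, 'm::finite) block_matrix \<Rightarrow> ('k, 'm) affine_space \<Rightarrow> ('k, 'm) affine_space \<Rightarrow> ('k, 'm) affine_space" where
  "action_field_deriv \<xi> w v = (\<chi> j. cohomog w j ** \<xi> ** top_incl ** v $ j
     - v $ j ** ctranspose (block_incl None) ** \<xi> ** homog w j)"

lemma has_derivative_action_field: "(action_field \<xi> has_derivative action_field_deriv \<xi> w) (at w)"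
proof (rule has_derivative_vecI)
  fix j
  note m = bounded_bilinear.FDERIV[OF bounded_bilinear_matrix_mult]
  have nth: "((\<lambda>w. w $ j) has_derivative (\<lambda>v. v $ j)) (at w)"
    by (rule bounded_linear_imp_has_derivative[OF bounded_linear_vec_nth])
  have 1: "((\<lambda>w. cohomog w j) has_derivative (\<lambda>v. 0 - (w $ j ** 0 + v $ j ** ctranspose (block_incl None)))) (at w)"
    unfolding cohomog_def by (intro has_derivative_diff has_derivative_const m nth)
  have 2: "((\<lambda>w. homog w j) has_derivative (\<lambda>v. (top_incl ** v $ j + 0 ** w $ j) + 0)) (at w)"
    unfolding homog_def by (intro has_derivative_add has_derivative_const m nth)
  have "((\<lambda>w. cohomog w j ** \<xi> ** homog w j) has_derivative
      (\<lambda>v. (cohomog w j ** \<xi>) ** ((top_incl ** v $ j + 0 ** w $ j) + 0) +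
        (cohomog w j ** 0 + (0 - (w $ j ** 0 + v $ j ** ctranspose (block_incl None))) ** \<xi>) ** homog w j)) (at w)"
    by (intro m has_derivative_const 1 2)
  then show "((\<lambda>w. action_field \<xi> w $ j) has_derivative (\<lambda>v. action_field_deriv \<xi> w v $ j)) (at w)"
    by (simp add: action_field_def action_field_deriv_def matrix_distribs matrix_mul_assoc)
qed

text \<open>
  The part of the derivative along another action field that is symmetric in the two generators
  drops out of the bracket.
\<close>

lemma action_field_deriv_action_field:
  "action_field_deriv \<xi> w (action_field \<eta> w) $ j = cohomog w j ** (\<xi> ** \<eta>) ** homog w j
    - cohomog w j ** \<xi> ** homog w j ** ctranspose (block_incl None) ** \<eta> ** homog w j
    - cohomog w j ** \<eta> ** homog w j ** ctranspose (block_incl None) ** \<xi> ** homog w j"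
proof -
  have "cohomog w j ** \<xi> ** top_incl ** action_field \<eta> w $ j =
      cohomog w j ** \<xi> ** (top_incl ** cohomog w j) ** \<eta> ** homog w j"
    by (simp add: action_field_def matrix_assoc)
  also have "\<dots> = cohomog w j ** (\<xi> ** \<eta>) ** homog w j
      - cohomog w j ** \<xi> ** homog w j ** ctranspose (block_incl None) ** \<eta> ** homog w j"
    by (simp add: top_incl_cohomog matrix_distribs matrix_assoc)
  finally show ?thesis by (simp add: action_field_deriv_def) (simp add: action_field_def matrix_assoc)
qed

lemma action_field_bracket:
  "action_field_deriv \<xi> w (action_field \<eta> w) - action_field_deriv \<eta> w (action_field \<xi> w) =
    action_field (\<xi> ** \<eta> - \<eta> ** \<xi>) w"
  by (simp add: vec_eq_iff[of _ "action_field _ _"] action_field_deriv_action_field)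
     (simp add: action_field_def matrix_distribs)

text \<open>
  These vectors are the first order part of the sum of the squares of the action fields. The Casimir
  identity makes each of its two contributions a multiple of \<open>(I, -w\<^sub>j) (w\<^sub>j; I) = 0\<close>.
\<close>

lemma sum_action_field_deriv_self:
  "(\<Sum>x\<in>UNIV. action_field_deriv (u_frame x) w (action_field (u_frame x) w)) = 0"
proof -
  have "(\<Sum>x\<in>UNIV. action_field_deriv (u_frame x) w (action_field (u_frame x) w)) $ j = 0" for j
  proof -
    let ?Q = "top_incl ** cohomog w j" and ?R = "homog w j ** ctranspose (block_incl None)"
    have "(\<Sum>x\<in>UNIV. action_field_deriv (u_frame x) w (action_field (u_frame x) w)) $ j =
        cohomog w j ** (\<Sum>x\<in>UNIV. u_frame x ** ?Q ** u_frame x) ** homog w j -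
        cohomog w j ** (\<Sum>x\<in>UNIV. u_frame x ** ?R ** u_frame x) ** homog w j"
      by (simp add: action_field_deriv_def action_field_def matrix_mult_sum_left matrix_mult_sum_right
          sum_subtractf matrix_assoc)
    also have "\<dots> = 0"
    proof -
      have "cohomog w j ** mat c ** homog w j = 0" for c
      proof -
        have "(cohomog w j ** mat c) $ p $ q = c * cohomog w j $ p $ q" for p q
          by (simp add: matrix_mult_nth mat_def if_distrib mult.commute cong: if_cong)
        then have "(cohomog w j ** mat c ** homog w j) $ p $ q = c * (cohomog w j ** homog w j) $ p $ q" for p q
          by (simp add: matrix_mult_nth[of "_ ** mat c"] matrix_mult_nth[of "cohomog w j"] sum_distrib_left mult.assoc)
        then show ?thesis by (simp add: vec_eq_iff cohomog_homog)
      qed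
      then show ?thesis by (simp add: sum_u_frame_casimir)
    qed
    finally show ?thesis .
  qed
  then show ?thesis by (simp add: vec_eq_iff)
qed

section \<open>Unitary matrices with given affine coordinates\<close>

lemma block_ext:
  assumes "\<And>l j. block A l j = block B l j" shows "A = B"
  using assms by (auto simp: block_def vec_eq_iff)

lemma block_mult_block_incl:
  "ctranspose (block_incl l) ** (A ** block_incl j) = block A l j"
  by (simp add: block_eq matrix_assoc)

lemma affine_coords_eq:
  fixes A :: "('k::finite, 'm::finite) block_matrix"
  shows "affine_coords A $ j = ctranspose top_incl ** (A ** block_incl j) ** matrix_inv (block A None j)"
proof -
  have 1: "(A ** block_incl j) $ r $ k = A $ r $ (j, k)" for r k
    by (simp add: matrix_mult_nth block_incl_def mult.commute[of _ "of_bool _"] sum_of_bool_mult del: of_bool_conj)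
  have 2: "(ctranspose top_incl ** X) $ (a, b) $ k = X $ (Some a, b) $ k"
    for X :: "complex^'m^('k option \<times> 'm)" and a b k
    by (simp add: matrix_mult_nth ctranspose_def top_incl_def cnj_of_bool sum_of_bool_mult del: of_bool_conj)
  have "affine_coords A $ j $ (a, b) $ c =
      (ctranspose top_incl ** (A ** block_incl j) ** matrix_inv (block A None j)) $ (a, b) $ c" for a b c
  proof -
    have "affine_coords A $ j $ (a, b) $ c = (\<Sum>k\<in>UNIV. A $ (Some a, b) $ (j, k) * matrix_inv (block A None j) $ k $ c)"
      by (simp add: affine_coords_def matrix_mult_nth) (simp add: block_def)
    then show ?thesis
      unfolding matrix_mult_nth[of "ctranspose top_incl ** (A ** block_incl j)"] 2 1 .
  qed
  then show ?thesis by (auto simp: vec_eq_iff)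
qed

lemma homog_affine_coords:
  assumes "A \<in> affine_domain"
  shows "homog (affine_coords A) j ** block A None j = A ** block_incl j"
proof -
  have "matrix_inv (block A None j) ** block A None j = mat 1"
    using assms by (intro matrix_inv_inverse) (simp add: affine_domain_def)
  then have "homog (affine_coords A) j ** block A None j =
      top_incl ** ctranspose top_incl ** (A ** block_incl j) + block_incl None ** block A None j"
    by (simp add: homog_def affine_coords_eq matrix_distribs matrix_assoc)
  also have "block_incl None ** block A None j = block_incl None ** ctranspose (block_incl None) ** (A ** block_incl j)"
    by (simp add: block_eq matrix_assoc)
  finally show ?thesis by (simp add: top_incl_complement matrix_distribs)
qed

text \<open>
  Differentiating \<open>w\<^sub>j A\<^bsub>(k+1)j\<^esub> = (A\<^bsub>1j\<^esub>; \<dots>; A\<^bsub>kj\<^esub>)\<close> shows that the submersion maps the tangent vector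
  \<open>\<xi> A\<close> of the unitary group to the action field of \<open>\<xi>\<close>.
\<close>

lemma has_derivative_affine_coords:
  fixes A :: "('k::finite, 'm::finite) block_matrix"
  assumes A: "A \<in> affine_domain"
  shows "(affine_coords has_derivative (\<lambda>Z. action_field (Z ** ctranspose A) (affine_coords A))) (at A)"
proof (rule has_derivative_vecI)
  fix j
  let ?w = "affine_coords A" and ?I = "matrix_inv (block A None j)"
  have nz: "det (block A None j) \<noteq> 0" using A by (simp add: affine_domain_def)
  have AA: "ctranspose A ** A = mat 1" using A by (simp add: affine_domain_def unitary_group_def)
  have lin: "((\<lambda>A. L ** (A ** R)) has_derivative (\<lambda>Z. L ** (Z ** R))) (at A)"
    for L :: "complex^('k option \<times> 'm)^'p" and R :: "complex^'q^('k option \<times> 'm)"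
    by (intro bounded_linear.has_derivative[OF bounded_bilinear.bounded_linear_right[OF bounded_bilinear_matrix_mult]]
        bounded_linear.has_derivative[OF bounded_bilinear.bounded_linear_left[OF bounded_bilinear_matrix_mult]]
        has_derivative_ident)
  have b: "((\<lambda>A. block A None j) has_derivative (\<lambda>Z. block Z None j)) (at A)"
    using lin[of "ctranspose (block_incl None)" "block_incl j"] by (simp add: block_mult_block_incl)
  have "((\<lambda>A. affine_coords A $ j) has_derivative
    (\<lambda>Z. ctranspose top_incl ** (A ** block_incl j) ** - (?I ** block Z None j ** ?I) +
      ctranspose top_incl ** (Z ** block_incl j) ** ?I)) (at A)"
    unfolding affine_coords_eq
    by (intro bounded_bilinear.FDERIV[OF bounded_bilinear_matrix_mult] lin has_derivative_matrix_inv b nz)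
  moreover have "ctranspose top_incl ** (A ** block_incl j) ** - (?I ** block Z None j ** ?I) +
      ctranspose top_incl ** (Z ** block_incl j) ** ?I = action_field (Z ** ctranspose A) ?w $ j" for Z
  proof -
    have "homog ?w j = homog ?w j ** (block A None j ** ?I)"
      by (simp add: matrix_inv_inverse[OF nz])
    then have h: "homog ?w j = A ** block_incl j ** ?I"
      by (simp add: matrix_mul_assoc homog_affine_coords[OF A])
    have "action_field (Z ** ctranspose A) ?w $ j = cohomog ?w j ** Z ** (ctranspose A ** A) ** block_incl j ** ?I"
      by (simp add: action_field_def h matrix_assoc)
    also have "\<dots> = cohomog ?w j ** (Z ** block_incl j) ** ?I" by (simp add: AA matrix_assoc)
    finally show ?thesis
      by (simp add: cohomog_def affine_coords_eq[of A] matrix_distribs block_eq matrix_assoc)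
  qed
  ultimately show "((\<lambda>A. affine_coords A $ j) has_derivative
      (\<lambda>Z. action_field (Z ** ctranspose A) ?w $ j)) (at A)" by simp
qed

text \<open>
  The homogeneous coordinates of a point have mutually orthogonal column spaces, so orthonormalizing
  each of them separately yields a unitary matrix.
\<close>

lemma exists_unitary_over:
  fixes w :: "('k::finite, 'm::finite) affine_space"
  assumes w: "w \<in> affine_image"
  obtains A where "A \<in> affine_domain" "affine_coords A = w"
proof -
  have "\<exists>B :: complex^'m^'m. ctranspose (homog w j ** B) ** (homog w j ** B) = mat 1" for j
  proof (rule exists_orthonormalizing_matrix[of "homog w j"])
    fix x assume "homog w j *v x = 0"
    then have "(ctranspose (block_incl None) ** homog w j) *v x = 0"
      by (simp add: matrix_vector_mul_assoc[symmetric])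
    then show "x = 0" by (simp add: homog_parts)
  qed blast
  then obtain B :: "'k option \<Rightarrow> complex^'m^'m"
    where B: "\<And>j. ctranspose (homog w j ** B j) ** (homog w j ** B j) = mat 1" by metis
  define A where "A = (\<Sum>j\<in>UNIV. homog w j ** B j ** ctranspose (block_incl j))"
  have A: "A ** block_incl j = homog w j ** B j" for j
  proof -
    have "A ** block_incl j = (\<Sum>l\<in>UNIV. homog w l ** B l ** (ctranspose (block_incl l) ** block_incl j))"
      by (simp add: A_def matrix_mult_sum_left matrix_assoc)
    also have "\<dots> = (\<Sum>l\<in>UNIV. if l = j then homog w l ** B l else 0)"
      by (intro sum.cong refl) (simp add: block_incl_orthonormal)
    finally show ?thesis by simp
  qed
  have "ctranspose A ** A = mat 1"
  proof (rule block_ext)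
    fix l j
    have "block (ctranspose A ** A) l j = ctranspose (A ** block_incl l) ** (A ** block_incl j)"
      by (simp add: block_eq ctranspose_mult matrix_assoc)
    also have "\<dots> = (if l = j then mat 1 else 0)"
    proof (cases "l = j")
      case False
      have "ctranspose (homog w l ** B l) ** (homog w j ** B j) =
          ctranspose (B l) ** (ctranspose (homog w l) ** homog w j) ** B j"
        by (simp add: ctranspose_mult matrix_assoc)
      then show ?thesis using False by (simp add: A homog_orthogonal[OF w])
    qed (simp add: A B)
    also have "\<dots> = block (mat 1) l j"
      by (auto simp: block_def vec_eq_iff mat_def)
    finally show "block (ctranspose A ** A) l j = block (mat 1) l j" .
  qed
  then have unitary: "A \<in> unitary_group"
    by (simp add: unitary_group_def matrix_left_right_inverse)
  have block: "block A None j = B j" for j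
    by (simp add: block_mult_block_incl[symmetric] A matrix_mul_assoc homog_parts)
  have det: "det (B j) \<noteq> 0" for j
  proof -
    have "(ctranspose (homog w j ** B j) ** homog w j) ** B j = mat 1" using B by (simp add: matrix_assoc)
    then have "B j ** (ctranspose (homog w j ** B j) ** homog w j) = mat 1"
      by (simp only: matrix_left_right_inverse)
    then show ?thesis by (rule matrix_inv_eqI)
  qed
  have "A \<in> affine_domain" using unitary det by (simp add: affine_domain_def block)
  moreover have "affine_coords A $ j = w $ j" for j
    by (simp add: affine_coords_eq A block matrix_assoc matrix_inv_inverse[OF det])
      (simp add: homog_parts)
  then have "affine_coords A = w" by (simp add: vec_eq_iff)
  ultimately show ?thesis by (rule that)
qed

section \<open>Horizontal lifts and the metric\<close>

text \<open>Pairing \<open>X\<close> with its own diagonal blocks, which form a vertical matrix, shows that they vanish.\<close>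

lemma horizontal_iff:
  fixes X :: "('k::finite, 'm::finite) block_matrix"
  shows "X \<in> horizontal \<longleftrightarrow> X \<in> skew_hermitian \<and> (\<forall>j. block X j j = 0)"
proof -
  have block_ct: "block (ctranspose Y) l j = ctranspose (block Y j l)" for Y :: "('k, 'm) block_matrix" and l j
    by (simp add: block_def ctranspose_def vec_eq_iff)
  have trace_block: "trace M = (\<Sum>j\<in>UNIV. trace (block M j j))" for M :: "('k, 'm) block_matrix"
    by (simp add: trace_def block_def UNIV_Times_UNIV[symmetric] sum.cartesian_product' del: UNIV_Times_UNIV)
  have block_mult: "block (M ** N) l j = (\<Sum>i\<in>UNIV. block M l i ** block N i j)" for M N :: "('k, 'm) block_matrix" and l j
    by (simp add: block_def vec_eq_iff matrix_mult_nth UNIV_Times_UNIV[symmetric] sum.cartesian_product' del: UNIV_Times_UNIV)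
  have inner: "u_inner X Y = (\<Sum>j\<in>UNIV. Re (trace (block X j j ** ctranspose (block Y j j)))) / 2"
    if Y: "Y \<in> vertical" for X Y :: "('k, 'm) block_matrix"
  proof -
    have "trace (block (X ** ctranspose Y) j j) = trace (block X j j ** ctranspose (block Y j j))" for j
    proof -
      have "block (X ** ctranspose Y) j j = (\<Sum>i\<in>UNIV. block X j i ** ctranspose (block Y j i))"
        by (simp only: block_mult block_ct)
      also have "\<dots> = (\<Sum>i\<in>UNIV. if i = j then block X j j ** ctranspose (block Y j j) else 0)"
        by (rule sum.cong[OF refl]) (use Y in \<open>auto simp: vertical_def\<close>)
      finally show ?thesis by simp
    qed
    then show ?thesis by (simp add: u_inner_def trace_block[of "X ** ctranspose Y"])
  qed
  show ?thesis
  proof (intro iffI conjI allI)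
    assume X: "X \<in> horizontal"
    then show skew: "X \<in> skew_hermitian" by (simp add: horizontal_def)
    fix j
    define Y :: "('k, 'm) block_matrix" where
      "Y = (\<chi> r s. if fst r = j \<and> fst s = j then X $ r $ s else 0)"
    have blockY: "block Y l i = (if l = j \<and> i = j then block X j j else 0)" for l i
      by (auto simp: Y_def block_def vec_eq_iff)
    have "Y \<in> vertical"
      using skew blockY by (auto simp: vertical_def skew_hermitian_def ctranspose_def Y_def vec_eq_iff)
    then have "0 = (\<Sum>i\<in>UNIV. Re (trace (block X i i ** ctranspose (block Y i i)))) / 2"
      using X inner by (simp add: horizontal_def)
    also have "\<dots> = (\<Sum>i\<in>UNIV. if i = j then (norm (block X j j))\<^sup>2 else 0) / 2"
      by (intro arg_cong[where f="\<lambda>x. x / 2"] sum.cong refl) (auto simp: blockY trace_mult_ctranspose trace_0[unfolded mat_0])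
    finally show "block X j j = 0" by simp
  next
    assume "X \<in> skew_hermitian \<and> (\<forall>j. block X j j = 0)"
    then show "X \<in> horizontal" by (simp add: horizontal_def inner trace_0[unfolded mat_0])
  qed
qed

definition homog_gram :: "('k::finite, 'm::finite) affine_space \<Rightarrow> 'k option \<Rightarrow> complex^'m^'m" where
  "homog_gram w j = ctranspose (homog w j) ** homog w j"

text \<open>The orthogonal projection onto the column space of \<open>(w\<^sub>j; I)\<close>.\<close>

definition homog_proj :: "('k::finite, 'm::finite) affine_space \<Rightarrow> 'k option \<Rightarrow> ('k, 'm) block_matrix" where
  "homog_proj w j = homog w j ** matrix_inv (homog_gram w j) ** ctranspose (homog w j)"

text \<open>
  The generator orthogonal to the stabilizer of \<open>w\<close> whose action field at \<open>w\<close> is \<open>u\<close>, written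
  without reference to a unitary matrix over \<open>w\<close>.
\<close>

definition hor_lift :: "('k::finite, 'm::finite) affine_space \<Rightarrow> ('k, 'm) affine_space \<Rightarrow> ('k, 'm) block_matrix" where
  "hor_lift w u = (\<Sum>j\<in>UNIV. (mat 1 - homog_proj w j) ** top_incl ** u $ j ** matrix_inv (homog_gram w j) ** ctranspose (homog w j))"

text \<open>
  The column blocks of a unitary matrix over \<open>w\<close> are orthonormal bases of the column spaces of the
  homogeneous coordinates.
\<close>

lemma homog_gram_unitary:
  assumes A: "A \<in> affine_domain" and w: "affine_coords A = w"
  shows "det (homog_gram w j) \<noteq> 0"
    "homog_proj w j = A ** block_incl j ** ctranspose (block_incl j) ** ctranspose A"
proof -
  let ?B = "block A None j" and ?S = "homog_gram w j"
  have AA: "ctranspose A ** A = mat 1" using A by (simp add: affine_domain_def unitary_group_def)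
  have WB: "homog w j ** ?B = A ** block_incl j" using homog_affine_coords[OF A] w by simp
  have "ctranspose ?B ** ?S ** ?B = ctranspose (homog w j ** ?B) ** (homog w j ** ?B)"
    by (simp add: homog_gram_def ctranspose_mult matrix_assoc)
  also have "\<dots> = ctranspose (block_incl j) ** (ctranspose A ** A) ** block_incl j"
    by (simp add: WB ctranspose_mult matrix_assoc)
  finally have "(ctranspose ?B ** ?S) ** ?B = mat 1" by (simp add: AA block_incl_orthonormal)
  then have "?B ** (ctranspose ?B ** ?S) = mat 1" by (simp only: matrix_left_right_inverse)
  then have "(?B ** ctranspose ?B) ** ?S = mat 1" by (simp add: matrix_assoc)
  then have "?S ** (?B ** ctranspose ?B) = mat 1" by (simp only: matrix_left_right_inverse)
  note inv = matrix_inv_eqI[OF this]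
  from inv(2) show "det ?S \<noteq> 0" .
  have "homog_proj w j = (homog w j ** ?B) ** ctranspose (homog w j ** ?B)"
    by (simp add: homog_proj_def inv(1) ctranspose_mult matrix_assoc)
  then show "homog_proj w j = A ** block_incl j ** ctranspose (block_incl j) ** ctranspose A"
    by (simp add: WB ctranspose_mult matrix_assoc)
qed

context
  fixes w :: "('k::finite, 'm::finite) affine_space"
  assumes w: "w \<in> affine_image"
begin

lemma det_homog_gram: "det (homog_gram w j) \<noteq> 0"
  using exists_unitary_over[OF w] homog_gram_unitary(1) by metis

lemma sum_homog_proj: "(\<Sum>j\<in>UNIV. homog_proj w j) = mat 1"
proof -
  obtain A where A: "A \<in> affine_domain" "affine_coords A = w" using exists_unitary_over[OF w] .
  have "(\<Sum>j\<in>UNIV. homog_proj w j) = A ** (\<Sum>j\<in>UNIV. block_incl j ** ctranspose (block_incl j)) ** ctranspose A"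
    by (simp add: homog_gram_unitary(2)[OF A] matrix_mult_sum_left matrix_mult_sum_right matrix_assoc)
  then show ?thesis using A(1) by (simp add: sum_block_incl affine_domain_def unitary_group_def)
qed

lemma homog_proj_homog: "homog_proj w j ** homog w j = homog w j"
  using matrix_inv_inverse(2)[OF det_homog_gram[of j]]
  by (simp add: homog_proj_def matrix_assoc) (simp add: homog_gram_def[symmetric])

lemma homog_homog_proj:
  "ctranspose (homog w l) ** homog_proj w j = (if l = j then ctranspose (homog w j) else 0)"
  using matrix_inv_inverse(1)[OF det_homog_gram[of j]] homog_orthogonal[OF w, of l j]
  by (auto simp: homog_proj_def matrix_mul_assoc) (simp add: homog_gram_def[symmetric])

lemma ctranspose_homog_proj: "ctranspose (homog_proj w j) = homog_proj w j"
proof -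
  let ?S = "homog_gram w j"
  have "ctranspose ?S = ?S" by (simp add: homog_gram_def ctranspose_mult)
  then have "?S ** ctranspose (matrix_inv ?S) = mat 1"
    using matrix_inv_inverse(2)[OF det_homog_gram[of j]] by (metis ctranspose_mult ctranspose_mat_1)
  from matrix_inv_eqI(1)[OF this] show ?thesis
    by (simp add: homog_proj_def ctranspose_mult matrix_assoc)
qed

lemma linear_hor_lift: "linear (hor_lift w)"
  by (auto simp: hor_lift_def matrix_distribs matrix_mult_scaleR_left matrix_mult_scaleR_right
      sum.distrib sum_negf sum_subtractf scaleR_sum_right scaleR_diff_right algebra_simps intro!: linearI)

lemma action_field_hor_lift: "action_field (hor_lift w u) w = u"
proof -
  have "action_field (hor_lift w u) w $ i = u $ i" for i
  proof -
    have "hor_lift w u ** homog w i = (\<Sum>j\<in>UNIV. if j = i then (mat 1 - homog_proj w i) ** top_incl ** u $ i else 0)"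
      unfolding hor_lift_def matrix_mult_sum_left
      using homog_orthogonal[OF w] matrix_inv_inverse(2)[OF det_homog_gram[of i]]
      by (intro sum.cong refl) (auto simp: matrix_assoc homog_gram_def[symmetric])
    then have "action_field (hor_lift w u) w $ i = cohomog w i ** ((mat 1 - homog_proj w i) ** top_incl ** u $ i)"
      by (simp add: action_field_def matrix_assoc)
    also have "\<dots> = cohomog w i ** top_incl ** u $ i -
        cohomog w i ** homog w i ** matrix_inv (homog_gram w i) ** ctranspose (homog w i) ** top_incl ** u $ i"
      by (simp add: matrix_distribs homog_proj_def matrix_assoc)
    finally show ?thesis by (simp add: cohomog_top_incl cohomog_homog)
  qed
  then show ?thesis by (simp add: vec_eq_iff)
qed

lemma hor_lift_action_field:
  "hor_lift w (action_field \<xi> w) = \<xi> - (\<Sum>j\<in>UNIV. homog_proj w j ** \<xi> ** homog_proj w j)"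
proof -
  have "(mat 1 - homog_proj w j) ** top_incl ** action_field \<xi> w $ j ** matrix_inv (homog_gram w j) ** ctranspose (homog w j) =
      \<xi> ** homog_proj w j - homog_proj w j ** \<xi> ** homog_proj w j" for j
  proof -
    have "(mat 1 - homog_proj w j) ** top_incl ** action_field \<xi> w $ j ** matrix_inv (homog_gram w j) ** ctranspose (homog w j) =
      (mat 1 - homog_proj w j) ** (top_incl ** cohomog w j) ** \<xi> ** homog_proj w j"
      by (simp add: action_field_def homog_proj_def matrix_assoc)
    also have "(mat 1 - homog_proj w j) ** (top_incl ** cohomog w j) = mat 1 - homog_proj w j"
      by (simp add: top_incl_cohomog matrix_distribs matrix_mul_assoc homog_proj_homog)
    finally show ?thesis by (simp add: matrix_distribs)
  qed
  then have "hor_lift w (action_field \<xi> w) = \<xi> ** (\<Sum>j\<in>UNIV. homog_proj w j) - (\<Sum>j\<in>UNIV. homog_proj w j ** \<xi> ** homog_proj w j)"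
    by (simp add: hor_lift_def sum_subtractf matrix_mult_sum_right)
  then show ?thesis by (simp add: sum_homog_proj)
qed

lemma homog_hor_lift:
  "ctranspose (homog w a) ** hor_lift w u ** homog w b = (if a = b then 0 else ctranspose (w $ a) ** u $ b)"
proof -
  have "hor_lift w u ** homog w b = (\<Sum>j\<in>UNIV. if j = b then (mat 1 - homog_proj w b) ** top_incl ** u $ b else 0)"
    unfolding hor_lift_def matrix_mult_sum_left
    using homog_orthogonal[OF w] matrix_inv_inverse(2)[OF det_homog_gram[of b]]
    by (intro sum.cong refl) (auto simp: matrix_assoc homog_gram_def[symmetric])
  then have "ctranspose (homog w a) ** hor_lift w u ** homog w b =
      (ctranspose (homog w a) - ctranspose (homog w a) ** homog_proj w b) ** top_incl ** u $ b"
    by (simp add: matrix_assoc) (simp add: matrix_distribs matrix_mul_assoc)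
  moreover have "ctranspose (homog w a) ** top_incl = ctranspose (w $ a)"
    by (metis homog_parts(2) ctranspose_mult ctranspose_ctranspose)
  ultimately show ?thesis by (simp add: homog_homog_proj)
qed

lemma homog_proj_hor_lift: "homog_proj w j ** hor_lift w u ** homog_proj w j = 0"
proof -
  have "homog_proj w j ** hor_lift w u ** homog_proj w j = homog w j ** matrix_inv (homog_gram w j) **
      (ctranspose (homog w j) ** hor_lift w u ** homog w j) ** matrix_inv (homog_gram w j) ** ctranspose (homog w j)"
    by (simp add: homog_proj_def matrix_assoc)
  then show ?thesis by (simp add: homog_hor_lift)
qed

text \<open>
  Lifting an action field projects its generator orthogonally, so pairing with another lift does
  not see the difference.
\<close>

lemma u_inner_hor_lift:
  "u_inner (hor_lift w (action_field \<xi> w)) (hor_lift w u) = u_inner \<xi> (hor_lift w u)"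
proof -
  let ?L = "hor_lift w u"
  have "trace (homog_proj w j ** \<xi> ** homog_proj w j ** ctranspose ?L) = 0" for j
  proof -
    have "trace (homog_proj w j ** \<xi> ** homog_proj w j ** ctranspose ?L) =
        trace (homog_proj w j ** (\<xi> ** homog_proj w j ** ctranspose ?L))"
      by (simp add: matrix_assoc)
    also have "\<dots> = trace (\<xi> ** ctranspose (homog_proj w j ** ?L ** homog_proj w j))"
      by (subst trace_mul_sym) (simp add: ctranspose_mult ctranspose_homog_proj matrix_assoc)
    also have "\<dots> = 0" by (simp add: homog_proj_hor_lift trace_def)
    finally show ?thesis .
  qed
  then show ?thesis
    by (simp add: hor_lift_action_field u_inner_def matrix_distribs matrix_mult_sum_left trace_sub trace_sum)
qed

text \<open>
  The hypothesis is the linearized equation of the affine image. By completeness of the projections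
  it suffices to test the lift between the column spaces, where \<open>homog_hor_lift\<close> evaluates it.
\<close>

lemma hor_lift_skew_hermitian:
  assumes u: "\<And>j l. j \<noteq> l \<Longrightarrow> ctranspose (u $ j) ** w $ l + ctranspose (w $ j) ** u $ l = 0"
  shows "hor_lift w u \<in> skew_hermitian"
proof -
  let ?L = "hor_lift w u"
  have 0: "ctranspose (homog w a) ** (ctranspose ?L + ?L) ** homog w b = 0" for a b
  proof -
    have "ctranspose (homog w a) ** ctranspose ?L ** homog w b = ctranspose (ctranspose (homog w b) ** ?L ** homog w a)"
      by (simp add: ctranspose_mult matrix_assoc)
    then show ?thesis
      using u[of a b] by (auto simp: matrix_distribs homog_hor_lift ctranspose_mult)
  qed
  have "homog_proj w a ** (ctranspose ?L + ?L) ** homog_proj w b = 0" for a b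
  proof -
    have "homog_proj w a ** (ctranspose ?L + ?L) ** homog_proj w b = homog w a ** matrix_inv (homog_gram w a) **
      (ctranspose (homog w a) ** (ctranspose ?L + ?L) ** homog w b) ** matrix_inv (homog_gram w b) ** ctranspose (homog w b)"
      by (simp add: homog_proj_def matrix_assoc)
    then show ?thesis by (simp only: 0 times0_left times0_right)
  qed
  moreover have "ctranspose ?L + ?L = (\<Sum>a\<in>UNIV. homog_proj w a) ** (ctranspose ?L + ?L) ** (\<Sum>b\<in>UNIV. homog_proj w b)"
    by (simp add: sum_homog_proj)
  ultimately have "ctranspose ?L + ?L = 0"
    by (simp add: matrix_mult_sum_left matrix_mult_sum_right)
  then show ?thesis by (simp add: skew_hermitian_def eq_neg_iff_add_eq_0)
qed

text \<open>
  If \<open>A\<close> lies over \<open>w\<close> and \<open>X\<close> is horizontal with \<open>dp(A X) = u\<close>, then \<open>A X A\<^sup>*\<close> is the horizontal lift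
  \<open>hor_lift w u\<close>. This lift does not depend on \<open>A\<close>, and conjugation by \<open>A\<close> is an isometry, so all choices
  of \<open>A\<close> give the same scalar product.
\<close>

lemma flag_metric_eq:
  assumes u: "hor_lift w u \<in> skew_hermitian" and v: "hor_lift w v \<in> skew_hermitian"
  shows "flag_metric w u v = u_inner (hor_lift w u) (hor_lift w v)"
proof -
  have deriv: "frechet_derivative affine_coords (at A) (A ** X) = action_field (A ** X ** ctranspose A) w"
    if "A \<in> affine_domain" "affine_coords A = w" for A X
    using frechet_derivative_at[OF has_derivative_affine_coords[OF that(1)]] that(2) by metis
  have hor: "hor_lift w (action_field (A ** X ** ctranspose A) w) = A ** X ** ctranspose A"
    if A: "A \<in> affine_domain" "affine_coords A = w" and X: "X \<in> horizontal" for A X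
  proof -
    have AA: "ctranspose A ** A = mat 1" using A(1) by (simp add: affine_domain_def unitary_group_def)
    have "homog_proj w j ** (A ** X ** ctranspose A) ** homog_proj w j = 0" for j
    proof -
      have "homog_proj w j ** (A ** X ** ctranspose A) ** homog_proj w j = A ** block_incl j **
        (ctranspose (block_incl j) ** (ctranspose A ** A) ** X ** (ctranspose A ** A) ** block_incl j) **
        ctranspose (block_incl j) ** ctranspose A"
        by (simp only: homog_gram_unitary(2)[OF A] matrix_assoc)
      also have "\<dots> = A ** block_incl j ** block X j j ** ctranspose (block_incl j) ** ctranspose A"
        by (simp add: AA block_eq)
      finally show ?thesis using X by (simp add: horizontal_iff)
    qed
    then show ?thesis by (simp add: hor_lift_action_field)
  qed
  have ex: "\<exists>X\<in>horizontal. frechet_derivative affine_coords (at A) (A ** X) = u \<and>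
      A ** X ** ctranspose A = hor_lift w u"
    if A: "A \<in> affine_domain" "affine_coords A = w" and u: "hor_lift w u \<in> skew_hermitian" for A u
  proof (intro bexI conjI)
    let ?X = "ctranspose A ** hor_lift w u ** A"
    have AA: "A ** ctranspose A = mat 1" "ctranspose A ** A = mat 1"
      using A(1) by (auto simp: affine_domain_def unitary_group_def)
    have "A ** ?X ** ctranspose A = (A ** ctranspose A) ** hor_lift w u ** (A ** ctranspose A)"
      by (simp only: matrix_assoc)
    then show AX: "A ** ?X ** ctranspose A = hor_lift w u" by (simp add: AA)
    show "frechet_derivative affine_coords (at A) (A ** ?X) = u"
      by (simp only: deriv[OF A] AX action_field_hor_lift)
    have "ctranspose ?X = - ?X"
      using u by (simp add: skew_hermitian_def ctranspose_mult matrix_distribs matrix_assoc)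
    moreover have "block ?X j j = 0" for j
    proof -
      have "block ?X j j = (ctranspose (block_incl j) ** block_incl j) ** block ?X j j ** (ctranspose (block_incl j) ** block_incl j)"
        by (simp add: block_incl_orthonormal)
      also have "\<dots> = ctranspose (block_incl j) ** (ctranspose A ** A) ** block_incl j ** ctranspose (block_incl j) ** ctranspose A
          ** hor_lift w u ** A ** block_incl j ** ctranspose (block_incl j) ** (ctranspose A ** A) ** block_incl j"
        by (simp only: AA matrix_mul_rid block_eq matrix_assoc)
      also have "\<dots> = ctranspose (block_incl j) ** ctranspose A **
          (homog_proj w j ** hor_lift w u ** homog_proj w j) ** A ** block_incl j"
        by (simp only: homog_gram_unitary(2)[OF A] matrix_assoc)
      finally show ?thesis by (simp add: homog_proj_hor_lift)
    qed
    ultimately show "?X \<in> horizontal" by (simp add: horizontal_iff skew_hermitian_def)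
  qed
  show ?thesis
    unfolding flag_metric_def
  proof (rule the_equality)
    obtain A where A: "A \<in> affine_domain" "affine_coords A = w" using exists_unitary_over[OF w] .
    have AA: "ctranspose A ** A = mat 1" using A(1) by (simp add: affine_domain_def unitary_group_def)
    obtain X Y where X: "X \<in> horizontal" "frechet_derivative affine_coords (at A) (A ** X) = u"
        "A ** X ** ctranspose A = hor_lift w u"
      and Y: "Y \<in> horizontal" "frechet_derivative affine_coords (at A) (A ** Y) = v"
        "A ** Y ** ctranspose A = hor_lift w v"
      using ex[OF A u] ex[OF A v] by blast
    have "u_inner (hor_lift w u) (hor_lift w v) = u_inner X Y"
      using u_inner_conjugate[OF AA, of X Y] X(3) Y(3) by simp
    with A X Y show "\<exists>A\<in>affine_domain. \<exists>X\<in>horizontal. \<exists>Y\<in>horizontal. affine_coords A = w \<and>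
        frechet_derivative affine_coords (at A) (A ** X) = u \<and>
        frechet_derivative affine_coords (at A) (A ** Y) = v \<and>
        u_inner (hor_lift w u) (hor_lift w v) = u_inner X Y" by blast
  next
    fix c assume "\<exists>A\<in>affine_domain. \<exists>X\<in>horizontal. \<exists>Y\<in>horizontal. affine_coords A = w \<and>
        frechet_derivative affine_coords (at A) (A ** X) = u \<and>
        frechet_derivative affine_coords (at A) (A ** Y) = v \<and> c = u_inner X Y"
    then obtain A X Y where A: "A \<in> affine_domain" "affine_coords A = w"
      and X: "X \<in> horizontal" "frechet_derivative affine_coords (at A) (A ** X) = u"
      and Y: "Y \<in> horizontal" "frechet_derivative affine_coords (at A) (A ** Y) = v"
      and c: "c = u_inner X Y" by blast
    have AA: "ctranspose A ** A = mat 1" using A(1) by (simp add: affine_domain_def unitary_group_def)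
    have "hor_lift w u = A ** X ** ctranspose A" "hor_lift w v = A ** Y ** ctranspose A"
      using hor[OF A X(1)] hor[OF A Y(1)] X(2) Y(2) by (simp_all only: deriv[OF A])
    then show "c = u_inner (hor_lift w u) (hor_lift w v)"
      by (simp add: c u_inner_conjugate[OF AA])
  qed
qed

text \<open>Parseval's identity for the horizontal lift of \<open>u\<close>, transported to \<open>w\<close> by the action.\<close>

lemma action_field_frame:
  assumes u: "hor_lift w u \<in> skew_hermitian"
  shows "(\<Sum>x\<in>UNIV. u_inner (hor_lift w (action_field (u_frame x) w)) (hor_lift w u) *\<^sub>R action_field (u_frame x) w) = u"
proof -
  have "(\<Sum>x\<in>UNIV. u_inner (u_frame x) (hor_lift w u) *\<^sub>R action_field (u_frame x) w) =
      action_field (\<Sum>x\<in>UNIV. u_inner (hor_lift w u) (u_frame x) *\<^sub>R u_frame x) w"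
    by (simp add: linear_sum[OF linear_action_field] linear_cmul[OF linear_action_field] u_inner_commute)
  then show ?thesis
    by (simp add: u_inner_hor_lift u_frame_parseval[OF u] action_field_hor_lift)
qed

end

section \<open>The affine image as a regular level set\<close>

text \<open>An enumeration, for each \<open>j\<close>, of the block indices other than \<open>j\<close>.\<close>

definition other_index :: "'k option \<Rightarrow> 'k \<Rightarrow> 'k option" where
  "other_index j i = (if j = Some i then None else Some i)"

lemma bij_betw_other_index: "bij_betw (other_index j) UNIV (- {j})"
  unfolding bij_betw_def
proof
  show "inj (other_index j)" by (auto simp: inj_def other_index_def)
  show "range (other_index j) = - {j}"
  proof (intro equalityI subsetI)
    fix l assume "l \<in> - {j}"
    then show "l \<in> range (other_index j)"
      by (cases l; cases j) (auto simp: other_index_def image_def)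
  qed (auto simp: other_index_def split: if_splits)
qed

text \<open>
  The off-diagonal blocks of a Hermitian family are determined by the sums of the real and the
  imaginary parts of their entries: opposite entries are conjugate, so the differences of the two
  parts occur as well. These are linear coordinates that do not single out one half of the index pairs.
\<close>

definition hermitian_coords ::
    "('k option \<Rightarrow> 'k option \<Rightarrow> complex^'m^'m) \<Rightarrow> real^('k::finite option \<times> 'k \<times> 'm::finite \<times> 'm)" where
  "hermitian_coords H = (\<chi> x. case x of (j, i, a, b) \<Rightarrow> Re (H j (other_index j i) $ a $ b) + Im (H j (other_index j i) $ a $ b))"

lemma hermitian_coords_eq_0_iff:
  assumes herm: "\<And>j l. ctranspose (H j l) = H l j"
  shows "hermitian_coords H = 0 \<longleftrightarrow> (\<forall>j l. j \<noteq> l \<longrightarrow> H j l = 0)"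
proof
  assume 0: "hermitian_coords H = 0"
  have re_im: "Re (H j l $ a $ b) + Im (H j l $ a $ b) = 0" if "j \<noteq> l" for j l a b
  proof -
    have "l \<in> - {j}" using that by auto
    then obtain i where "l = other_index j i"
      using bij_betw_other_index[of j] unfolding bij_betw_def by blast
    moreover have "hermitian_coords H $ (j, i, a, b) = 0" using 0 by simp
    ultimately show ?thesis by (simp add: hermitian_coords_def)
  qed
  show "\<forall>j l. j \<noteq> l \<longrightarrow> H j l = 0"
  proof (intro allI impI)
    fix j l :: "'a option" assume "j \<noteq> l"
    have "H j l $ a $ b = 0" for a b
    proof -
      have "H l j $ b $ a = cnj (H j l $ a $ b)"
        unfolding herm[of j l, symmetric] by (simp add: ctranspose_def)
      then show ?thesis
        using re_im[OF \<open>j \<noteq> l\<close>, of a b] re_im[of l j b a] \<open>j \<noteq> l\<close> by (simp add: complex_eq_iff)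
    qed
    then show "H j l = 0" by (simp add: vec_eq_iff)
  qed
next
  assume "\<forall>j l. j \<noteq> l \<longrightarrow> H j l = 0"
  moreover have "j \<noteq> other_index j i" for j :: "'a option" and i by (simp add: other_index_def)
  ultimately show "hermitian_coords H = 0" by (auto simp: hermitian_coords_def vec_eq_iff)
qed

lemma hermitian_coords_surj:
  "\<exists>H. (\<forall>j l. ctranspose (H j l) = H l j) \<and> hermitian_coords H = r"
proof -
  define s where "s j l a b = r $ (j, inv (other_index j) l, a, b)" for j l a b
  define H where "H j l = (\<chi> a b. Complex ((s j l a b + s l j b a) / 2) ((s j l a b - s l j b a) / 2))" for j l
  have "ctranspose (H j l) = H l j" for j l
    by (simp add: H_def ctranspose_def vec_eq_iff complex_eq_iff) (simp add: field_simps)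
  moreover have "hermitian_coords H $ (j, i, a, b) = r $ (j, i, a, b)" for j i a b
  proof -
    have "inv (other_index j) (other_index j i) = i"
      using bij_betw_other_index[of j] by (auto simp: bij_betw_def intro: inv_f_f)
    then show ?thesis
      by (simp add: hermitian_coords_def H_def s_def add_divide_distrib diff_divide_distrib)
  qed
  then have "hermitian_coords H = r" by (auto simp: vec_eq_iff)
  ultimately show ?thesis by blast
qed

definition affine_constraint ::
    "('k::finite, 'm::finite) affine_space \<Rightarrow> real^('k option \<times> 'k \<times> 'm \<times> 'm)" where
  "affine_constraint w = hermitian_coords (\<lambda>j l. ctranspose (w $ j) ** w $ l + mat 1)"

definition affine_constraint_deriv ::
    "('k::finite, 'm::finite) affine_space \<Rightarrow> ('k, 'm) affine_space \<Rightarrow> real^('k option \<times> 'k \<times> 'm \<times> 'm)" where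
  "affine_constraint_deriv w v = hermitian_coords (\<lambda>j l. ctranspose (w $ j) ** v $ l + ctranspose (v $ j) ** w $ l)"

lemma affine_image_eq:
  "(affine_image :: ('k::finite, 'm::finite) affine_space set) = {w. affine_constraint w = 0}"
proof -
  have "affine_constraint w = 0 \<longleftrightarrow> (\<forall>j l. j \<noteq> l \<longrightarrow> ctranspose (w $ j) ** w $ l + mat 1 = 0)"
    for w :: "('k, 'm) affine_space"
    unfolding affine_constraint_def
    by (rule hermitian_coords_eq_0_iff) (simp add: ctranspose_add ctranspose_mult)
  then show ?thesis by (simp add: affine_image_def eq_neg_iff_add_eq_0)
qed

lemma affine_constraint_deriv_eq_0_iff:
  "affine_constraint_deriv w v = 0 \<longleftrightarrow>
    (\<forall>j l. j \<noteq> l \<longrightarrow> ctranspose (v $ j) ** w $ l + ctranspose (w $ j) ** v $ l = 0)"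
  unfolding affine_constraint_deriv_def
  by (subst hermitian_coords_eq_0_iff) (simp_all add: ctranspose_add ctranspose_mult add.commute)

lemma has_derivative_affine_constraint:
  fixes w :: "('k::finite, 'm::finite) affine_space"
  shows "(affine_constraint has_derivative affine_constraint_deriv w) (at w)"
proof (rule has_derivative_vecI)
  fix x :: "'k option \<times> 'k \<times> 'm \<times> 'm"
  obtain j i a b where x: "x = (j, i, a, b)" by (cases x)
  let ?l = "other_index j i"
  have nth: "((\<lambda>w. w $ l) has_derivative (\<lambda>v. v $ l)) (at w)" for l
    by (rule bounded_linear_imp_has_derivative[OF bounded_linear_vec_nth])
  have "((\<lambda>w. ctranspose (w $ j) ** w $ ?l + mat 1) has_derivative
      (\<lambda>v. (ctranspose (w $ j) ** v $ ?l + ctranspose (v $ j) ** w $ ?l) + 0)) (at w)"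
    by (intro has_derivative_add has_derivative_const bounded_bilinear.FDERIV[OF bounded_bilinear_matrix_mult]
        bounded_linear.has_derivative[OF bounded_linear_ctranspose] nth)
  from has_derivative_vec_nth[OF has_derivative_vec_nth[OF this, of a], of b]
  have d: "((\<lambda>w. (ctranspose (w $ j) ** w $ ?l + mat 1) $ a $ b) has_derivative
      (\<lambda>v. (ctranspose (w $ j) ** v $ ?l + ctranspose (v $ j) ** w $ ?l) $ a $ b)) (at w)"
    by simp
  show "((\<lambda>w. affine_constraint w $ x) has_derivative (\<lambda>v. affine_constraint_deriv w v $ x)) (at w)"
    unfolding x affine_constraint_def affine_constraint_deriv_def hermitian_coords_def
    using has_derivative_add[OF bounded_linear.has_derivative[OF bounded_linear_Re d]
        bounded_linear.has_derivative[OF bounded_linear_Im d]]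
    by simp
qed

lemma smooth_on_affine_constraint:
  "smooth_on UNIV (affine_constraint :: ('k::finite, 'm::finite) affine_space \<Rightarrow> _)"
  unfolding smooth_on_def
proof
  fix r
  have "Ck_on r UNIV (\<lambda>w. affine_constraint w $ x)" for x :: "'k option \<times> 'k \<times> 'm \<times> 'm"
  proof -
    obtain j i a b where x: "x = (j, i, a, b)" by (cases x)
    let ?l = "other_index j i"
    have nth: "Ck_on r UNIV (\<lambda>w::('k, 'm) affine_space. w $ l)" for l
      by (intro Ck_on_linear bounded_linear_vec_nth) simp
    have "Ck_on r UNIV (\<lambda>w::('k, 'm) affine_space. (ctranspose (w $ j) ** w $ ?l + mat 1) $ a $ b)"
      by (intro Ck_on_vec_nth Ck_on_add Ck_on_const Ck_on_bilinear[OF bounded_bilinear_matrix_mult]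
          Ck_on_linear_compose[OF _ bounded_linear_ctranspose] nth open_UNIV)
    then have "Ck_on r UNIV (\<lambda>w::('k, 'm) affine_space. Re ((ctranspose (w $ j) ** w $ ?l + mat 1) $ a $ b) +
        Im ((ctranspose (w $ j) ** w $ ?l + mat 1) $ a $ b))"
      by (intro Ck_on_add Ck_on_linear_compose[OF _ bounded_linear_Re] Ck_on_linear_compose[OF _ bounded_linear_Im] open_UNIV)
    then show ?thesis by (simp add: x affine_constraint_def hermitian_coords_def)
  qed
  then show "Ck_on r UNIV (affine_constraint :: ('k, 'm) affine_space \<Rightarrow> _)"
    by (intro Ck_on_vecI open_UNIV)
qed

text \<open>
  Off the diagonal, the blocks \<open>w\<^sub>l\<^sup>* u\<^sub>j\<close> of a vector \<open>u\<close> can be prescribed arbitrarily; take half of the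
  desired Hermitian family. The vector is an action field whose generator \<open>Y\<close> need not be
  skew-Hermitian.
\<close>

lemma surj_affine_constraint_deriv:
  fixes w :: "('k::finite, 'm::finite) affine_space"
  assumes w: "w \<in> affine_image"
  shows "surj (affine_constraint_deriv w)"
proof -
  have "\<exists>u. affine_constraint_deriv w u = r" for r
  proof -
    obtain H :: "'k option \<Rightarrow> 'k option \<Rightarrow> complex^'m^'m"
      where herm: "\<And>j l. ctranspose (H j l) = H l j" and H: "hermitian_coords H = r"
      using hermitian_coords_surj[of r] by blast
    let ?V = "\<lambda>j. matrix_inv (homog_gram w j) ** ctranspose (homog w j)"
    define Y where "Y = (\<Sum>a\<in>UNIV. \<Sum>b\<in>UNIV. homog w a ** matrix_inv (homog_gram w a) ** ((1/2) *\<^sub>R H a b) ** ?V b)"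
    have V: "?V b ** homog w j = (if b = j then mat 1 else 0)" for b j
      using matrix_inv_inverse(2)[OF det_homog_gram[OF w, of j]] homog_orthogonal[OF w, of b j]
      by (auto simp: matrix_assoc homog_gram_def[symmetric])
    have V': "ctranspose (homog w l) ** homog w a ** matrix_inv (homog_gram w a) = (if a = l then mat 1 else 0)" for a l
      using matrix_inv_inverse(1)[OF det_homog_gram[OF w, of l]] homog_orthogonal[OF w, of l a]
      by (auto simp: homog_gram_def[symmetric])
    have Y: "ctranspose (homog w l) ** Y ** homog w j = (1/2) *\<^sub>R H l j" for l j
    proof -
      have "ctranspose (homog w l) ** Y ** homog w j = (\<Sum>a\<in>UNIV. \<Sum>b\<in>UNIV.
          (ctranspose (homog w l) ** homog w a ** matrix_inv (homog_gram w a)) ** ((1/2) *\<^sub>R H a b) ** (?V b ** homog w j))"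
        by (simp add: Y_def matrix_mult_sum_left matrix_mult_sum_right matrix_assoc)
      also have "\<dots> = (\<Sum>a\<in>UNIV. \<Sum>b\<in>UNIV. if l = a then if j = b then (1/2) *\<^sub>R H a b else 0 else 0)"
        unfolding V V' by (intro sum.cong refl) auto
      also have "\<dots> = (1/2) *\<^sub>R H l j" by (rule sum_sum_delta)
      finally show ?thesis .
    qed
    let ?u = "action_field Y w"
    have wu: "ctranspose (w $ l) ** ?u $ j = (1/2) *\<^sub>R H l j" if "l \<noteq> j" for l j
      using homog_action_field[OF w that, of Y] Y[of l j] by simp
    have "ctranspose (w $ j) ** ?u $ l + ctranspose (?u $ j) ** w $ l = H j l" if "j \<noteq> l" for j l
    proof -
      have "ctranspose (?u $ j) ** w $ l = ctranspose (ctranspose (w $ l) ** ?u $ j)"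
        by (simp add: ctranspose_mult)
      also have "\<dots> = (1/2) *\<^sub>R H j l"
        using that by (simp add: wu linear_cmul[OF bounded_linear.linear[OF bounded_linear_ctranspose]] herm)
      finally show ?thesis using that by (simp add: wu scaleR_add_left[symmetric])
    qed
    moreover have "j \<noteq> other_index j i" for j :: "'k option" and i by (simp add: other_index_def)
    ultimately have "affine_constraint_deriv w ?u = hermitian_coords H"
      by (simp add: affine_constraint_deriv_def hermitian_coords_def)
    then show ?thesis using H by blast
  qed
  then show ?thesis by (metis surj_def)
qed

lemma action_field_tangent:
  fixes w :: "('k::finite, 'm::finite) affine_space"
  assumes w: "w \<in> affine_image" and \<xi>: "\<xi> \<in> skew_hermitian"
  shows "affine_constraint_deriv w (action_field \<xi> w) = 0"
  unfolding affine_constraint_deriv_eq_0_iff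
proof (intro allI impI)
  fix j l :: "'k option" assume "j \<noteq> l"
  have "ctranspose (action_field \<xi> w $ j) ** w $ l = ctranspose (ctranspose (w $ l) ** action_field \<xi> w $ j)"
    by (simp add: ctranspose_mult)
  also have "\<dots> = - (ctranspose (homog w j) ** \<xi> ** homog w l)"
    using \<xi> \<open>j \<noteq> l\<close>
    by (simp add: homog_action_field[OF w] ctranspose_mult skew_hermitian_def matrix_distribs matrix_assoc)
  finally show "ctranspose (action_field \<xi> w $ j) ** w $ l + ctranspose (w $ j) ** action_field \<xi> w $ l = 0"
    using \<open>j \<noteq> l\<close> by (simp add: homog_action_field[OF w])
qed

section \<open>Expansion in Wirtinger derivatives\<close>

text \<open>
  The coefficients of a real linear form with respect to the differential of the coordinate
  \<open>w\<^bsub>j,pq\<^esub>\<close> and its conjugate. Applied to the derivative of a function they are its Wirtinger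
  derivatives.
\<close>

definition lin_part :: "'k option \<times> ('k \<times> 'm) \<times> 'm \<Rightarrow> (('k::finite, 'm::finite) affine_space \<Rightarrow> complex) \<Rightarrow> complex" where
  "lin_part = (\<lambda>(j, p, q) L. (L (coord_vec j p q 1) - \<i> * L (coord_vec j p q \<i>)) / 2)"

definition antilin_part :: "'k option \<times> ('k \<times> 'm) \<times> 'm \<Rightarrow> (('k::finite, 'm::finite) affine_space \<Rightarrow> complex) \<Rightarrow> complex" where
  "antilin_part = (\<lambda>(j, p, q) L. (L (coord_vec j p q 1) + \<i> * L (coord_vec j p q \<i>)) / 2)"

definition entry :: "('k::finite, 'm::finite) affine_space \<Rightarrow> 'k option \<times> ('k \<times> 'm) \<times> 'm \<Rightarrow> complex" where
  "entry v = (\<lambda>(j, p, q). v $ j $ p $ q)"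

lemma sum_triple: "(\<Sum>x\<in>UNIV. g x) = (\<Sum>a\<in>UNIV. \<Sum>b\<in>UNIV. \<Sum>c\<in>UNIV. g (a, b, c))"
  by (simp add: UNIV_Times_UNIV[symmetric] sum.cartesian_product' del: UNIV_Times_UNIV)

lemma linear_eq_wirtinger_parts:
  fixes L :: "('k::finite, 'm::finite) affine_space \<Rightarrow> complex"
  assumes L: "linear L"
  shows "L v = (\<Sum>x\<in>UNIV. entry v x * lin_part x L + cnj (entry v x) * antilin_part x L)"
proof -
  have c: "L (coord_vec j p q c) = c * lin_part (j, p, q) L + cnj c * antilin_part (j, p, q) L" for j p q c
  proof -
    have "coord_vec j p q c = Re c *\<^sub>R coord_vec j p q 1 + Im c *\<^sub>R (coord_vec j p q \<i> :: ('k, 'm) affine_space)"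
      by (auto simp: coord_vec_def axis_def vec_eq_iff complex_eq_iff)
    then have "L (coord_vec j p q c) = Re c *\<^sub>R L (coord_vec j p q 1) + Im c *\<^sub>R L (coord_vec j p q \<i>)"
      by (simp add: linear_add[OF L] linear_cmul[OF L])
    then show ?thesis
      by (simp add: lin_part_def antilin_part_def complex_eq_iff field_simps)
  qed
  have lin_axis: "axis j (\<Sum>i\<in>I. f i) = (\<Sum>i\<in>I. axis j (f i))" for j :: "'x::finite" and f :: "'i \<Rightarrow> 'y::real_normed_vector" and I
    by (rule linear_sum[OF bounded_linear.linear[OF bounded_linear_axis]])
  have "v = (\<Sum>j\<in>UNIV. axis j (\<Sum>p\<in>UNIV. axis p (\<Sum>q\<in>UNIV. axis q (v $ j $ p $ q))))"
    by (simp flip: vec_eq_sum_axis)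
  then have "v = (\<Sum>j\<in>UNIV. \<Sum>p\<in>UNIV. \<Sum>q\<in>UNIV. coord_vec j p q (v $ j $ p $ q))"
    by (simp only: lin_axis coord_vec_def)
  then have "L v = L (\<Sum>j\<in>UNIV. \<Sum>p\<in>UNIV. \<Sum>q\<in>UNIV. coord_vec j p q (v $ j $ p $ q))" by simp
  also have "\<dots> = (\<Sum>j\<in>UNIV. \<Sum>p\<in>UNIV. \<Sum>q\<in>UNIV. L (coord_vec j p q (v $ j $ p $ q)))"
    by (simp only: linear_sum[OF L])
  finally show ?thesis by (simp add: c sum_triple entry_def)
qed

lemma linear_parts:
  assumes "\<And>v. linear (\<lambda>u. \<beta> u v)"
  shows "linear (\<lambda>u. lin_part x (\<beta> u))" "linear (\<lambda>u. antilin_part x (\<beta> u))"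
  by (cases x; auto intro!: linearI simp: lin_part_def antilin_part_def linear_add[OF assms]
      linear_cmul[OF assms] scaleR_conv_of_real field_simps)+

lemma antilin_lin_part_commute:
  assumes "\<And>u v. \<beta> u v = \<beta> v u"
  shows "antilin_part x (\<lambda>u. lin_part y (\<beta> u)) = lin_part y (\<lambda>u. antilin_part x (\<beta> u))"
proof -
  have "antilin_part x (\<lambda>u. lin_part y (\<beta> u)) = lin_part y (\<lambda>v. antilin_part x (\<lambda>u. \<beta> u v))"
    by (cases x; cases y) (simp add: lin_part_def antilin_part_def field_simps)
  moreover have "(\<lambda>u. \<beta> u v) = \<beta> v" for v using assms by blast
  ultimately show ?thesis by simp
qed

text \<open>The two mixed terms coincide by symmetry, which explains the factor \<open>2\<close>.\<close>

lemma symmetric_bilinear_wirtinger_expansion: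
  fixes \<beta> :: "('k::finite, 'm::finite) affine_space \<Rightarrow> ('k, 'm) affine_space \<Rightarrow> complex"
  assumes lin: "\<And>u. linear (\<beta> u)" "\<And>v. linear (\<lambda>u. \<beta> u v)" and sym: "\<And>u v. \<beta> u v = \<beta> v u"
  shows "\<beta> v v =
    (\<Sum>x\<in>UNIV. \<Sum>y\<in>UNIV. entry v x * entry v y * lin_part x (\<lambda>u. lin_part y (\<beta> u))) +
    2 * (\<Sum>x\<in>UNIV. \<Sum>y\<in>UNIV. entry v x * cnj (entry v y) * lin_part x (\<lambda>u. antilin_part y (\<beta> u))) +
    (\<Sum>x\<in>UNIV. \<Sum>y\<in>UNIV. cnj (entry v x) * cnj (entry v y) * antilin_part x (\<lambda>u. antilin_part y (\<beta> u)))"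
proof -
  let ?e = "entry v"
  have "\<beta> v v = (\<Sum>y\<in>UNIV. ?e y * lin_part y (\<beta> v) + cnj (?e y) * antilin_part y (\<beta> v))"
    by (rule linear_eq_wirtinger_parts[OF lin(1)])
  also have "\<dots> = (\<Sum>y\<in>UNIV.
      ?e y * (\<Sum>x\<in>UNIV. ?e x * lin_part x (\<lambda>u. lin_part y (\<beta> u)) + cnj (?e x) * antilin_part x (\<lambda>u. lin_part y (\<beta> u))) +
      cnj (?e y) * (\<Sum>x\<in>UNIV. ?e x * lin_part x (\<lambda>u. antilin_part y (\<beta> u)) + cnj (?e x) * antilin_part x (\<lambda>u. antilin_part y (\<beta> u))))"
    using linear_eq_wirtinger_parts[where v=v, OF linear_parts(1)[of \<beta>, OF lin(2)]]
      linear_eq_wirtinger_parts[where v=v, OF linear_parts(2)[of \<beta>, OF lin(2)]] by simp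
  also have "\<dots> = (\<Sum>y\<in>UNIV. \<Sum>x\<in>UNIV. ?e x * ?e y * lin_part x (\<lambda>u. lin_part y (\<beta> u))) +
      (\<Sum>y\<in>UNIV. \<Sum>x\<in>UNIV. ?e y * cnj (?e x) * lin_part y (\<lambda>u. antilin_part x (\<beta> u))) +
      (\<Sum>y\<in>UNIV. \<Sum>x\<in>UNIV. ?e x * cnj (?e y) * lin_part x (\<lambda>u. antilin_part y (\<beta> u))) +
      (\<Sum>y\<in>UNIV. \<Sum>x\<in>UNIV. cnj (?e x) * cnj (?e y) * antilin_part x (\<lambda>u. antilin_part y (\<beta> u)))"
    unfolding antilin_lin_part_commute[of \<beta>, OF sym]
    by (simp add: sum_distrib_left sum.distrib distrib_left mult_ac)
  also have "(\<Sum>y\<in>UNIV. \<Sum>x\<in>UNIV. ?e x * ?e y * lin_part x (\<lambda>u. lin_part y (\<beta> u))) =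
      (\<Sum>x\<in>UNIV. \<Sum>y\<in>UNIV. ?e x * ?e y * lin_part x (\<lambda>u. lin_part y (\<beta> u)))" by (rule sum.swap)
  also have "(\<Sum>y\<in>UNIV. \<Sum>x\<in>UNIV. ?e x * cnj (?e y) * lin_part x (\<lambda>u. antilin_part y (\<beta> u))) =
      (\<Sum>x\<in>UNIV. \<Sum>y\<in>UNIV. ?e x * cnj (?e y) * lin_part x (\<lambda>u. antilin_part y (\<beta> u)))" by (rule sum.swap)
  also have "(\<Sum>y\<in>UNIV. \<Sum>x\<in>UNIV. cnj (?e x) * cnj (?e y) * antilin_part x (\<lambda>u. antilin_part y (\<beta> u))) =
      (\<Sum>x\<in>UNIV. \<Sum>y\<in>UNIV. cnj (?e x) * cnj (?e y) * antilin_part x (\<lambda>u. antilin_part y (\<beta> u)))" by (rule sum.swap)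
  finally show ?thesis by simp
qed

lemma sum_index_pairs:
  "(\<Sum>x\<in>UNIV. \<Sum>y\<in>UNIV. g x y) =
    (\<Sum>j\<in>UNIV. \<Sum>l\<in>UNIV. \<Sum>p\<in>UNIV. \<Sum>r\<in>UNIV. \<Sum>s\<in>UNIV. \<Sum>q\<in>UNIV. g (j, p, q) (l, r, s))"
proof -
  have "(\<Sum>x\<in>UNIV. \<Sum>y\<in>UNIV. g x y) =
      (\<Sum>j\<in>UNIV. \<Sum>p\<in>UNIV. \<Sum>q\<in>UNIV. \<Sum>l\<in>UNIV. \<Sum>r\<in>UNIV. \<Sum>s\<in>UNIV. g (j, p, q) (l, r, s))"
    by (simp only: sum_triple)
  also have "\<dots> = (\<Sum>j\<in>UNIV. \<Sum>p\<in>UNIV. \<Sum>l\<in>UNIV. \<Sum>q\<in>UNIV. \<Sum>r\<in>UNIV. \<Sum>s\<in>UNIV. g (j, p, q) (l, r, s))"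
    by (intro sum.cong refl) (rule sum.swap)
  also have "\<dots> = (\<Sum>j\<in>UNIV. \<Sum>l\<in>UNIV. \<Sum>p\<in>UNIV. \<Sum>q\<in>UNIV. \<Sum>r\<in>UNIV. \<Sum>s\<in>UNIV. g (j, p, q) (l, r, s))"
    by (intro sum.cong refl) (rule sum.swap)
  also have "\<dots> = (\<Sum>j\<in>UNIV. \<Sum>l\<in>UNIV. \<Sum>p\<in>UNIV. \<Sum>r\<in>UNIV. \<Sum>q\<in>UNIV. \<Sum>s\<in>UNIV. g (j, p, q) (l, r, s))"
    by (intro sum.cong refl) (rule sum.swap)
  also have "\<dots> = (\<Sum>j\<in>UNIV. \<Sum>l\<in>UNIV. \<Sum>p\<in>UNIV. \<Sum>r\<in>UNIV. \<Sum>s\<in>UNIV. \<Sum>q\<in>UNIV. g (j, p, q) (l, r, s))"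
    by (intro sum.cong refl) (rule sum.swap)
  finally show ?thesis .
qed

text \<open>
  Contraction with the frame turns the coefficients into those of the Laplacian. Mixed terms with
  different block indices vanish because the homogeneous coordinates are orthogonal, and pure terms
  with equal block indices because \<open>(I, -w\<^sub>j)\<close> annihilates \<open>(w\<^sub>j; I)\<close>.
\<close>

lemma sum_u_frame_bilinear:
  fixes \<beta> :: "('k::finite, 'm::finite) affine_space \<Rightarrow> ('k, 'm) affine_space \<Rightarrow> complex"
  assumes lin: "\<And>u. linear (\<beta> u)" "\<And>v. linear (\<lambda>u. \<beta> u v)" and sym: "\<And>u v. \<beta> u v = \<beta> v u"
    and w: "w \<in> affine_image"
  shows "(\<Sum>x\<in>UNIV. \<beta> (action_field (u_frame x) w) (action_field (u_frame x) w)) =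
      4 * (\<Sum>j\<in>UNIV. \<Sum>p\<in>UNIV. \<Sum>r\<in>UNIV. \<Sum>s\<in>UNIV. \<Sum>q\<in>UNIV.
            (mat 1 + w$j ** ctranspose (w$j)) $ p $ r * (mat 1 + ctranspose (w$j) ** w$j) $ s $ q *
            lin_part (j, p, q) (\<lambda>u. antilin_part (j, r, s) (\<beta> u)))
    - 2 * (\<Sum>j\<in>UNIV. \<Sum>l\<in>UNIV - {j}. \<Sum>p\<in>UNIV. \<Sum>r\<in>UNIV. \<Sum>s\<in>UNIV. \<Sum>q\<in>UNIV.
            (w$l - w$j) $ p $ s * (w$j - w$l) $ r $ q *
            lin_part (j, p, q) (\<lambda>u. lin_part (l, r, s) (\<beta> u)))
    - 2 * (\<Sum>j\<in>UNIV. \<Sum>l\<in>UNIV - {j}. \<Sum>p\<in>UNIV. \<Sum>r\<in>UNIV. \<Sum>s\<in>UNIV. \<Sum>q\<in>UNIV.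
            cnj ((w$l - w$j) $ p $ s) * cnj ((w$j - w$l) $ r $ q) *
            antilin_part (j, p, q) (\<lambda>u. antilin_part (l, r, s) (\<beta> u)))"
    (is "?sum = 4 * ?mixed - 2 * ?holo - 2 * ?anti")
proof -
  let ?K = "\<lambda>x. action_field (u_frame x) w"
  have e: "entry (?K x) (j, p, q) = (cohomog w j ** u_frame x ** homog w j) $ p $ q" for x j p q
    by (simp add: entry_def action_field_def)
  have holo: "(\<Sum>x\<in>UNIV. entry (?K x) (j, p, q) * entry (?K x) (l, r, s)) =
      - 2 * ((w$l - w$j) $ p $ s * (w$j - w$l) $ r $ q)" for j p q l r s
    unfolding e sum_u_frame_contract by (simp only: cohomog_homog mult.assoc)
  have anti: "(\<Sum>x\<in>UNIV. cnj (entry (?K x) (j, p, q)) * cnj (entry (?K x) (l, r, s))) =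
      - 2 * (cnj ((w$l - w$j) $ p $ s) * cnj ((w$j - w$l) $ r $ q))" for j p q l r s
    using arg_cong[OF holo[of j p q l r s], of cnj] by simp
  have mixed: "(\<Sum>x\<in>UNIV. entry (?K x) (j, p, q) * cnj (entry (?K x) (l, r, s))) =
      (if l = j then 2 * ((mat 1 + w$j ** ctranspose (w$j)) $ p $ r * (mat 1 + ctranspose (w$j) ** w$j) $ s $ q) else 0)"
    for j p q l r s
    unfolding e sum_u_frame_contract_cnj
    by (cases "l = j") (simp add: cohomog_self homog_self, simp add: homog_orthogonal[OF w])
  have pull: "(\<Sum>x\<in>UNIV. \<Sum>a\<in>UNIV. \<Sum>b\<in>UNIV. c x a b * d a b) = (\<Sum>a\<in>UNIV. \<Sum>b\<in>UNIV. (\<Sum>x\<in>UNIV. c x a b) * d a b)"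
    for c :: "'x::finite \<Rightarrow> 'a::finite \<Rightarrow> 'b::finite \<Rightarrow> complex" and d
    unfolding sum_distrib_right by (subst sum.swap, intro sum.cong refl, rule sum.swap)
  have drop: "(\<Sum>j\<in>UNIV. \<Sum>l\<in>UNIV. g j l) = (\<Sum>j\<in>UNIV. \<Sum>l\<in>UNIV - {j}. g j l)"
    if "\<And>j. g j j = 0" for g :: "'k option \<Rightarrow> 'k option \<Rightarrow> complex"
    using that by (intro sum.cong refl sum.mono_neutral_right) auto
  have "?sum =
    (\<Sum>a\<in>UNIV. \<Sum>b\<in>UNIV. (\<Sum>x\<in>UNIV. entry (?K x) a * entry (?K x) b) * lin_part a (\<lambda>u. lin_part b (\<beta> u))) +
    2 * (\<Sum>a\<in>UNIV. \<Sum>b\<in>UNIV. (\<Sum>x\<in>UNIV. entry (?K x) a * cnj (entry (?K x) b)) * lin_part a (\<lambda>u. antilin_part b (\<beta> u))) +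
    (\<Sum>a\<in>UNIV. \<Sum>b\<in>UNIV. (\<Sum>x\<in>UNIV. cnj (entry (?K x) a) * cnj (entry (?K x) b)) * antilin_part a (\<lambda>u. antilin_part b (\<beta> u)))"
    unfolding symmetric_bilinear_wirtinger_expansion[of \<beta>, OF lin sym] sum.distrib sum_distrib_left[symmetric] pull ..
  also have "(\<Sum>a\<in>UNIV. \<Sum>b\<in>UNIV. (\<Sum>x\<in>UNIV. entry (?K x) a * entry (?K x) b) * lin_part a (\<lambda>u. lin_part b (\<beta> u))) = - 2 * ?holo"
    unfolding sum_index_pairs holo
    by (subst drop, simp) (simp add: sum_distrib_left mult.assoc)
  also have "(\<Sum>a\<in>UNIV. \<Sum>b\<in>UNIV. (\<Sum>x\<in>UNIV. cnj (entry (?K x) a) * cnj (entry (?K x) b)) * antilin_part a (\<lambda>u. antilin_part b (\<beta> u))) = - 2 * ?anti"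
    unfolding sum_index_pairs anti
    by (subst drop, simp) (simp add: sum_distrib_left mult.assoc)
  also have "(\<Sum>a\<in>UNIV. \<Sum>b\<in>UNIV. (\<Sum>x\<in>UNIV. entry (?K x) a * cnj (entry (?K x) b)) * lin_part a (\<lambda>u. antilin_part b (\<beta> u))) = 2 * ?mixed"
  proof -
    have "(\<Sum>l\<in>UNIV. \<Sum>p\<in>UNIV. \<Sum>r\<in>UNIV. \<Sum>s\<in>UNIV. \<Sum>q\<in>UNIV. (if l = j then c p r s q else 0) * d l p r s q) =
        (\<Sum>p\<in>UNIV. \<Sum>r\<in>UNIV. \<Sum>s\<in>UNIV. \<Sum>q\<in>UNIV. c p r s q * d j p r s q)"
      for j :: "'k option" and c :: "'k \<times> 'm \<Rightarrow> 'k \<times> 'm \<Rightarrow> 'm \<Rightarrow> 'm \<Rightarrow> complex" and d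
      by (subst sum.remove[of UNIV j]) auto
    then show ?thesis
      unfolding sum_index_pairs mixed by (simp add: sum_distrib_left mult.assoc)
  qed
  finally show ?thesis by simp
qed

section \<open>The Laplace--Beltrami operator\<close>

theorem theorem2p1:
  fixes f :: "('k::finite, 'm::finite) affine_space \<Rightarrow> complex"
    and W :: "('k, 'm) affine_space set"
    and w :: "('k, 'm) affine_space"
  assumes "open W" and "affine_image \<subseteq> W" and "smooth_on W f"
    and "w \<in> affine_image"
  shows "flag_laplacian f w =
      4 * (\<Sum>j\<in>UNIV. \<Sum>p\<in>UNIV. \<Sum>r\<in>UNIV. \<Sum>s\<in>UNIV. \<Sum>q\<in>UNIV.
            (mat 1 + w$j ** ctranspose (w$j)) $ p $ r * (mat 1 + ctranspose (w$j) ** w$j) $ s $ q *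
            wirtinger j p q (wirtinger_bar j r s f) w)
    - 2 * (\<Sum>j\<in>UNIV. \<Sum>l\<in>UNIV - {j}. \<Sum>p\<in>UNIV. \<Sum>r\<in>UNIV. \<Sum>s\<in>UNIV. \<Sum>q\<in>UNIV.
            (w$l - w$j) $ p $ s * (w$j - w$l) $ r $ q *
            wirtinger j p q (wirtinger l r s f) w)
    - 2 * (\<Sum>j\<in>UNIV. \<Sum>l\<in>UNIV - {j}. \<Sum>p\<in>UNIV. \<Sum>r\<in>UNIV. \<Sum>s\<in>UNIV. \<Sum>q\<in>UNIV.
            cnj ((w$l - w$j) $ p $ s) * cnj ((w$j - w$l) $ r $ q) *
            wirtinger_bar j p q (wirtinger_bar l r s f) w)"
    (is "_ = ?rhs")
proof -
  have C2: "Ck_on 2 W f" using assms(3) by (simp add: smooth_on_def)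
  then have C2': "Ck_on (Suc (Suc 0)) W f" by (simp only: numeral_2_eq_2)
  have wW: "w \<in> W" using assms by blast
  define \<beta> where "\<beta> u v = frechet_derivative (\<lambda>y. frechet_derivative f (at y) v) (at w) u" for u v
  have d2: "((\<lambda>y. frechet_derivative f (at y) v) has_derivative (\<lambda>u. \<beta> u v)) (at w)" for v
    unfolding \<beta>_def by (rule Ck_on_SucD(1)[OF Ck_on_SucD(2)[OF C2'] wW])
  have lin2: "linear (\<lambda>u. \<beta> u v)" for v by (rule has_derivative_linear[OF d2])
  have sym: "\<beta> u v = \<beta> v u" for u v
    unfolding \<beta>_def by (rule symmetric_second_derivative[OF assms(1) wW C2])
  have lin1: "linear (\<beta> u)" for u using lin2[of u] by (simp add: sym[of _ u])

  have wirtinger_part: "frechet_derivative (wirtinger l r s f) (at w) = (\<lambda>u. lin_part (l, r, s) (\<beta> u))" for l r s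
  proof -
    have "((\<lambda>y. (frechet_derivative f (at y) (coord_vec l r s 1) -
        \<i> * frechet_derivative f (at y) (coord_vec l r s \<i>)) / 2) has_derivative
      (\<lambda>u. (\<beta> u (coord_vec l r s 1) - \<i> * \<beta> u (coord_vec l r s \<i>)) / 2)) (at w)"
      by (intro bounded_linear.has_derivative[OF bounded_linear_divide] has_derivative_diff has_derivative_mult_right d2)
    then have "(wirtinger l r s f has_derivative (\<lambda>u. lin_part (l, r, s) (\<beta> u))) (at w)"
      by (simp add: wirtinger_def[abs_def] lin_part_def)
    from frechet_derivative_at[OF this] show ?thesis by simp
  qed
  have wirtinger_bar_part: "frechet_derivative (wirtinger_bar l r s f) (at w) = (\<lambda>u. antilin_part (l, r, s) (\<beta> u))" for l r s
  proof -
    have "((\<lambda>y. (frechet_derivative f (at y) (coord_vec l r s 1) +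
        \<i> * frechet_derivative f (at y) (coord_vec l r s \<i>)) / 2) has_derivative
      (\<lambda>u. (\<beta> u (coord_vec l r s 1) + \<i> * \<beta> u (coord_vec l r s \<i>)) / 2)) (at w)"
      by (intro bounded_linear.has_derivative[OF bounded_linear_divide] has_derivative_add has_derivative_mult_right d2)
    then have "(wirtinger_bar l r s f has_derivative (\<lambda>u. antilin_part (l, r, s) (\<beta> u))) (at w)"
      by (simp add: wirtinger_bar_def[abs_def] antilin_part_def)
    from frechet_derivative_at[OF this] show ?thesis by simp
  qed
  have rhs: "?rhs = (\<Sum>x\<in>UNIV. \<beta> (action_field (u_frame x) w) (action_field (u_frame x) w))"
  proof -
    have "wirtinger j p q g w = lin_part (j, p, q) (frechet_derivative g (at w))"
      "wirtinger_bar j p q g w = antilin_part (j, p, q) (frechet_derivative g (at w))" for j p q g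
      by (simp_all add: wirtinger_def wirtinger_bar_def lin_part_def antilin_part_def)
    then show ?thesis
      unfolding sum_u_frame_bilinear[of \<beta>, OF lin1 lin2 sym assms(4)]
      by (simp only: wirtinger_part wirtinger_bar_part)
  qed

  \<comment> \<open>In any chart the Laplacian is the sum of the squares of the action fields of the frame, and
    the first order part of these squares cancels.\<close>
  define K where "K x = action_field (u_frame x :: ('k, 'm) block_matrix)" for x
  define K' where "K' x = action_field_deriv (u_frame x :: ('k, 'm) block_matrix)" for x
  have dK: "(K x has_derivative K' x y) (at y)" for x y
    unfolding K_def K'_def by (rule has_derivative_action_field)
  have "frechet_derivative (\<lambda>w. frechet_derivative f (at w) (K x w)) (at w) (K x w) =
      \<beta> (K x w) (K x w) + frechet_derivative f (at w) (K' x w (K x w))" for x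
    unfolding \<beta>_def
    by (rule fun_cong[OF frechet_derivative_at[OF has_derivative_moving_direction[OF assms(1) wW C2 dK], symmetric]])
  moreover have "(\<Sum>x\<in>UNIV. frechet_derivative f (at w) (K' x w (K x w))) = 0"
  proof -
    have lin: "linear (frechet_derivative f (at w))"
      by (rule has_derivative_linear[OF Ck_on_SucD(1)[OF C2' wW]])
    have "(\<Sum>x\<in>UNIV. frechet_derivative f (at w) (K' x w (K x w))) =
        frechet_derivative f (at w) (\<Sum>x\<in>UNIV. K' x w (K x w))"
      by (simp add: linear_sum[OF lin])
    then show ?thesis
      by (simp add: K_def K'_def sum_action_field_deriv_self linear_0[OF lin])
  qed
  ultimately have sum_K2: "(\<Sum>x\<in>UNIV. frechet_derivative (\<lambda>w. frechet_derivative f (at w) (K x w)) (at w) (K x w)) = ?rhs"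
    unfolding rhs by (simp add: sum.distrib K_def)

  have dim: "DIM(('k, 'm) affine_space) = CARD('k option \<times> 'k \<times> 'm \<times> 'm) + CARD('k option \<times> 'k \<times> 'm \<times> 'm)"
    by simp
  have chart: "laplace_beltrami_in_chart flag_metric \<phi> f y = ?rhs"
    if \<phi>: "local_parametrization affine_image V \<phi>" and y: "y \<in> V" "\<phi> y = w"
    for V and \<phi> :: "real^('k option \<times> 'k \<times> 'm \<times> 'm) \<Rightarrow> ('k, 'm) affine_space" and y
  proof -
    have image: "\<phi> z \<in> affine_image" if "z \<in> V" for z
      by (rule local_parametrizationD(3)[OF \<phi> that])
    have tangent: "range (frechet_derivative \<phi> (at z)) = {v. affine_constraint_deriv (\<phi> z) v = 0}" if "z \<in> V" for z
      using range_derivative_local_parametrization[OF \<phi>[unfolded affine_image_eq] that dim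
          has_derivative_affine_constraint surj_affine_constraint_deriv[OF image[OF that]]] .
    have lift: "hor_lift (\<phi> z) u \<in> skew_hermitian"
      if "z \<in> V" "u \<in> range (frechet_derivative \<phi> (at z))" for z u
      using that by (intro hor_lift_skew_hermitian image) (auto simp: tangent affine_constraint_deriv_eq_0_iff)
    have "laplace_beltrami_in_chart flag_metric \<phi> f y =
        (\<Sum>x\<in>UNIV. frechet_derivative (\<lambda>w. frechet_derivative f (at w) (K x w)) (at (\<phi> y)) (K x (\<phi> y)))"
    proof (rule laplace_beltrami_in_chart_killing_frame[OF \<phi> y(1) dK, where W=W and
          B="\<lambda>w u v. u_inner (hor_lift w u) (hor_lift w v)" and
          c="\<lambda>x y z. u_inner (u_frame y ** u_frame x - u_frame x ** u_frame y) (u_frame z :: ('k, 'm) block_matrix)"])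
      show "K x (\<phi> z) \<in> range (frechet_derivative \<phi> (at z))" if "z \<in> V" for z x
        using action_field_tangent[OF image[OF that] u_frame_skew_hermitian] by (simp add: tangent[OF that] K_def)
      show "flag_metric (\<phi> z) u v = u_inner (hor_lift (\<phi> z) u) (hor_lift (\<phi> z) v)"
        if "z \<in> V" "u \<in> range (frechet_derivative \<phi> (at z))" "v \<in> range (frechet_derivative \<phi> (at z))" for z u v
        by (intro flag_metric_eq image lift that)
      show "linear (\<lambda>v. u_inner (hor_lift w u) (hor_lift w v))" "linear (\<lambda>u. u_inner (hor_lift w u) (hor_lift w v))"
        if "w \<in> affine_image" for w u v :: "('k, 'm) affine_space"
        using linear_compose[OF linear_hor_lift[OF that] bounded_linear.linear[OF bounded_bilinear.bounded_linear_right[OF bounded_bilinear_u_inner]]]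
          linear_compose[OF linear_hor_lift[OF that] bounded_linear.linear[OF bounded_bilinear.bounded_linear_left[OF bounded_bilinear_u_inner]]]
        by (auto simp: o_def)
      show "(\<Sum>x\<in>UNIV. u_inner (hor_lift (\<phi> z) (K x (\<phi> z))) (hor_lift (\<phi> z) u) *\<^sub>R K x (\<phi> z)) = u"
        if "z \<in> V" "u \<in> range (frechet_derivative \<phi> (at z))" for z u
        unfolding K_def by (intro action_field_frame image lift that)
      show "K' j w (K i w) - K' i w (K j w) =
          (\<Sum>l\<in>UNIV. u_inner (u_frame j ** u_frame i - u_frame i ** u_frame j) (u_frame l) *\<^sub>R K l w)" for i j w
      proof -
        let ?C = "u_frame j ** u_frame i - u_frame i ** u_frame j :: ('k, 'm) block_matrix"
        have skew: "?C \<in> skew_hermitian"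
          using u_frame_skew_hermitian[of i] u_frame_skew_hermitian[of j]
          by (simp add: skew_hermitian_def ctranspose_diff ctranspose_mult matrix_distribs)
        have "K' j w (K i w) - K' i w (K j w) = action_field (\<Sum>l\<in>UNIV. u_inner ?C (u_frame l) *\<^sub>R u_frame l) w"
          unfolding u_frame_parseval[OF skew] K_def K'_def by (rule action_field_bracket)
        then show ?thesis
          by (simp add: linear_sum[OF linear_action_field] linear_cmul[OF linear_action_field] K_def)
      qed
      show "u_inner (u_frame j ** u_frame i - u_frame i ** u_frame j) (u_frame l :: ('k, 'm) block_matrix) =
          - u_inner (u_frame l ** u_frame i - u_frame i ** u_frame l) (u_frame j)" for i j l
        by (intro u_inner_commutator_antisym u_frame_skew_hermitian)
    qed (use assms C2 in auto)
    then show ?thesis by (simp only: y(2) sum_K2)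
  qed
  have "surj (frechet_derivative affine_constraint (at w))"
    using surj_affine_constraint_deriv[OF assms(4)] frechet_derivative_at[OF has_derivative_affine_constraint]
    by metis
  then obtain V and \<phi> :: "real^('k option \<times> 'k \<times> 'm \<times> 'm) \<Rightarrow> ('k, 'm) affine_space"
    where "local_parametrization affine_image V \<phi>" "w \<in> \<phi> ` V"
    using regular_level_set_parametrization[OF smooth_on_affine_constraint dim] assms(4)
    unfolding affine_image_eq by blast
  then show ?thesis
    unfolding flag_laplacian_def laplace_beltrami_def
    using chart by (intro the_equality) (force, blast)
qed

end
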